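(* Let $K$ be a totally real field of degree $d$, let $(V,Q)$ be an $n$-dimensional $K$-vector space with a nondegenerate symmetric bilinear form, and let $Q_0$ be the corestricted form on $\mathrm{Cor}_{K/\mathbb{Q}}(V)$. (1) $K$ admits a canonical embedding $\phi$ into $\mathrm{End}(\mathrm{Cor}_{K/\mathbb{Q}}(V),\mathbb{Q})$. Moreover, $\phi(k)\in\mathrm{End}(\mathrm{Cor}_{K/\mathbb{Q}}(V),\mathbb{Z})$ for any $k\in\mathcal{O}_K$. (2) $Q_0$ takes coefficients in $\mathbb{Q}$ on $\mathrm{Cor}_{K/\mathbb{Q}}(V)$. Moreover, with $\phi$ the canonical embedding of $K$ into $\mathrm{End}(\mathrm{Cor}_{K/\mathbb{Q}}(V),\mathbb{Q})$ and $f:V\to\mathrm{Cor}_{K/\mathbb{Q}}(V)$ the canonical isomorphism of $\mathbb{Q}$-vector spaces, one has $$Q_0(\phi(k)f(v),f(w))=\mathrm{Tr}_{K/\mathbb{Q}}(k\cdot Q(v,w))$$ for all $k\in K$ and $v,w\in V$. The discriminant group of $Q_0$ has order $$|\mathrm{disc}(Q_0)|=\mathrm{disc}(K/\mathbb{Q})^n\cdot\mathrm{Norm}_{K/\mathbb{Q}}(\mathrm{disc}(Q)).$$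
   Context: Let $\sigma_1,\dots,\sigma_d$ be the real embeddings of $K$. Then $V\otimes_{\mathbb{Q}}\mathbb{R}\cong(K^{\sigma_1})^n\oplus\cdots\oplus(K^{\sigma_d})^n$, where $K^{\sigma_i}$ is $\mathbb{R}$ with $K$ embedded via $\sigma_i$; a vector $kv$ maps to $(\sigma_1(k)v^{(1)},\dots,\sigma_d(k)v^{(d)})$. The Galois group $G=\mathrm{Gal}(K/\mathbb{Q})$ acts semilinearly: if $\sigma_j=\sigma_i\circ g$, then $g$ takes $\sigma_i(k)\otimes v^{(i)}$ to $\sigma_j(k)\otimes v^{(j)}$. The corestriction $\mathrm{Cor}_{K/\mathbb{Q}}(V)=(V\otimes_{\mathbb{Q}}\mathbb{R})^G$ is the $\mathbb{Q}$-subspace of invariants, i.e. the image of $V$ under the canonical map $f:v\mapsto(v^{(1)},\dots,v^{(d)})$ (for $n=1$, the Minkowski embedding of $K$). The corestricted form is $Q_0=Q^{\sigma_1}\oplus\cdots\oplus Q^{\sigma_d}$, where $Q^{\sigma_i}(r_1\otimes\sigma_i(x),r_2\otimes\sigma_i(y))=r_1r_2\,\sigma_i(Q(x,y))$. For a projective $\mathcal{O}_K$-lattice $\Lambda\subset V$, $\mathrm{Cor}_{K/\mathbb{Q}}(\Lambda,Q)$ is the $\mathbb{Z}$-lattice $f(\Lambda)$ with the form $Q_0$. $\mathrm{End}(\mathrm{Cor}_{K/\mathbb{Q}}(V),\mathbb{Q})$ denotes $\mathbb{Q}$-linear endomorphisms, and $\mathrm{End}(\mathrm{Cor}_{K/\mathbb{Q}}(V),\mathbb{Z})$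 those preserving the integral structure $f(\Lambda)$ coming from an $\mathcal{O}_K$-lattice $\Lambda$. The discriminant statement refers to an $\mathcal{O}_K$-lattice $\Lambda\subset V$ on which $Q$ takes values in $\mathcal{O}_K$. $\mathrm{disc}(Q)$ is the discriminant (Gram determinant, as an ideal) of $Q$ on $\Lambda$, $\mathrm{Norm}_{K/\mathbb{Q}}$ is its absolute norm, and $|\mathrm{disc}(Q_0)|$ is the order of the discriminant group $f(\Lambda)^\vee/f(\Lambda)$ of $(f(\Lambda),Q_0)$. *)

theory Defs
  imports "HOL-Analysis.Analysis" "HOL-Computational_Algebra.Polynomial"
begin

section \<open>Totally real number fields\<close>

text \<open>The number field \<open>K\<close> is a type \<open>'k\<close> of characteristic 0, regarded as a
  \<open>\<rat>\<close>-vector space through \<open>of_rat\<close>.\<close>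

abbreviation rat_scale :: "rat \<Rightarrow> 'k::field_char_0 \<Rightarrow> 'k" where
  "rat_scale \<equiv> (\<lambda>q x. of_rat q * x)"

definition field_degree :: "'k::field_char_0 itself \<Rightarrow> nat" where
  "field_degree _ = vector_space.dim rat_scale (UNIV :: 'k set)"

definition number_field :: "'k::field_char_0 itself \<Rightarrow> bool" where
  "number_field _ \<longleftrightarrow> (\<exists>B :: 'k set. finite B \<and> module.span rat_scale B = UNIV)"

definition field_embedding :: "('k::field \<Rightarrow> 'l::field) \<Rightarrow> bool" where
  "field_embedding \<tau> \<longleftrightarrow> \<tau> 1 = 1 \<and> (\<forall>x y. \<tau> (x + y) = \<tau> x + \<tau> y) \<and> (\<forall>x y. \<tau> (x * y) = \<tau> x * \<tau> y)"

definition totally_real_field :: "'k::field_char_0 itself \<Rightarrow> bool" where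
  "totally_real_field T \<longleftrightarrow> number_field T \<and>
     (\<forall>\<tau> :: 'k \<Rightarrow> complex. field_embedding \<tau> \<longrightarrow> range \<tau> \<subseteq> \<real>)"

definition real_embeddings :: "('k::field_char_0 \<Rightarrow> real) set" where
  "real_embeddings = {\<sigma>. field_embedding \<sigma>}"

definition ring_of_integers :: "'k::field_char_0 set" where
  "ring_of_integers = {x. algebraic_int x}"

text \<open>Trace of an endomorphism of a finite-dimensional space; the value does not depend on
  the basis that is picked.\<close>

definition endo_trace :: "('a::field \<Rightarrow> 'b::ab_group_add \<Rightarrow> 'b) \<Rightarrow> ('b \<Rightarrow> 'b) \<Rightarrow> 'a" where
  "endo_trace smul T =
     (let B = (SOME B. \<not> module.dependent smul B \<and> module.span smul B = UNIV)
      in \<Sum>b\<in>B. module.representation smul B (T b) b)"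

definition field_trace :: "'k::field_char_0 \<Rightarrow> rat" where
  "field_trace x = endo_trace rat_scale ((*) x)"

definition integral_basis :: "('d::finite \<Rightarrow> 'k::field_char_0) \<Rightarrow> bool" where
  "integral_basis b \<longleftrightarrow>
     bij_betw (\<lambda>c :: 'd \<Rightarrow> int. \<Sum>i\<in>UNIV. of_int (c i) * b i) UNIV ring_of_integers"

text \<open>The index type \<open>'d\<close> has to have as many elements as the degree of \<open>K\<close>.\<close>

definition field_disc :: "'d::finite itself \<Rightarrow> 'k::field_char_0 itself \<Rightarrow> rat" where
  "field_disc _ _ = (THE D. \<exists>b :: 'd \<Rightarrow> 'k. integral_basis b \<and>
     D = det (\<chi> i j. field_trace (b i * b j)))"

definition quotient_group :: "'a::ab_group_add set \<Rightarrow> 'a set \<Rightarrow> 'a set set" where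
  "quotient_group A B = A // {(x, y). x - y \<in> B}"

definition ideal_norm :: "'k::field_char_0 set \<Rightarrow> nat" where
  "ideal_norm I = card (quotient_group ring_of_integers I)"


section \<open>Quadratic spaces and lattices over \<open>K\<close>\<close>

definition basis_family :: "('k::field \<Rightarrow> 'v::ab_group_add \<Rightarrow> 'v) \<Rightarrow> ('n::finite \<Rightarrow> 'v) \<Rightarrow> bool" where
  "basis_family smul e \<longleftrightarrow>
     inj e \<and> \<not> module.dependent smul (range e) \<and> module.span smul (range e) = UNIV"

definition nondegenerate_symmetric_form ::
    "('k::field \<Rightarrow> 'v::ab_group_add \<Rightarrow> 'v) \<Rightarrow> ('v \<Rightarrow> 'v \<Rightarrow> 'k) \<Rightarrow> bool" where
  "nondegenerate_symmetric_form smul Q \<longleftrightarrow>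
     (\<forall>x. Vector_Spaces.linear smul (*) (\<lambda>y. Q x y)) \<and>
     (\<forall>y. Vector_Spaces.linear smul (*) (\<lambda>x. Q x y)) \<and>
     (\<forall>x y. Q x y = Q y x) \<and>
     (\<forall>x. (\<forall>y. Q x y = 0) \<longrightarrow> x = 0)"

definition integer_span ::
    "('k::field_char_0 \<Rightarrow> 'v::ab_group_add \<Rightarrow> 'v) \<Rightarrow> 'v set \<Rightarrow> 'v set" where
  "integer_span smul S =
     {\<Sum>s\<in>T. smul (c s) s | T c. finite T \<and> T \<subseteq> S \<and> c ` T \<subseteq> ring_of_integers}"

text \<open>Lattices have full rank. Projectivity is automatic, because a finitely generated
  torsion-free module over the Dedekind domain of integers is projective.\<close>

definition integer_lattice ::
    "('k::field_char_0 \<Rightarrow> 'v::ab_group_add \<Rightarrow> 'v) \<Rightarrow> 'v set \<Rightarrow> bool" where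
  "integer_lattice smul L \<longleftrightarrow>
     (\<exists>S. finite S \<and> L = integer_span smul S) \<and> module.span smul L = UNIV"

text \<open>A lattice need not be free, so the discriminant is the ideal generated by the Gram
  determinants of all families of \<open>CARD('n)\<close> elements of \<open>L\<close>. If \<open>L\<close> is free, the Gram
  determinant of a basis generates this ideal.\<close>

definition disc_ideal ::
    "'n::finite itself \<Rightarrow> ('v \<Rightarrow> 'v \<Rightarrow> 'k::field_char_0) \<Rightarrow> 'v set \<Rightarrow> 'k set" where
  "disc_ideal _ Q L =
     integer_span (*) {det (\<chi> i j. Q (x i) (x j)) | x :: 'n \<Rightarrow> 'v. range x \<subseteq> L}"


section \<open>Corestriction\<close>

text \<open>\<open>'d\<close> indexes the real embeddings \<open>\<sigma>\<close> and \<open>e :: 'n \<Rightarrow> 'v\<close> is a \<open>K\<close>-basis of \<open>V\<close>.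
  The tensor product of \<open>V\<close> and \<open>\<real>\<close> over \<open>\<rat>\<close> is the direct sum, over the embeddings, of the
  tensor products over \<open>K\<close>, where \<open>K\<close> acts on \<open>\<real>\<close> through \<open>\<sigma> j\<close>. The \<open>j\<close>-th summand is
  identified with \<open>real^'n\<close> through \<open>e\<close>, so that the whole space becomes \<open>real^'n^'d\<close>.\<close>

definition base_change_vec ::
    "('k::field \<Rightarrow> 'v::ab_group_add \<Rightarrow> 'v) \<Rightarrow> ('n::finite \<Rightarrow> 'v) \<Rightarrow> ('k \<Rightarrow> real) \<Rightarrow> 'v \<Rightarrow> real^'n" where
  "base_change_vec smul e \<tau> v = (\<chi> i. \<tau> (module.representation smul (range e) v (e i)))"

text \<open>The \<open>\<real>\<close>-bilinear extension of \<open>Q\<close> along \<open>\<tau>\<close>; see \<open>base_change_form_tensor\<close> below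
  for its values on pure tensors.\<close>

definition base_change_form ::
    "('n::finite \<Rightarrow> 'v) \<Rightarrow> ('k \<Rightarrow> real) \<Rightarrow> ('v \<Rightarrow> 'v \<Rightarrow> 'k) \<Rightarrow> real^'n \<Rightarrow> real^'n \<Rightarrow> real" where
  "base_change_form e \<tau> Q x y = (\<Sum>a\<in>UNIV. \<Sum>b\<in>UNIV. x $ a * y $ b * \<tau> (Q (e a) (e b)))"

definition cor_map ::
    "('k::field \<Rightarrow> 'v::ab_group_add \<Rightarrow> 'v) \<Rightarrow> ('n::finite \<Rightarrow> 'v) \<Rightarrow> ('d::finite \<Rightarrow> 'k \<Rightarrow> real) \<Rightarrow>
     'v \<Rightarrow> real^'n^'d" where
  "cor_map smul e \<sigma> v = (\<chi> j. base_change_vec smul e (\<sigma> j) v)"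

definition cor_space ::
    "('k::field \<Rightarrow> 'v::ab_group_add \<Rightarrow> 'v) \<Rightarrow> ('n::finite \<Rightarrow> 'v) \<Rightarrow> ('d::finite \<Rightarrow> 'k \<Rightarrow> real) \<Rightarrow>
     (real^'n^'d) set" where
  "cor_space smul e \<sigma> = range (cor_map smul e \<sigma>)"

definition cor_form ::
    "('n::finite \<Rightarrow> 'v) \<Rightarrow> ('d::finite \<Rightarrow> 'k \<Rightarrow> real) \<Rightarrow> ('v \<Rightarrow> 'v \<Rightarrow> 'k) \<Rightarrow>
     real^'n^'d \<Rightarrow> real^'n^'d \<Rightarrow> real" where
  "cor_form e \<sigma> Q x y = (\<Sum>j\<in>UNIV. base_change_form e (\<sigma> j) Q (x $ j) (y $ j))"

text \<open>Endomorphisms of a subset \<open>C\<close> are functions that are \<open>undefined\<close> outside \<open>C\<close>, so that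
  equality of endomorphisms is equality on \<open>C\<close>.\<close>

definition rat_End :: "'a::real_vector set \<Rightarrow> ('a \<Rightarrow> 'a) set" where
  "rat_End C = {T \<in> C \<rightarrow>\<^sub>E C. (\<forall>x\<in>C. \<forall>y\<in>C. T (x + y) = T x + T y) \<and>
                          (\<forall>q::rat. \<forall>x\<in>C. T (of_rat q *\<^sub>R x) = of_rat q *\<^sub>R T x)}"

definition int_End :: "'a::real_vector set \<Rightarrow> 'a set \<Rightarrow> ('a \<Rightarrow> 'a) set" where
  "int_End C M = {T \<in> rat_End C. T ` M \<subseteq> M}"

definition rat_End_embedding :: "'a::real_vector set \<Rightarrow> ('k::field \<Rightarrow> 'a \<Rightarrow> 'a) \<Rightarrow> bool" where
  "rat_End_embedding C \<phi> \<longleftrightarrow>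
     range \<phi> \<subseteq> rat_End C \<and> inj \<phi> \<and>
     \<phi> 1 = (\<lambda>x\<in>C. x) \<and>
     (\<forall>k l. \<phi> (k + l) = (\<lambda>x\<in>C. \<phi> k x + \<phi> l x)) \<and>
     (\<forall>k l. \<phi> (k * l) = compose C (\<phi> k) (\<phi> l))"

text \<open>\<open>K\<close> acts on the \<open>j\<close>-th summand through \<open>\<sigma> j\<close>.\<close>

definition cor_mult ::
    "('k::field \<Rightarrow> 'v::ab_group_add \<Rightarrow> 'v) \<Rightarrow> ('n::finite \<Rightarrow> 'v) \<Rightarrow> ('d::finite \<Rightarrow> 'k \<Rightarrow> real) \<Rightarrow>
     'k \<Rightarrow> real^'n^'d \<Rightarrow> real^'n^'d" where
  "cor_mult smul e \<sigma> k = (\<lambda>x \<in> cor_space smul e \<sigma>. \<chi> j. \<sigma> j k *\<^sub>R (x $ j))"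

definition dual_lattice :: "('a \<Rightarrow> 'a \<Rightarrow> real) \<Rightarrow> 'a set \<Rightarrow> 'a set \<Rightarrow> 'a set" where
  "dual_lattice B C M = {x \<in> C. \<forall>y\<in>M. B x y \<in> \<int>}"

definition discriminant_group ::
    "('k::field \<Rightarrow> 'v::ab_group_add \<Rightarrow> 'v) \<Rightarrow> ('n::finite \<Rightarrow> 'v) \<Rightarrow> ('d::finite \<Rightarrow> 'k \<Rightarrow> real) \<Rightarrow>
     ('v \<Rightarrow> 'v \<Rightarrow> 'k) \<Rightarrow> 'v set \<Rightarrow> (real^'n^'d) set set" where
  "discriminant_group smul e \<sigma> Q L =
     quotient_group
       (dual_lattice (cor_form e \<sigma> Q) (cor_space smul e \<sigma>) (cor_map smul e \<sigma> ` L))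
       (cor_map smul e \<sigma> ` L)"

lemma basis_family_expansion:
  assumes "vector_space smul" "basis_family smul e"
  shows "v = (\<Sum>a\<in>UNIV. smul (module.representation smul (range e) v (e a)) (e a))"
proof -
  interpret vector_space smul by fact
  have e: "inj e" "independent (range e)" "span (range e) = UNIV"
    using assms(2) by (auto simp: basis_family_def)
  have "(\<Sum>b\<in>range e. smul (representation (range e) v b) b) = v"
    by (rule sum_representation_eq) (use e in auto)
  then show ?thesis
    using e(1) by (simp add: sum.reindex)
qed

lemma field_embedding_sum:
  assumes "field_embedding \<tau>" "finite A"
  shows "\<tau> (\<Sum>a\<in>A. g a) = (\<Sum>a\<in>A. \<tau> (g a))"
proof -
  have add: "\<tau> (x + y) = \<tau> x + \<tau> y" for x y
    using assms(1) by (auto simp: field_embedding_def)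
  have "\<tau> 0 = 0"
    using add[of 0 0] by (metis add_0 add_cancel_left_right)
  with assms(2) show ?thesis
    by (induction A rule: finite_induct) (auto simp: add)
qed

lemma base_change_form_tensor:
  assumes V: "vector_space smul" "basis_family smul e"
    and \<tau>: "field_embedding \<tau>" and Q: "nondegenerate_symmetric_form smul Q"
  shows "base_change_form e \<tau> Q (r *\<^sub>R base_change_vec smul e \<tau> x) (s *\<^sub>R base_change_vec smul e \<tau> y)
           = r * s * \<tau> (Q x y)"
proof -
  define c where "c v a = module.representation smul (range e) v (e a)" for v a
  have expand: "v = (\<Sum>a\<in>UNIV. smul (c v a) (e a))" for v
    unfolding c_def by (rule basis_family_expansion[OF V])
  have lin: "Vector_Spaces.linear smul (*) (\<lambda>w. Q u w)"
            "Vector_Spaces.linear smul (*) (\<lambda>w. Q w u)" for u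
    using Q by (auto simp: nondegenerate_symmetric_form_def)
  interpret L: Vector_Spaces.linear smul "(*)" "\<lambda>w. Q u w" for u by (rule lin)
  interpret R: Vector_Spaces.linear smul "(*)" "\<lambda>w. Q w u" for u by (rule lin)
  have "Q x y = Q (\<Sum>a\<in>UNIV. smul (c x a) (e a)) (\<Sum>b\<in>UNIV. smul (c y b) (e b))"
    using expand by metis
  also have "\<dots> = (\<Sum>a\<in>UNIV. \<Sum>b\<in>UNIV. c x a * c y b * Q (e a) (e b))"
    by (simp add: L.sum R.sum L.scale R.scale sum_distrib_left mult.assoc mult.left_commute)
       (rule sum.swap)
  finally have "\<tau> (Q x y) = (\<Sum>a\<in>UNIV. \<Sum>b\<in>UNIV. \<tau> (c x a) * \<tau> (c y b) * \<tau> (Q (e a) (e b)))"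
    using \<tau> by (simp add: field_embedding_sum[OF \<tau>]) (simp add: field_embedding_def)
  then show ?thesis
    by (simp add: base_change_form_def base_change_vec_def c_def[symmetric] sum_distrib_left
        mult.assoc mult.left_commute)
qed

end

theory Submission
  imports Defs "Jordan_Normal_Form.Char_Poly" "HOL-Number_Theory.Cong"
begin

text \<open>Let \<open>K\<close> be the field, \<open>O\<close> its ring of integers, \<open>d\<close> its degree and \<open>n\<close> the dimension of \<open>V\<close>.

The first two assertions rest on the trace formula \<open>Tr x = \<sigma>\<^sub>1 x + \<dots> + \<sigma>\<^sub>d x\<close>. The \<open>d\<close> embeddings
are linearly independent functions on \<open>K\<close> (Dedekind), so the matrix of their values at a
\<open>\<rat>\<close>-basis is invertible, and it conjugates multiplication by \<open>x\<close> into the diagonal matrix of the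
numbers \<open>\<sigma>\<^sub>j x\<close> (\<open>field_trace_eq\<close>). Multiplication by \<open>k\<close> on \<open>V\<close>, transported along \<open>f\<close>, is \<open>\<phi> k\<close>, and
\<open>Q0 (f v) (f w)\<close> is the sum of the \<open>\<sigma>\<^sub>j (Q v w)\<close>, hence the trace of \<open>Q v w\<close>.

For the discriminant group, \<open>f\<close> is read as a map into \<open>\<real>\<close>-space of dimension \<open>dn\<close>, where the image
of a lattice \<open>L\<close> has a \<open>\<int>\<close>-basis and a covolume. The index of a sublattice is the quotient of the
covolumes (\<open>lattice_index\<close>), so the discriminant group has order \<open>|det H|\<close> times the square of the
covolume, where \<open>H\<close> is the matrix of the form (\<open>dual_lattice_basis\<close>, \<open>discriminant_group_order\<close>).
If \<open>L\<close> is free with basis \<open>x\<close>, this number is \<open>disc\<^sup>n\<close> times the absolute norm of the Gram determinant of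
\<open>x\<close>, because the covolume factors into \<open>n\<close> copies of that of \<open>O\<close> and a block diagonal determinant
(\<open>det_free_basis\<close>).

In general \<open>L\<close> is not free, and the two sides are compared one prime number \<open>p\<close> at a time. There is a
free submodule of \<open>L\<close> of index \<open>k\<close> prime to \<open>p\<close> (\<open>local_free_sublattice\<close>). Replacing \<open>L\<close> by it
multiplies the order of the discriminant group by \<open>k\<^sup>2\<close>. It replaces the discriminant ideal by the
principal ideal of one Gram determinant, which contains the multiple of the discriminant ideal by a
power of \<open>k\<close>, so the norm changes by a factor prime to \<open>p\<close> as well. Therefore both sides contain
the same power of \<open>p\<close> (\<open>discriminant_order_away_from_prime\<close>), and \<open>p\<close> is arbitrary.

The free submodule is found by Gaussian elimination modulo \<open>p\<close> (\<open>pivot_generator\<close>). The division step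
is that for \<open>c\<close> in \<open>K\<close> the fractional ideal generated by \<open>1\<close> and \<open>c\<close> has one generator modulo \<open>p\<close>
(\<open>local_bezout\<close>). This replaces the factorization of ideals into primes. It follows from the fact
that this fractional ideal is invertible (\<open>bezout_in_fractional_ideal\<close>) and from idempotents in the finite ring
\<open>O/pO\<close>.\<close>

section \<open>Algebraic integers form a ring\<close>

text \<open>The determinant trick: multiplication by \<open>x\<close> on the finitely generated \<open>\<int>\<close>-module spanned by the
\<open>v i\<close> is given by an integer matrix, which has \<open>x\<close> as an eigenvalue. Its characteristic polynomial is
monic with integer coefficients.\<close>

lemma algebraic_int_if_stable_module:
  fixes x :: "'a::field_char_0" and v :: "'i \<Rightarrow> 'a"
  assumes fin: "finite I" and nz: "u \<in> I" "v u \<noteq> 0"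
    and stable: "\<And>i. i \<in> I \<Longrightarrow> \<exists>a::'i \<Rightarrow> int. x * v i = (\<Sum>j\<in>I. of_int (a j) * v j)"
  shows "algebraic_int x"
proof -
  define n where "n = card I"
  obtain h where h: "bij_betw h {..<n} I"
    using ex_bij_betw_nat_finite[OF fin] unfolding n_def by (auto simp: atLeast0LessThan)
  obtain a :: "'i \<Rightarrow> 'i \<Rightarrow> int" where a: "\<And>i. i \<in> I \<Longrightarrow> x * v i = (\<Sum>j\<in>I. of_int (a i j) * v j)"
    using stable by metis
  define A where "A = Matrix.mat n n (\<lambda>(i, j). a (h i) (h j))"
  define w where "w = Matrix.vec n (\<lambda>i. v (h i))"
  let ?A = "of_int_hom.mat_hom A :: 'a mat"
  have A: "A \<in> carrier_mat n n" "?A \<in> carrier_mat n n"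
    by (auto simp: A_def)
  obtain k where k: "k < n" "h k = u"
    using h nz(1) by (auto simp: bij_betw_def)
  have "?A *\<^sub>v w = x \<cdot>\<^sub>v w"
  proof (rule eq_vecI)
    fix i assume "i < dim_vec (x \<cdot>\<^sub>v w)"
    then have i: "i < n" by (simp add: w_def)
    then have hi: "h i \<in> I" using h by (auto simp: bij_betw_def)
    have "(?A *\<^sub>v w) $ i = (\<Sum>j<n. of_int (a (h i) (h j)) * v (h j))"
      using i by (simp add: A_def w_def scalar_prod_def atLeast0LessThan)
    also have "\<dots> = (\<Sum>j\<in>I. of_int (a (h i) j) * v j)"
      by (rule sum.reindex_bij_betw[OF h])
    also have "\<dots> = (x \<cdot>\<^sub>v w) $ i"
      using i a[OF hi] by (simp add: w_def)
    finally show "(?A *\<^sub>v w) $ i = (x \<cdot>\<^sub>v w) $ i" .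
  qed (simp add: A_def w_def)
  moreover have "w \<noteq> 0\<^sub>v n"
  proof
    assume "w = 0\<^sub>v n"
    then have "w $ k = 0" using k by simp
    then show False using k nz by (simp add: w_def)
  qed
  ultimately have "eigenvalue ?A x"
    unfolding eigenvalue_def eigenvector_def using A by (intro exI[of _ w]) (auto simp: w_def)
  then have "poly (of_int_poly (char_poly A)) x = 0"
    using eigenvalue_root_char_poly[OF A(2)] of_int_hom.char_poly_hom[OF A(1), where 'a = 'a]
    by auto
  moreover have "lead_coeff (char_poly A) = 1"
    using degree_monic_char_poly[OF A(1)] by simp
  ultimately show ?thesis
    unfolding algebraic_int_altdef_ipoly by blast
qed

text \<open>From here on, vectors and matrices are those indexed by finite types.\<close>

hide_const (open) Matrix.mat Matrix.row Matrix.vec Determinant.det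
hide_type (open) Matrix.vec
hide_fact (open) Determinant.det_def Determinant.det_rows_mul Matrix.vec_eq_iff Matrix.row_def Matrix.mat_def
no_notation Matrix.vec_index (infixl \<open>$\<close> 100)

lemma algebraic_int_power_recurrence:
  fixes x :: "'a::field_char_0"
  assumes "algebraic_int x"
  obtains m :: nat where "0 < m" "\<And>i. i < m \<Longrightarrow> \<exists>c::nat \<Rightarrow> int. x * x ^ i = (\<Sum>k<m. of_int (c k) * x ^ k)"
proof -
  obtain p :: "int poly" where p: "poly (of_int_poly p) x = 0" "lead_coeff p = 1"
    using assms unfolding algebraic_int_altdef_ipoly by blast
  define m where "m = degree p"
  have eq: "poly (of_int_poly p) x = (\<Sum>k<m. of_int (coeff p k) * x ^ k) + x ^ m"
    using p(2) by (simp add: poly_altdef m_def lessThan_Suc_atMost[symmetric] )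
  have m0: "m \<noteq> 0"
    using eq p(1) by (intro notI) simp
  have "\<exists>c::nat \<Rightarrow> int. x * x ^ i = (\<Sum>k<m. of_int (c k) * x ^ k)" if i: "i < m" for i
  proof (cases "Suc i < m")
    case True
    have "x * x ^ i = (\<Sum>k<m. of_int (if k = Suc i then 1 else 0) * x ^ k)"
      using True by (simp add: if_distrib[where f = of_int] if_distrib[where f = "\<lambda>z. z * _"] cong: if_cong)
    then show ?thesis by (rule exI[where x = "\<lambda>k. if k = Suc i then 1 else 0"])
  next
    case False
    then have "x * x ^ i = x ^ m"
      using i by (metis Suc_lessI power_Suc)
    also have "\<dots> = (\<Sum>k<m. of_int (- coeff p k) * x ^ k)"
      using eq p(1) by (simp add: sum_negf eq_neg_iff_add_eq_0 add.commute)
    finally show ?thesis by - (rule exI)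
  qed
  with that m0 show ?thesis by blast
qed

text \<open>If \<open>x\<close> and \<open>y\<close> satisfy monic equations of degrees \<open>m\<close> and \<open>n\<close>, the monomials \<open>x ^ i * y ^ j\<close> with
\<open>i < m\<close> and \<open>j < n\<close> span a ring. The stability hypothesis only has to be checked from the two
reduction formulas, which is all that sums and products need.\<close>

lemma algebraic_int_if_stable_on_monomials:
  fixes x y z :: "'a::field_char_0"
  assumes "algebraic_int x" "algebraic_int y"
    and stable: "\<And>m n i j (a :: nat \<Rightarrow> int) (b :: nat \<Rightarrow> int). i < m \<Longrightarrow> j < n \<Longrightarrow>
      x * x ^ i = (\<Sum>k<m. of_int (a k) * x ^ k) \<Longrightarrow> y * y ^ j = (\<Sum>l<n. of_int (b l) * y ^ l) \<Longrightarrow>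
      \<exists>c::nat \<Rightarrow> nat \<Rightarrow> int. z * (x ^ i * y ^ j) = (\<Sum>k<m. \<Sum>l<n. of_int (c k l) * (x ^ k * y ^ l))"
  shows "algebraic_int z"
proof -
  obtain m where m: "0 < m"
    and xs: "\<And>i. i < m \<Longrightarrow> \<exists>c::nat \<Rightarrow> int. x * x ^ i = (\<Sum>k<m. of_int (c k) * x ^ k)"
    using algebraic_int_power_recurrence[OF assms(1)] by blast
  obtain n where n: "0 < n"
    and ys: "\<And>i. i < n \<Longrightarrow> \<exists>c::nat \<Rightarrow> int. y * y ^ i = (\<Sum>k<n. of_int (c k) * y ^ k)"
    using algebraic_int_power_recurrence[OF assms(2)] by blast
  define v where "v = (\<lambda>(i, j). x ^ i * y ^ j)"
  show ?thesis
  proof (rule algebraic_int_if_stable_module[where I = "{..<m} \<times> {..<n}" and v = v and u = "(0, 0)"])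
    fix t assume "t \<in> {..<m} \<times> {..<n}"
    then obtain i j where t: "t = (i, j)" "i < m" "j < n" by auto
    obtain a b :: "nat \<Rightarrow> int" where a: "x * x ^ i = (\<Sum>k<m. of_int (a k) * x ^ k)"
      and b: "y * y ^ j = (\<Sum>k<n. of_int (b k) * y ^ k)"
      using xs ys t by blast
    obtain c :: "nat \<Rightarrow> nat \<Rightarrow> int" where "z * (x ^ i * y ^ j) = (\<Sum>k<m. \<Sum>l<n. of_int (c k l) * (x ^ k * y ^ l))"
      using stable[OF t(2,3) a b] by blast
    then have "z * v t = (\<Sum>s\<in>{..<m} \<times> {..<n}. of_int ((\<lambda>(k, l). c k l) s) * v s)"
      unfolding sum.cartesian_product by (simp add: t v_def case_prod_unfold)
    then show "\<exists>c::nat \<times> nat \<Rightarrow> int. z * v t = (\<Sum>s\<in>{..<m} \<times> {..<n}. of_int (c s) * v s)"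
      by - (rule exI)
  qed (use m n in \<open>auto simp: v_def\<close>)
qed

lemma algebraic_int_add:
  fixes x y :: "'a::field_char_0"
  assumes "algebraic_int x" "algebraic_int y"
  shows "algebraic_int (x + y)"
proof (rule algebraic_int_if_stable_on_monomials[OF assms])
  fix m n i j and a b :: "nat \<Rightarrow> int"
  assume ij: "i < m" "j < n" and a: "x * x ^ i = (\<Sum>k<m. of_int (a k) * x ^ k)"
    and b: "y * y ^ j = (\<Sum>l<n. of_int (b l) * y ^ l)"
  define c where "c k l = (if l = j then a k else 0) + (if k = i then b l else 0)" for k l
  have "(\<Sum>k<m. \<Sum>l<n. of_int (c k l) * (x ^ k * y ^ l))
      = (\<Sum>k<m. \<Sum>l<n. (if l = j then of_int (a k) * (x ^ k * y ^ l) else 0) + (if k = i then of_int (b l) * (x ^ k * y ^ l) else 0))"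
    by (intro sum.cong refl) (auto simp: c_def algebra_simps)
  also have "\<dots> = (\<Sum>k<m. of_int (a k) * (x ^ k * y ^ j)) + (\<Sum>l<n. of_int (b l) * (x ^ i * y ^ l))"
  proof -
    have "(\<Sum>k<m. \<Sum>l<n. if k = i then of_int (b l) * (x ^ k * y ^ l) else 0) = (\<Sum>l<n. of_int (b l) * (x ^ i * y ^ l))"
      using ij by (subst sum.swap) simp
    then show ?thesis using ij by (simp add: sum.distrib)
  qed
  also have "\<dots> = x * x ^ i * y ^ j + x ^ i * (y * y ^ j)"
    unfolding a b sum_distrib_left sum_distrib_right by (simp add: algebra_simps)
  finally have "(x + y) * (x ^ i * y ^ j) = (\<Sum>k<m. \<Sum>l<n. of_int (c k l) * (x ^ k * y ^ l))"
    by (simp add: algebra_simps)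
  then show "\<exists>c::nat \<Rightarrow> nat \<Rightarrow> int. (x + y) * (x ^ i * y ^ j) = (\<Sum>k<m. \<Sum>l<n. of_int (c k l) * (x ^ k * y ^ l))"
    by blast
qed

lemma algebraic_int_mult:
  fixes x y :: "'a::field_char_0"
  assumes "algebraic_int x" "algebraic_int y"
  shows "algebraic_int (x * y)"
proof (rule algebraic_int_if_stable_on_monomials[OF assms])
  fix m n i j and a b :: "nat \<Rightarrow> int"
  assume a: "x * x ^ i = (\<Sum>k<m. of_int (a k) * x ^ k)" and b: "y * y ^ j = (\<Sum>l<n. of_int (b l) * y ^ l)"
  have "(x * y) * (x ^ i * y ^ j) = (x * x ^ i) * (y * y ^ j)" by (simp add: algebra_simps)
  also have "\<dots> = (\<Sum>k<m. \<Sum>l<n. of_int (a k * b l) * (x ^ k * y ^ l))"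
    unfolding a b sum_product by (intro sum.cong refl) (simp add: algebra_simps)
  finally show "\<exists>c::nat \<Rightarrow> nat \<Rightarrow> int. (x * y) * (x ^ i * y ^ j) = (\<Sum>k<m. \<Sum>l<n. of_int (c k l) * (x ^ k * y ^ l))"
    by - (rule exI[where x = "\<lambda>k l. a k * b l"])
qed

lemma algebraic_int_of_int: "algebraic_int (of_int z :: 'a::field_char_0)"
  by (rule int_imp_algebraic_int) auto

lemma ring_of_integers_closed:
  fixes x y :: "'a::field_char_0"
  shows "of_int z \<in> (ring_of_integers :: 'a set)" "of_nat k \<in> (ring_of_integers :: 'a set)"
    "0 \<in> (ring_of_integers :: 'a set)" "1 \<in> (ring_of_integers :: 'a set)"
    "x \<in> ring_of_integers \<Longrightarrow> - x \<in> ring_of_integers"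
    "x \<in> ring_of_integers \<Longrightarrow> y \<in> ring_of_integers \<Longrightarrow> x + y \<in> ring_of_integers"
    "x \<in> ring_of_integers \<Longrightarrow> y \<in> ring_of_integers \<Longrightarrow> x - y \<in> ring_of_integers"
    "x \<in> ring_of_integers \<Longrightarrow> y \<in> ring_of_integers \<Longrightarrow> x * y \<in> ring_of_integers"
    "x \<in> ring_of_integers \<Longrightarrow> x ^ k \<in> ring_of_integers"
proof -
  show int: "of_int z \<in> (ring_of_integers :: 'a set)" for z
    by (simp add: ring_of_integers_def algebraic_int_of_int)
  show "of_nat k \<in> (ring_of_integers :: 'a set)" "0 \<in> (ring_of_integers :: 'a set)"
    and one: "1 \<in> (ring_of_integers :: 'a set)"
    using int[of "int k"] int[of 0] int[of 1] by simp_all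
  show minus: "- x \<in> ring_of_integers" if "x \<in> ring_of_integers" for x :: 'a
    using that by (auto simp: ring_of_integers_def)
  show add: "x + y \<in> ring_of_integers" if "x \<in> ring_of_integers" "y \<in> ring_of_integers" for x y :: 'a
    using that by (auto simp: ring_of_integers_def intro: algebraic_int_add)
  show mult: "x * y \<in> ring_of_integers" if "x \<in> ring_of_integers" "y \<in> ring_of_integers" for x y :: 'a
    using that by (auto simp: ring_of_integers_def intro: algebraic_int_mult)
  show "x - y \<in> ring_of_integers" if "x \<in> ring_of_integers" "y \<in> ring_of_integers"
    using add[OF that(1) minus[OF that(2)]] by simp
  show "x ^ k \<in> ring_of_integers" if "x \<in> ring_of_integers"
    using that by (induction k) (auto intro: one mult)
qed

lemma ring_of_integers_sum:
  assumes "\<And>i. i \<in> A \<Longrightarrow> f i \<in> ring_of_integers"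
  shows "(\<Sum>i\<in>A. f i) \<in> ring_of_integers"
  using assms by (induction A rule: infinite_finite_induct) (auto intro: ring_of_integers_closed)

lemma ring_of_integers_prod:
  assumes "\<And>i. i \<in> A \<Longrightarrow> f i \<in> ring_of_integers"
  shows "(\<Prod>i\<in>A. f i) \<in> ring_of_integers"
  using assms by (induction A rule: infinite_finite_induct) (auto intro: ring_of_integers_closed)

lemma ring_of_integers_det:
  fixes A :: "'k::field_char_0^'n^'n"
  assumes "\<And>i j. A $ i $ j \<in> ring_of_integers"
  shows "det A \<in> ring_of_integers"
  unfolding Determinants.det_def
  by (intro ring_of_integers_sum ring_of_integers_closed(8) ring_of_integers_prod assms
      ring_of_integers_closed(1))

section \<open>Fractional ideals with two generators are invertible\<close>

text \<open>These sums are the coefficients of \<open>h(X) / (X - c)\<close>, obtained by synthetic division. They are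
integral although \<open>c\<close> need not be: multiplication by such a coefficient maps the \<open>\<int>\<close>-span of
\<open>1, c, \<dots>, c\<^bsup>m - 1\<^esup>\<close> into itself. For low powers of \<open>c\<close> the product has degree less than \<open>m\<close>;
for high powers the equation \<open>h(c) = 0\<close> trades the leading terms for the trailing ones.\<close>

lemma algebraic_root_quotient_coeff_integral:
  fixes c :: "'a::field_char_0" and h :: "int poly"
  assumes root: "poly (of_int_poly h) c = 0" and deg: "degree h = m" "0 < m"
  shows "(\<Sum>k\<in>{i..m}. of_int (coeff h k) * c ^ (k - i)) \<in> ring_of_integers" (is "?\<gamma> \<in> _")
proof (cases "i \<le> m \<and> 0 < i")
  case True
  have z: "(\<Sum>k\<le>m. of_int (coeff h k) * c ^ k) = 0"
    using root deg(1) by (simp add: poly_altdef)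
  have "algebraic_int ?\<gamma>"
  proof (rule algebraic_int_if_stable_module[of "{..<m}" 0 "\<lambda>j. c ^ j"])
    fix l assume "l \<in> {..<m}"
    then have l: "l < m" by simp
    show "\<exists>a::nat \<Rightarrow> int. ?\<gamma> * c ^ l = (\<Sum>j<m. of_int (a j) * c ^ j)"
    proof (cases "l < i")
      case li: True
      have "?\<gamma> * c ^ l = (\<Sum>k\<in>{i..m}. of_int (coeff h k) * c ^ (k - i + l))"
        unfolding sum_distrib_right
        by (intro sum.cong refl) (simp add: mult.assoc flip: power_add)
      also have "\<dots> = (\<Sum>k\<in>{i..m}. \<Sum>j<m. if j = k - i + l then of_int (coeff h k) * c ^ j else 0)"
        using True li by (intro sum.cong refl) (auto simp: sum.delta)
      also have "\<dots> = (\<Sum>j<m. of_int (\<Sum>k\<in>{i..m}. if j = k - i + l then coeff h k else 0) * c ^ j)"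
        by (subst sum.swap) (auto simp: sum_distrib_right intro!: sum.cong)
      finally show ?thesis by - (rule exI)
    next
      case li: False
      \<comment> \<open>Since \<open>h(c) = 0\<close>, the terms of degree at least \<open>i\<close> are minus the terms of lower degree.\<close>
      have "?\<gamma> * c ^ i = (\<Sum>k\<in>{i..m}. of_int (coeff h k) * c ^ k)"
        unfolding sum_distrib_right
        by (intro sum.cong refl) (simp add: mult.assoc flip: power_add)
      also have "\<dots> = - (\<Sum>k<i. of_int (coeff h k) * c ^ k)"
      proof -
        have "{..m} = {..<i} \<union> {i..m}" using True by auto
        then have "(\<Sum>k\<le>m. of_int (coeff h k) * c ^ k)
            = (\<Sum>k<i. of_int (coeff h k) * c ^ k) + (\<Sum>k\<in>{i..m}. of_int (coeff h k) * c ^ k)"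
          by (simp add: sum.union_disjoint ivl_disj_int)
        then show ?thesis using z by (simp add: eq_neg_iff_add_eq_0 add.commute)
      qed
      finally have "?\<gamma> * c ^ i * c ^ (l - i) = (\<Sum>k<i. - of_int (coeff h k) * c ^ k) * c ^ (l - i)"
        by (simp add: sum_negf)
      then have "?\<gamma> * c ^ l = (\<Sum>k<i. - of_int (coeff h k) * c ^ (k + (l - i)))"
        using li by (simp add: mult.assoc power_add[symmetric] sum_distrib_right)
      also have "\<dots> = (\<Sum>k<i. \<Sum>j<m. if j = k + (l - i) then of_int (- coeff h k) * c ^ j else 0)"
        using l li by (intro sum.cong refl) (auto simp: sum.delta)
      also have "\<dots> = (\<Sum>j<m. of_int (\<Sum>k<i. if j = k + (l - i) then - coeff h k else 0) * c ^ j)"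
        by (subst sum.swap) (auto simp: sum_distrib_right intro!: sum.cong)
      finally show ?thesis by - (rule exI)
    qed
  qed (use deg in auto)
  then show ?thesis by (simp add: ring_of_integers_def)
next
  case False
  then consider "m < i" | "i = 0" by linarith
  then show ?thesis
  proof cases
    case 2
    have "?\<gamma> = poly (of_int_poly h) c"
      using 2 deg(1) by (simp add: poly_altdef atLeast0AtMost)
    then show ?thesis using root by (simp add: ring_of_integers_closed)
  qed (simp add: ring_of_integers_closed)
qed

lemma integer_multiple_algebraic_int_imp_root:
  fixes c :: "'a::field_char_0"
  assumes "0 < N" "algebraic_int (of_nat N * c)"
  obtains h :: "int poly" where "poly (of_int_poly h) c = 0" "content h = 1" "0 < degree h"
proof -
  obtain p :: "int poly" where p: "poly (of_int_poly p) (of_nat N * c) = 0" "lead_coeff p = 1"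
    using assms(2) unfolding algebraic_int_altdef_ipoly by blast
  define q where "q = pcompose p [:0, int N:]"
  have qc: "poly (of_int_poly q) c = 0"
    using p(1) by (simp add: q_def of_int_hom.map_poly_pcompose map_poly_pCons poly_pcompose mult.commute of_int_hom.map_poly_pCons_hom)
  have q0: "q \<noteq> 0"
  proof
    assume "q = 0"
    then have "p = 0" using assms(1) by (simp add: q_def pcompose_eq_0)
    then show False using p(2) by simp
  qed
  define h where "h = primitive_part q"
  have qh: "q = Polynomial.smult (content q) h" by (simp add: h_def content_times_primitive_part)
  have h: "content h = 1" using q0 by (simp add: h_def)
  have "of_int (content q) * poly (of_int_poly h) c = 0"
    using qc by (subst (asm) qh) (simp add: of_int_hom.map_poly_hom_smult)
  then have hc: "poly (of_int_poly h) c = 0" using q0 by simp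
  moreover have "0 < degree h"
  proof (rule ccontr)
    assume "\<not> 0 < degree h"
    then obtain a where a: "h = [:a:]" by (metis degree_eq_zeroE gr0I)
    with hc have "a = 0" by (simp add: of_int_hom.map_poly_pCons_hom)
    with a h show False by simp
  qed
  ultimately show ?thesis using that h by blast
qed

lemma content_int_combination:
  fixes h :: "int poly"
  shows "\<exists>z. content h = (\<Sum>i\<le>degree h. z i * coeff h i)"
proof -
  have "\<exists>z::nat \<Rightarrow> int. Gcd (coeff h ` A) = (\<Sum>i\<in>A. z i * coeff h i)" if "finite A" for A
    using that
  proof (induction A)
    case (insert a A)
    then obtain z where z: "Gcd (coeff h ` A) = (\<Sum>i\<in>A. z i * coeff h i)" by blast
    obtain u v where uv: "u * coeff h a + v * Gcd (coeff h ` A) = gcd (coeff h a) (Gcd (coeff h ` A))"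
      by (metis bezout_int)
    have "(\<Sum>i\<in>A. v * z i * coeff h i) = (\<Sum>i\<in>A. ((\<lambda>i. v * z i)(a := u)) i * coeff h i)"
      using insert.hyps by (intro sum.cong) auto
    then have "Gcd (coeff h ` insert a A) = (\<Sum>i\<in>insert a A. ((\<lambda>i. v * z i)(a := u)) i * coeff h i)"
      using insert.hyps uv by (simp add: z sum_distrib_left mult.assoc)
    then show ?case by blast
  qed simp
  moreover have "content h = Gcd (coeff h ` {..degree h})"
    by (cases "h = 0") (simp_all add: content_def coeffs_def atLeast0LessThan lessThan_Suc_atMost del: upt_Suc)
  ultimately show ?thesis by simp
qed

text \<open>Let \<open>\<gamma> 0, \<gamma> 1, \<dots>\<close> be the coefficients of \<open>h(X) / (X - c)\<close> for a primitive integer polynomial \<open>h\<close>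
with root \<open>c\<close>. They satisfy \<open>\<gamma> i = h\<^sub>i + c * \<gamma> (i + 1)\<close>, so all \<open>\<gamma> i\<close> and \<open>c * \<gamma> i\<close> are integral, and
the coprime numbers \<open>h\<^sub>i\<close> are combinations of them. Hence the fractional ideal generated by \<open>1\<close> and \<open>c\<close>
is inverse to the one generated by the \<open>\<gamma> i\<close>; the conclusion is that the product contains \<open>1\<close>.\<close>

lemma bezout_in_fractional_ideal:
  fixes c :: "'a::field_char_0"
  assumes "0 < N" "algebraic_int (of_nat N * c)"
  obtains y y' where "y \<in> ring_of_integers" "c * y \<in> ring_of_integers"
    "y' \<in> ring_of_integers" "c * y' \<in> ring_of_integers" "y + c * y' = 1"
proof -
  obtain h where h: "poly (of_int_poly h) c = 0" "content h = 1" "0 < degree h"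
    using integer_multiple_algebraic_int_imp_root[OF assms] by blast
  define m where "m = degree h"
  define \<gamma> where "\<gamma> i = (\<Sum>k\<in>{i..m}. of_int (coeff h k) * c ^ (k - i))" for i
  have int: "\<gamma> i \<in> ring_of_integers" for i
    unfolding \<gamma>_def using algebraic_root_quotient_coeff_integral[OF h(1) _ h(3)] m_def by simp
  have rec: "\<gamma> i = of_int (coeff h i) + c * \<gamma> (Suc i)" if "i \<le> m" for i
  proof -
    have "\<gamma> i = of_int (coeff h i) + (\<Sum>k\<in>{Suc i..m}. of_int (coeff h k) * c ^ (k - i))"
      unfolding \<gamma>_def using that by (simp add: sum.atLeast_Suc_atMost)
    also have "(\<Sum>k\<in>{Suc i..m}. of_int (coeff h k) * c ^ (k - i)) = c * \<gamma> (Suc i)"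
      unfolding \<gamma>_def sum_distrib_left
      by (intro sum.cong refl) (auto simp: Suc_diff_le Suc_le_eq simp flip: power_Suc dest!: less_imp_Suc_add)
    finally show ?thesis .
  qed
  have zero: "\<gamma> 0 = 0"
    using h(1) by (simp add: \<gamma>_def m_def poly_altdef atLeast0AtMost)
  obtain z where z: "1 = (\<Sum>i\<le>m. z i * coeff h i)"
    using content_int_combination[of h] h(2) m_def by metis
  define y where "y = (\<Sum>i\<le>m. of_int (z i) * \<gamma> i)"
  define y' where "y' = (\<Sum>i\<le>m. of_int (z i) * - \<gamma> (Suc i))"
  have shift: "c * \<gamma> (Suc i) \<in> ring_of_integers" if "i \<le> m" for i
    using rec[OF that] int[of i] ring_of_integers_closed(7)[OF int[of i] ring_of_integers_closed(1)[of "coeff h i"]]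
    by simp
  have shift': "c * \<gamma> i \<in> ring_of_integers" if "i \<le> m" for i
    using that shift[of "i - 1"] by (cases i) (auto simp: zero ring_of_integers_closed)
  have "y + c * y' = (\<Sum>i\<le>m. of_int (z i) * (\<gamma> i - c * \<gamma> (Suc i)))"
    by (simp add: y_def y'_def sum_distrib_left algebra_simps sum_subtractf sum_negf)
  also have "\<dots> = (\<Sum>i\<le>m. of_int (z i * coeff h i))"
    by (intro sum.cong refl) (simp add: rec)
  also have "\<dots> = of_int (\<Sum>i\<le>m. z i * coeff h i)" by simp
  also have "\<dots> = 1" by (simp flip: z)
  finally have one: "y + c * y' = 1" .
  have "y \<in> ring_of_integers" "y' \<in> ring_of_integers"
    unfolding y_def y'_def by (intro ring_of_integers_sum ring_of_integers_closed int)+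
  moreover have "c * y \<in> ring_of_integers" "c * y' \<in> ring_of_integers"
    unfolding y_def y'_def sum_distrib_left mult.left_commute[of c] mult_minus_right
    by (intro ring_of_integers_sum ring_of_integers_closed shift shift'; simp)+
  ultimately show ?thesis using that one by blast
qed

section \<open>Index of a subgroup of an abelian group\<close>

definition additive_subgroup :: "'a::ab_group_add set \<Rightarrow> bool" where
  "additive_subgroup A \<longleftrightarrow> 0 \<in> A \<and> (\<forall>x\<in>A. \<forall>y\<in>A. x - y \<in> A)"

lemma additive_subgroupD:
  assumes "additive_subgroup A"
  shows "0 \<in> A" "x \<in> A \<Longrightarrow> y \<in> A \<Longrightarrow> x - y \<in> A" "x \<in> A \<Longrightarrow> - x \<in> A"
    "x \<in> A \<Longrightarrow> y \<in> A \<Longrightarrow> x + y \<in> A"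
proof -
  show zero: "0 \<in> A" and diff: "\<And>x y. x \<in> A \<Longrightarrow> y \<in> A \<Longrightarrow> x - y \<in> A"
    using assms by (auto simp: additive_subgroup_def)
  show minus: "- x \<in> A" if "x \<in> A" for x using diff[OF zero that] by simp
  show "x + y \<in> A" if "x \<in> A" "y \<in> A" using diff[OF that(1) minus[OF that(2)]] by simp
qed

lemma additive_subgroup_sum:
  assumes "additive_subgroup A" "\<And>i. i \<in> I \<Longrightarrow> f i \<in> A"
  shows "(\<Sum>i\<in>I. f i) \<in> A"
  using assms(2) by (induction I rule: infinite_finite_induct) (auto intro: additive_subgroupD[OF assms(1)])

lemma additive_subgroup_of_int_scaleR:
  fixes A :: "'a::real_vector set"
  assumes "additive_subgroup A" "x \<in> A"
  shows "of_int z *\<^sub>R x \<in> A"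
proof -
  have nat: "real n *\<^sub>R x \<in> A" for n
    by (induction n) (auto simp: scaleR_add_left intro: additive_subgroupD[OF assms(1)] assms(2))
  show ?thesis
  proof (cases "0 \<le> z")
    case True
    then show ?thesis using nat[of "nat z"] by simp
  next
    case False
    then show ?thesis using additive_subgroupD(3)[OF assms(1) nat[of "nat (- z)"]] by simp
  qed
qed

text \<open>Systems of representatives of \<open>A\<close> modulo \<open>B\<close>. They make indices multiplicative by adding
representatives, without passing through sets of cosets.\<close>

definition transversal :: "'a::ab_group_add set \<Rightarrow> 'a set \<Rightarrow> 'a set \<Rightarrow> bool" where
  "transversal A B T \<longleftrightarrow> T \<subseteq> A \<and> (\<forall>a\<in>A. \<exists>t\<in>T. a - t \<in> B) \<and>
     (\<forall>a\<in>A. \<forall>s\<in>T. \<forall>t\<in>T. a - s \<in> B \<longrightarrow> a - t \<in> B \<longrightarrow> s = t)"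

definition has_index :: "'a::ab_group_add set \<Rightarrow> 'a set \<Rightarrow> nat \<Rightarrow> bool" where
  "has_index A B k \<longleftrightarrow> (\<exists>T. transversal A B T \<and> finite T \<and> card T = k)"

lemma transversal_subset: "transversal A B T \<Longrightarrow> t \<in> T \<Longrightarrow> t \<in> A"
  by (auto simp: transversal_def)

lemma transversal_cover:
  assumes "transversal A B T" "a \<in> A"
  obtains t where "t \<in> T" "a - t \<in> B"
  using assms by (auto simp: transversal_def)

lemma transversal_unique:
  "transversal A B T \<Longrightarrow> a \<in> A \<Longrightarrow> s \<in> T \<Longrightarrow> t \<in> T \<Longrightarrow> a - s \<in> B \<Longrightarrow> a - t \<in> B \<Longrightarrow> s = t"
  unfolding transversal_def by blast

lemma has_index_refl:
  assumes "additive_subgroup A"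
  shows "has_index A A 1"
proof -
  have "transversal A A {0}"
    using additive_subgroupD(1)[OF assms] by (simp add: transversal_def)
  then show ?thesis unfolding has_index_def by (intro exI[of _ "{0}"]) simp
qed

lemma has_index_trans:
  assumes A: "additive_subgroup A" and B: "additive_subgroup B" and C: "additive_subgroup C"
    and sub: "C \<subseteq> B" "B \<subseteq> A" and AB: "has_index A B k" and BC: "has_index B C l"
  shows "has_index A C (k * l)"
proof -
  obtain S where S: "transversal A B S" "finite S" "card S = k"
    using AB by (auto simp: has_index_def)
  obtain T where T: "transversal B C T" "finite T" "card T = l"
    using BC by (auto simp: has_index_def)
  have TB: "t \<in> B" if "t \<in> T" for t using transversal_subset[OF T(1) that] .
  have mem: "s + t \<in> A" if "s \<in> S" "t \<in> T" for s t
    using transversal_subset[OF S(1) that(1)] TB[OF that(2)] sub(2) additive_subgroupD(4)[OF A] by blast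
  have uniq: "s = s' \<and> t = t'"
    if st: "s \<in> S" "s' \<in> S" "t \<in> T" "t' \<in> T" "a - (s + t) \<in> C" "a - (s' + t') \<in> C" "a \<in> A" for s s' t t' a
  proof -
    have "a - (s + t) + t \<in> B"
      by (rule additive_subgroupD(4)[OF B]) (use st TB sub(1) in auto)
    moreover have "a - (s' + t') + t' \<in> B"
      by (rule additive_subgroupD(4)[OF B]) (use st TB sub(1) in auto)
    ultimately have as: "a - s \<in> B" "a - s' \<in> B" by (simp_all add: algebra_simps)
    then have s: "s = s'" using transversal_unique[OF S(1) st(7,1,2)] by simp
    have "a - s - t \<in> C" "a - s - t' \<in> C" using st(5,6) s by (simp_all add: algebra_simps)
    then show ?thesis using transversal_unique[OF T(1) as(1) st(3,4)] s by simp
  qed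
  define U where "U = (\<lambda>(s, t). s + t) ` (S \<times> T)"
  have inj: "inj_on (\<lambda>(s, t). s + t) (S \<times> T)"
  proof (rule inj_onI, clarify)
    fix s t s' t' assume st: "s \<in> S" "t \<in> T" "s' \<in> S" "t' \<in> T" "s + t = s' + t'"
    have "s + t - (s + t) \<in> C" "s + t - (s' + t') \<in> C"
      using st(5) additive_subgroupD(1)[OF C] by simp_all
    then show "s = s' \<and> t = t'" using uniq[OF st(1,3,2,4)] mem[OF st(1,2)] by blast
  qed
  have "transversal A C U"
    unfolding transversal_def
  proof (intro conjI ballI impI)
    show "U \<subseteq> A" using mem by (auto simp: U_def)
  next
    fix a assume "a \<in> A"
    obtain s where s: "s \<in> S" "a - s \<in> B" using transversal_cover[OF S(1) \<open>a \<in> A\<close>] .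
    obtain t where t: "t \<in> T" "a - s - t \<in> C" using transversal_cover[OF T(1) s(2)] .
    show "\<exists>u\<in>U. a - u \<in> C"
      using s t by (intro bexI[of _ "s + t"]) (auto simp: U_def algebra_simps)
  next
    fix a u v assume a: "a \<in> A" and "u \<in> U" "v \<in> U" and uv: "a - u \<in> C" "a - v \<in> C"
    then obtain s t s' t' where "u = s + t" "v = s' + t'" "s \<in> S" "t \<in> T" "s' \<in> S" "t' \<in> T"
      by (auto simp: U_def)
    then show "u = v" using uniq[of s s' t t' a] a uv by simp
  qed
  moreover have "card U = k * l"
    unfolding U_def using card_image[OF inj] S(3) T(3) by (simp add: card_cartesian_product)
  moreover have "finite U"
    using S T by (simp add: U_def)
  ultimately show ?thesis unfolding has_index_def by blast
qed

lemma has_index_quotient_group: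
  assumes A: "additive_subgroup A" and B: "additive_subgroup B" and ind: "has_index A B k"
  shows "finite (quotient_group A B)" "card (quotient_group A B) = k"
proof -
  obtain T where T: "transversal A B T" "finite T" "card T = k"
    using ind by (auto simp: has_index_def)
  define cl where "cl x = {y. x - y \<in> B}" for x
  have cl_eq: "cl x = cl y \<longleftrightarrow> x - y \<in> B" for x y
  proof
    assume "cl x = cl y"
    moreover have "y \<in> cl y" using additive_subgroupD(1)[OF B] by (simp add: cl_def)
    ultimately have "y \<in> cl x" by simp
    then show "x - y \<in> B" by (simp add: cl_def)
  next
    assume xy: "x - y \<in> B"
    have "x - z \<in> B \<longleftrightarrow> y - z \<in> B" for z
      using additive_subgroupD(2)[OF B, of "x - z" "x - y"] additive_subgroupD(4)[OF B, of "x - y" "y - z"] xy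
      by auto
    then show "cl x = cl y" by (simp add: cl_def)
  qed
  have q: "quotient_group A B = cl ` A"
    by (auto simp: quotient_group_def quotient_def cl_def)
  also have "\<dots> = cl ` T"
  proof
    show "cl ` A \<subseteq> cl ` T"
    proof
      fix c assume "c \<in> cl ` A"
      then obtain a where a: "a \<in> A" "c = cl a" by blast
      obtain t where "t \<in> T" "a - t \<in> B" using transversal_cover[OF T(1) a(1)] .
      then show "c \<in> cl ` T" using cl_eq[of a t] a by auto
    qed
    show "cl ` T \<subseteq> cl ` A" using transversal_subset[OF T(1)] by blast
  qed
  finally have qT: "quotient_group A B = cl ` T" .
  have "inj_on cl T"
  proof (rule inj_onI)
    fix s t assume st: "s \<in> T" "t \<in> T" "cl s = cl t"
    then have "s - t \<in> B" "s - s \<in> B" using cl_eq additive_subgroupD(1)[OF B] by simp_all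
    then show "s = t" using transversal_unique[OF T(1) transversal_subset[OF T(1) st(1)] st(1,2)] by simp
  qed
  then show "finite (quotient_group A B)" "card (quotient_group A B) = k"
    using T qT card_image by auto
qed

text \<open>The cosets that form a quotient are differences \<open>x - B\<close>, so an additive injection carries them over.
This moves quotients from \<open>K\<close> and from the corestriction to Euclidean space.\<close>

lemma quotient_group_image:
  assumes inj: "inj h" and diff: "\<And>x y. h (x - y) = h x - h y"
  shows "card (quotient_group (h ` A) (h ` B)) = card (quotient_group A B)"
    "finite (quotient_group (h ` A) (h ` B)) \<longleftrightarrow> finite (quotient_group A B)"
proof -
  have q: "quotient_group A B = (\<lambda>x. (\<lambda>b. x - b) ` B) ` A" for A B :: "'c::ab_group_add set"
  proof -
    have "{y. x - y \<in> B} = (\<lambda>b. x - b) ` B" for x :: 'c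
      by (auto simp: image_iff) (metis diff_diff_eq2 add_diff_cancel_left')
    then show ?thesis by (auto simp: quotient_group_def quotient_def)
  qed
  have "quotient_group (h ` A) (h ` B) = (`) h ` quotient_group A B"
    unfolding q by (simp add: image_image diff)
  moreover have "inj_on ((`) h) X" for X
    using inj by (simp add: inj_on_def inj_image_eq_iff)
  ultimately show "card (quotient_group (h ` A) (h ` B)) = card (quotient_group A B)"
    "finite (quotient_group (h ` A) (h ` B)) \<longleftrightarrow> finite (quotient_group A B)"
    by (simp_all add: card_image finite_image_iff)
qed

section \<open>Lattices in Euclidean space\<close>

definition int_span :: "('m::finite \<Rightarrow> 'a::real_vector) \<Rightarrow> 'a set" where
  "int_span x = range (\<lambda>z::'m \<Rightarrow> int. \<Sum>i\<in>UNIV. of_int (z i) *\<^sub>R x i)"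

text \<open>The tuple is read as the matrix with rows \<open>x i\<close>, so the condition on the determinant says that the
lattice has full rank.\<close>

definition lattice_basis :: "(real^'m) set \<Rightarrow> ('m \<Rightarrow> real^'m) \<Rightarrow> bool" where
  "lattice_basis M x \<longleftrightarrow> det (vec_lambda x) \<noteq> 0 \<and> M = int_span x"

abbreviation covol :: "('m \<Rightarrow> real^'m) \<Rightarrow> real" where
  "covol x \<equiv> \<bar>det (vec_lambda x)\<bar>"

lemma int_spanI: "(\<Sum>i\<in>UNIV. of_int (z i) *\<^sub>R x i) \<in> int_span x"
  by (auto simp: int_span_def)

lemma additive_subgroup_int_span: "additive_subgroup (int_span x)"
  unfolding additive_subgroup_def
proof (intro conjI ballI)
  show "0 \<in> int_span x"
    using int_spanI[of "\<lambda>_. 0" x] by simp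
next
  fix a b assume "a \<in> int_span x" "b \<in> int_span x"
  then obtain u v where "a = (\<Sum>i\<in>UNIV. of_int (u i) *\<^sub>R x i)" "b = (\<Sum>i\<in>UNIV. of_int (v i) *\<^sub>R x i)"
    by (auto simp: int_span_def)
  then have "a - b = (\<Sum>i\<in>UNIV. of_int (u i - v i) *\<^sub>R x i)"
    by (simp add: sum_subtractf scaleR_left_diff_distrib)
  then show "a - b \<in> int_span x" using int_spanI[of "\<lambda>i. u i - v i" x] by simp
qed

lemma int_span_base: "x i \<in> int_span x"
proof -
  have "x i = (\<Sum>j\<in>UNIV. of_int (if j = i then 1 else 0) *\<^sub>R x j)"
    by (simp add: if_distrib[where f = of_int] if_distrib[where f = "\<lambda>c. c *\<^sub>R _"] cong: if_cong)
  then show ?thesis using int_spanI[of "\<lambda>j. if j = i then 1 else 0" x] by simp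
qed

lemma int_span_minimal:
  assumes "additive_subgroup M" "\<And>i. x i \<in> M"
  shows "int_span x \<subseteq> M"
  unfolding int_span_def
  by (intro image_subsetI additive_subgroup_sum[OF assms(1)] additive_subgroup_of_int_scaleR[OF assms(1)] assms(2))

lemma vec_lambda_matrix_mult:
  "c v* (vec_lambda x :: real^'n^'m) = (\<Sum>i\<in>UNIV. (c $ i) *\<^sub>R x i)"
  by (intro vec_eq_iff[THEN iffD2] allI) (simp add: vector_matrix_mult_def mult.commute)

lemma real_coordinates:
  fixes x :: "'m::finite \<Rightarrow> real^'m"
  assumes "det (vec_lambda x) \<noteq> 0"
  shows "\<exists>c. y = (\<Sum>i\<in>UNIV. c i *\<^sub>R x i)"
proof -
  obtain B where "B ** vec_lambda x = mat 1"
    using assms by (auto simp: invertible_det_nz[symmetric] invertible_def)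
  then have "(y v* B) v* vec_lambda x = y"
    by (simp add: vector_matrix_mul_assoc)
  then show ?thesis unfolding vec_lambda_matrix_mult by metis
qed

lemma real_coordinates_unique:
  fixes x :: "'m::finite \<Rightarrow> real^'m"
  assumes "det (vec_lambda x) \<noteq> 0" "(\<Sum>i\<in>UNIV. c i *\<^sub>R x i) = (\<Sum>i\<in>UNIV. b i *\<^sub>R x i)"
  shows "c = b"
proof -
  obtain B where inv: "vec_lambda x ** B = mat 1"
    using assms(1) by (auto simp: invertible_det_nz[symmetric] invertible_def)
  have "(vec_lambda c) v* vec_lambda x = (vec_lambda b) v* vec_lambda x"
    using assms(2) by (simp add: vec_lambda_matrix_mult)
  then have "vec_lambda c v* vec_lambda x v* B = vec_lambda b v* vec_lambda x v* B"
    by simp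
  then have "vec_lambda c = (vec_lambda b :: real^'m)"
    by (simp add: vector_matrix_mul_assoc inv)
  then show ?thesis by (simp add: vec_lambda_inject)
qed

text \<open>Cramer's rule, used below to read off real coordinates as quotients of determinants.\<close>

lemma det_replace_row:
  fixes x :: "'m::finite \<Rightarrow> real^'m"
  assumes "y = (\<Sum>i\<in>UNIV. c i *\<^sub>R x i)"
  shows "det (vec_lambda (x(k := y))) = c k * det (vec_lambda x)"
proof -
  have "det (\<chi> i. if i = k then \<Sum>i\<in>UNIV. (vec_lambda c) $ i *s row i (vec_lambda x) else row i (vec_lambda x))
      = (vec_lambda c :: real^'m) $ k * det (vec_lambda x)"
    by (rule cramer_lemma_transpose)
  moreover have "(\<chi> i. if i = k then \<Sum>i\<in>UNIV. (vec_lambda c) $ i *s row i (vec_lambda x) else row i (vec_lambda x))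
      = vec_lambda (x(k := y))"
    using assms by (intro vec_eq_iff[THEN iffD2] allI) (simp add: row_def)
  ultimately show ?thesis by simp
qed

lemma det_of_int:
  "det (\<chi> i j. (of_int (z i j) :: real)) = of_int (det (\<chi> i j. (z i j :: int)))"
  by (simp add: Determinants.det_def)

lemma det_int_combinations:
  fixes x y :: "'m::finite \<Rightarrow> real^'m"
  assumes "\<And>i. y i = (\<Sum>j\<in>UNIV. of_int (z i j) *\<^sub>R x j)"
  shows "det (vec_lambda y) = of_int (det (\<chi> i j. z i j)) * det (vec_lambda x)"
proof -
  have "vec_lambda y = (\<chi> i j. (of_int (z i j) :: real)) ** vec_lambda x"
    by (intro vec_eq_iff[THEN iffD2] allI) (simp add: matrix_matrix_mult_def assms)
  then show ?thesis by (simp add: det_mul det_of_int)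
qed

lemma det_int_multiple:
  fixes x y :: "'m::finite \<Rightarrow> real^'m"
  assumes "\<And>i. y i \<in> int_span x"
  shows "\<exists>k::int. det (vec_lambda y) = of_int k * det (vec_lambda x)"
proof -
  have "\<forall>i. \<exists>z. y i = (\<Sum>j\<in>UNIV. of_int (z j) *\<^sub>R x j)"
    using assms by (auto simp: int_span_def)
  then obtain z where "\<And>i. y i = (\<Sum>j\<in>UNIV. of_int (z i j) *\<^sub>R x j)" by metis
  then show ?thesis using det_int_combinations by blast
qed

lemma lattice_basis_subgroup: "lattice_basis M x \<Longrightarrow> additive_subgroup M"
  by (simp add: lattice_basis_def additive_subgroup_int_span)

lemma lattice_basis_mem: "lattice_basis M x \<Longrightarrow> x i \<in> M"
  by (simp add: lattice_basis_def int_span_base)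

lemma lattice_basis_mem_iff:
  assumes "lattice_basis M x"
  shows "(\<Sum>i\<in>UNIV. c i *\<^sub>R x i) \<in> M \<longleftrightarrow> (\<forall>i. c i \<in> \<int>)"
proof
  assume "(\<Sum>i\<in>UNIV. c i *\<^sub>R x i) \<in> M"
  then obtain z where "(\<Sum>i\<in>UNIV. c i *\<^sub>R x i) = (\<Sum>i\<in>UNIV. of_int (z i) *\<^sub>R x i)"
    using assms by (auto simp: lattice_basis_def int_span_def)
  then have "c = (\<lambda>i. of_int (z i))"
    using assms real_coordinates_unique[of x c "\<lambda>i. of_int (z i)"] by (auto simp: lattice_basis_def)
  then show "\<forall>i. c i \<in> \<int>" by simp
next
  assume "\<forall>i. c i \<in> \<int>"
  then have "\<forall>i. \<exists>z. c i = of_int z" by (auto elim: Ints_cases)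
  then obtain z where "\<And>i. c i = of_int (z i)" by metis
  then show "(\<Sum>i\<in>UNIV. c i *\<^sub>R x i) \<in> M"
    using assms int_spanI[of z x] by (simp add: lattice_basis_def)
qed

text \<open>A linearly independent tuple in \<open>M\<close> with least determinant is a basis: if some member of \<open>M\<close> had a
non-integral coordinate, subtracting the integral part of this coordinate would give a tuple whose determinant is
smaller by the fractional part. The least value exists because the squares of the determinants lie
in a discrete set; squares are used because discriminants of number fields arise as such squares.\<close>

lemma lattice_basis_exists:
  fixes M :: "(real^'m) set"
  assumes M: "additive_subgroup M" and x0: "\<And>i. x0 i \<in> M" "det (vec_lambda x0) \<noteq> 0"
    and c: "0 < c" and disc: "\<And>x :: 'm \<Rightarrow> real^'m. (\<And>i. x i \<in> M) \<Longrightarrow> \<exists>n::nat. (det (vec_lambda x))\<^sup>2 = c * real n"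
  shows "\<exists>x. lattice_basis M x"
proof -
  define P where "P n \<longleftrightarrow> 0 < n \<and> (\<exists>x. (\<forall>i. x i \<in> M) \<and> (det (vec_lambda x :: real^'m^'m))\<^sup>2 = c * real n)" for n
  have P_I: "\<exists>n. P n \<and> (det (vec_lambda x))\<^sup>2 = c * real n" if x: "\<And>i. x i \<in> M" "det (vec_lambda x) \<noteq> 0" for x
  proof -
    obtain n where n: "(det (vec_lambda x))\<^sup>2 = c * real n" using disc[of x] x(1) by blast
    then have "0 < n" using x(2) by (cases n) auto
    then show ?thesis using x n by (auto simp: P_def)
  qed
  obtain n where n: "P n" "\<And>k. P k \<Longrightarrow> n \<le> k"
    using P_I[OF x0] by (metis LeastI Least_le)
  obtain x where x: "\<And>i. x i \<in> M" "(det (vec_lambda x))\<^sup>2 = c * real n" and "0 < n"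
    using n(1) by (auto simp: P_def)
  then have det: "det (vec_lambda x) \<noteq> 0" using c by auto
  have "y \<in> int_span x" if y: "y \<in> M" for y
  proof -
    obtain b where b: "y = (\<Sum>i\<in>UNIV. b i *\<^sub>R x i)" using real_coordinates[OF det] by blast
    have "b k \<in> \<int>" for k
    proof (rule ccontr)
      assume k: "b k \<notin> \<int>"
      \<comment> \<open>Exchanging \<open>x k\<close> for \<open>y'\<close> multiplies the determinant by the fractional part of \<open>b k\<close>.\<close>
      define y' where "y' = y - of_int \<lfloor>b k\<rfloor> *\<^sub>R x k"
      have y'M: "y' \<in> M"
        unfolding y'_def by (intro additive_subgroupD(2)[OF M] y additive_subgroup_of_int_scaleR[OF M] x)
      have "of_int \<lfloor>b k\<rfloor> *\<^sub>R x k = (\<Sum>i\<in>UNIV. (if i = k then of_int \<lfloor>b k\<rfloor> else 0) *\<^sub>R x i)"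
        by (simp add: if_distrib[where f = "\<lambda>c. c *\<^sub>R _"] cong: if_cong)
      then have "y' = (\<Sum>i\<in>UNIV. (b i - (if i = k then of_int \<lfloor>b k\<rfloor> else 0)) *\<^sub>R x i)"
        by (simp add: y'_def b scaleR_left_diff_distrib sum_subtractf)
      from det_replace_row[OF this, of k]
      have d: "det (vec_lambda (x(k := y'))) = frac (b k) * det (vec_lambda x)"
        by (simp add: frac_def)
      have fr: "0 < frac (b k)" "frac (b k) < 1" using k by (simp_all add: frac_gt_0_iff frac_lt_1)
      have mem: "\<And>i. (x(k := y')) i \<in> M" using x y'M by simp
      obtain l where l: "P l" "(det (vec_lambda (x(k := y'))))\<^sup>2 = c * real l"
        using P_I[of "x(k := y')"] mem d fr det by (smt (verit) mult_eq_0_iff)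
      have "c * real l = (frac (b k))\<^sup>2 * (c * real n)"
        by (simp only: l(2)[symmetric] d x(2)[symmetric] power_mult_distrib)
      also have "\<dots> < 1 * (c * real n)"
        using fr c \<open>0 < n\<close> by (intro mult_strict_right_mono) (simp_all add: power_less_one_iff)
      finally have "l < n" using c by simp
      then show False using n(2)[OF l(1)] by simp
    qed
    then have "\<forall>i. \<exists>z. b i = of_int z" by (auto elim: Ints_cases)
    then obtain z where "\<And>i. b i = of_int (z i)" by metis
    then show ?thesis using int_spanI[of z x] b by simp
  qed
  then have "M = int_span x" using int_span_minimal[OF M, of x] x(1) by blast
  then show ?thesis using det by (auto simp: lattice_basis_def)
qed

lemma lattice_basis_between:
  fixes M :: "(real^'m) set"
  assumes M: "additive_subgroup M" and M1: "lattice_basis M1 x1" "M1 \<subseteq> M" and M2: "lattice_basis M2 x2" "M \<subseteq> M2"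
  shows "\<exists>x. lattice_basis M x"
proof (rule lattice_basis_exists[OF M, of x1 "(det (vec_lambda x2))\<^sup>2"])
  show "x1 i \<in> M" for i using lattice_basis_mem[OF M1(1)] M1(2) by blast
  show "det (vec_lambda x1) \<noteq> 0" "0 < (det (vec_lambda x2))\<^sup>2"
    using M1 M2 by (auto simp: lattice_basis_def)
next
  fix x :: "'m \<Rightarrow> real^'m" assume "\<And>i. x i \<in> M"
  then have "\<And>i. x i \<in> int_span x2" using M2 by (auto simp: lattice_basis_def)
  then obtain k :: int where "det (vec_lambda x) = of_int k * det (vec_lambda x2)"
    using det_int_multiple by blast
  then have "(det (vec_lambda x))\<^sup>2 = (det (vec_lambda x2))\<^sup>2 * real (nat (k\<^sup>2))"
    by (simp add: power_mult_distrib)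
  then show "\<exists>n::nat. (det (vec_lambda x))\<^sup>2 = (det (vec_lambda x2))\<^sup>2 * real n" by blast
qed

lemma abs_det_int_multiple:
  fixes x y :: "'m::finite \<Rightarrow> real^'m"
  assumes "\<And>i. y i \<in> int_span x"
  shows "\<exists>n::nat. covol y = real n * covol x"
proof -
  obtain k :: int where "det (vec_lambda y) = of_int k * det (vec_lambda x)"
    using det_int_multiple[of y x] assms by blast
  then have "covol y = real (nat \<bar>k\<bar>) * covol x"
    by (simp add: abs_mult)
  then show ?thesis by blast
qed

section \<open>The index of a sublattice\<close>

text \<open>The quotient of \<open>M'\<close> by \<open>M\<close> is a torsion group, so it contains an element of prime order \<open>p\<close>. A
multiple of it that is modified by a member of the basis has a coordinate equal to \<open>1 / p\<close>. This is what is
needed to enlarge \<open>M\<close> by exchanging one basis vector.\<close>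

lemma lattice_prime_torsion_coordinate:
  fixes M :: "(real^'m) set"
  assumes x: "lattice_basis M x" and M': "additive_subgroup M'" "M \<subset> M'"
    and N: "0 < N" "\<And>y. y \<in> M' \<Longrightarrow> real N *\<^sub>R y \<in> M"
  shows "\<exists>(p::nat) i b y. prime p \<and> y \<in> M' \<and> y = (\<Sum>j\<in>UNIV. b j *\<^sub>R x j) \<and>
    b i = 1 / real p \<and> (\<forall>j. real p * b j \<in> \<int>)"
proof -
  have M: "additive_subgroup M" using lattice_basis_subgroup[OF x] .
  obtain y0 where y0: "y0 \<in> M'" "y0 \<notin> M" using M'(2) by blast
  define t where "t = (LEAST t::nat. 0 < t \<and> real t *\<^sub>R y0 \<in> M)"
  have t: "0 < t" "real t *\<^sub>R y0 \<in> M"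
    using LeastI[of "\<lambda>t::nat. 0 < t \<and> real t *\<^sub>R y0 \<in> M" N] N y0(1) by (auto simp: t_def)
  have least: "t \<le> s" if "0 < s" "real s *\<^sub>R y0 \<in> M" for s
    unfolding t_def using that by (intro Least_le) simp
  have "t \<noteq> 1" using t y0 by auto
  then obtain p where p: "prime p" "p dvd t" using prime_factor_nat by blast
  then obtain s where s: "t = p * s" by (auto elim: dvdE)
  have "1 < p" using p(1) prime_gt_1_nat by blast
  have "0 < s" "s < t" using t(1) s \<open>1 < p\<close> by auto
  define y1 where "y1 = real s *\<^sub>R y0"
  have y1: "y1 \<in> M'" "y1 \<notin> M"
    using additive_subgroup_of_int_scaleR[OF M'(1) y0(1), of "int s"] least[of s] \<open>0 < s\<close> \<open>s < t\<close>
    by (auto simp: y1_def)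
  have py1: "real p *\<^sub>R y1 \<in> M" using t(2) s by (simp add: y1_def)
  obtain c where c: "y1 = (\<Sum>j\<in>UNIV. c j *\<^sub>R x j)"
    using real_coordinates x by (auto simp: lattice_basis_def)
  have pc: "real p * c j \<in> \<int>" for j
  proof -
    have "(\<Sum>j\<in>UNIV. (real p * c j) *\<^sub>R x j) \<in> M"
      using py1 by (simp add: c scaleR_sum_right)
    then show ?thesis using lattice_basis_mem_iff[OF x, of "\<lambda>j. real p * c j"] by simp
  qed
  obtain i where i: "c i \<notin> \<int>" using y1(2) c lattice_basis_mem_iff[OF x, of c] by auto
  obtain a where a: "real p * c i = of_int a" using pc[of i] by (auto elim: Ints_cases)
  have "\<not> int p dvd a"
  proof
    assume "int p dvd a"
    then obtain w where "a = int p * w" by (auto elim: dvdE)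
    then have "c i = of_int w" using a \<open>1 < p\<close> by simp
    then show False using i by simp
  qed
  then have "coprime (int p) a"
    using p(1) by (intro prime_imp_coprime) auto
  then obtain u v where uv: "u * int p + v * a = 1"
    using bezout_int[of "int p" a] coprime_imp_gcd_eq_1[of "int p" a] by auto
  \<comment> \<open>As \<open>v\<close> inverts \<open>a\<close> modulo \<open>p\<close>, this changes the coordinate \<open>a / p\<close> of \<open>y1\<close> into \<open>1 / p\<close>.\<close>
  define y where "y = of_int v *\<^sub>R y1 + of_int u *\<^sub>R x i"
  define b where "b j = of_int v * c j + (if j = i then of_int u else 0)" for j
  have "x i \<in> M'" using lattice_basis_mem[OF x] M'(2) by blast
  then have "y \<in> M'"
    unfolding y_def by (intro additive_subgroupD(4)[OF M'(1)] additive_subgroup_of_int_scaleR[OF M'(1)] y1)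
  moreover have "of_int u *\<^sub>R x i = (\<Sum>j\<in>UNIV. (if j = i then of_int u else 0) *\<^sub>R x j)"
    by (simp add: if_distrib[where f = "\<lambda>c. c *\<^sub>R _"] cong: if_cong)
  then have "y = (\<Sum>j\<in>UNIV. b j *\<^sub>R x j)"
    by (simp add: y_def b_def c scaleR_add_left sum.distrib scaleR_sum_right)
  moreover have "b i = 1 / real p"
  proof -
    have "real p * b i = of_int (u * int p + v * a)"
      by (simp add: b_def algebra_simps a[symmetric])
    then have "real p * b i = 1" by (simp only: uv of_int_1)
    then show ?thesis using \<open>1 < p\<close> by (simp add: field_simps)
  qed
  moreover have "real p * b j \<in> \<int>" for j
  proof -
    have "real p * b j = of_int v * (real p * c j) + real p * (if j = i then of_int u else 0)"
      by (simp add: b_def algebra_simps)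
    then show ?thesis using pc[of j] by auto
  qed
  ultimately show ?thesis
    using p(1) by (intro exI[of _ p] exI[of _ i] exI[of _ b] exI[of _ y]) simp
qed

text \<open>Exchanging \<open>x i\<close> for \<open>y\<close> adds \<open>y\<close> to the lattice, since \<open>p\<close> times \<open>y\<close> is \<open>x i\<close> plus an integral
combination of the other basis vectors. The multiples of \<open>y\<close> by \<open>0, \<dots>, p - 1\<close> represent the
cosets.\<close>

lemma lattice_index_prime_step:
  fixes M :: "(real^'m) set"
  assumes x: "lattice_basis M x" and p: "prime p" and y: "y = (\<Sum>j\<in>UNIV. b j *\<^sub>R x j)"
    and b: "b i = 1 / real p" "\<And>j. real p * b j \<in> \<int>"
  shows "M \<subseteq> int_span (x(i := y))" "has_index (int_span (x(i := y))) M p"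
    "\<And>a. a \<in> int_span (x(i := y)) \<Longrightarrow> real p *\<^sub>R a \<in> M"
proof -
  define x1 where "x1 = x(i := y)"
  define M1 where "M1 = int_span x1"
  have M: "additive_subgroup M" using lattice_basis_subgroup[OF x] .
  have M1: "additive_subgroup M1" by (simp add: M1_def additive_subgroup_int_span)
  have p1: "1 < p" using p prime_gt_1_nat by blast
  have py: "real p *\<^sub>R y = (\<Sum>j\<in>UNIV. (real p * b j) *\<^sub>R x j)"
    by (simp add: y scaleR_sum_right)
  then have pyM: "real p *\<^sub>R y \<in> M" using lattice_basis_mem_iff[OF x, of "\<lambda>j. real p * b j"] b(2) by simp
  have yM1: "y \<in> M1" using int_span_base[of x1 i] by (simp add: M1_def x1_def)
  have xM1: "x j \<in> M1" if "j \<noteq> i" for j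
    using int_span_base[of x1 j] that by (simp add: M1_def x1_def)
  have "x j \<in> M1" for j
  proof (cases "j = i")
    case True
    have "real p *\<^sub>R y = x i + (\<Sum>j\<in>UNIV - {i}. (real p * b j) *\<^sub>R x j)"
      unfolding py using b(1) p1 by (subst sum.remove[of _ i]) auto
    then have "x i = of_int (int p) *\<^sub>R y - (\<Sum>j\<in>UNIV - {i}. (real p * b j) *\<^sub>R x j)"
      by simp
    moreover have "(\<Sum>j\<in>UNIV - {i}. (real p * b j) *\<^sub>R x j) \<in> M1"
    proof (rule additive_subgroup_sum[OF M1])
      fix j assume "j \<in> UNIV - {i}"
      then show "(real p * b j) *\<^sub>R x j \<in> M1"
        using b(2)[of j] xM1[of j] additive_subgroup_of_int_scaleR[OF M1] by (auto elim!: Ints_cases)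
    qed
    ultimately have "x i \<in> M1"
      using additive_subgroupD(2)[OF M1] additive_subgroup_of_int_scaleR[OF M1 yM1, of "int p"] by simp
    then show ?thesis using True by simp
  qed (rule xM1)
  then show sub: "M \<subseteq> int_span (x(i := y))"
    using int_span_minimal[OF M1, of x] x by (simp add: lattice_basis_def M1_def x1_def)
  show "real p *\<^sub>R a \<in> M" if "a \<in> int_span (x(i := y))" for a
  proof -
    have "a \<in> int_span x1" using that by (simp add: x1_def)
    then obtain z where z: "a = (\<Sum>j\<in>UNIV. of_int (z j) *\<^sub>R x1 j)"
      by (auto simp: int_span_def)
    have "real p *\<^sub>R x1 j \<in> M" for j
      using pyM additive_subgroup_of_int_scaleR[OF M lattice_basis_mem[OF x, of j], of "int p"]
      by (simp add: x1_def)
    then have "(\<Sum>j\<in>UNIV. of_int (z j) *\<^sub>R real p *\<^sub>R x1 j) \<in> M"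
      by (intro additive_subgroup_sum[OF M] additive_subgroup_of_int_scaleR[OF M])
    then show ?thesis by (simp add: z scaleR_sum_right mult.commute)
  qed
  have dvd: "int p dvd m" if "of_int m *\<^sub>R y \<in> M" for m
  proof -
    have "(\<Sum>j\<in>UNIV. (of_int m * b j) *\<^sub>R x j) \<in> M"
      using that by (simp add: y scaleR_sum_right)
    then have "of_int m * b i \<in> \<int>" using lattice_basis_mem_iff[OF x, of "\<lambda>j. of_int m * b j"] by blast
    then obtain w where "of_int m / real p = of_int w" using b(1) by (auto elim: Ints_cases)
    then have "real_of_int m = of_int (int p * w)" using p1 by (simp add: field_simps)
    then have "m = int p * w" by (simp only: of_int_eq_iff)
    then show ?thesis by simp
  qed
  have same: "k = l" if "a - real k *\<^sub>R y \<in> M" "a - real l *\<^sub>R y \<in> M" "k < p" "l < p" for a k l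
  proof -
    have "(a - real k *\<^sub>R y) - (a - real l *\<^sub>R y) \<in> M" using additive_subgroupD(2)[OF M] that by blast
    then have "of_int (int l - int k) *\<^sub>R y \<in> M" by (simp add: scaleR_left_diff_distrib)
    then have "int p dvd int l - int k" by (rule dvd)
    then have "int l mod int p = int k mod int p" by (simp add: mod_eq_dvd_iff)
    then show ?thesis using that(3,4) by simp
  qed
  have "inj_on (\<lambda>k. real k *\<^sub>R y) {..<p}"
  proof (rule inj_onI)
    fix k l assume kl: "k \<in> {..<p}" "l \<in> {..<p}" "real k *\<^sub>R y = real l *\<^sub>R y"
    have "real k *\<^sub>R y - real k *\<^sub>R y \<in> M"
      using additive_subgroupD(1)[OF M] by simp
    moreover have "real k *\<^sub>R y - real l *\<^sub>R y \<in> M"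
      unfolding kl(3) using additive_subgroupD(1)[OF M] by simp
    ultimately show "k = l" using same kl(1,2) by blast
  qed
  then have "card ((\<lambda>k. real k *\<^sub>R y) ` {..<p}) = p" by (simp add: card_image)
  moreover have "transversal (int_span (x(i := y))) M ((\<lambda>k. real k *\<^sub>R y) ` {..<p})"
    unfolding transversal_def
  proof (intro conjI ballI impI)
    show "(\<lambda>k. real k *\<^sub>R y) ` {..<p} \<subseteq> int_span (x(i := y))"
      using additive_subgroup_of_int_scaleR[OF M1 yM1, of "int _"] by (auto simp: M1_def x1_def)
  next
    fix a assume "a \<in> int_span (x(i := y))"
    then have "a \<in> int_span x1" by (simp add: x1_def)
    then obtain z where z: "a = (\<Sum>j\<in>UNIV. of_int (z j) *\<^sub>R x1 j)"
      by (auto simp: int_span_def)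
    define r where "r = nat (z i mod int p)"
    have "0 < int p" using p1 by simp
    then have r: "int r = z i mod int p" "r < p" by (auto simp: r_def nat_less_iff)
    have zi: "z i = int r + int p * (z i div int p)" using r by simp
    have "a = of_int (z i) *\<^sub>R y + (\<Sum>j\<in>UNIV - {i}. of_int (z j) *\<^sub>R x1 j)"
      unfolding z by (subst sum.remove[of _ i]) (auto simp: x1_def)
    also have "of_int (z i) *\<^sub>R y = real r *\<^sub>R y + of_int (z i div int p) *\<^sub>R (real p *\<^sub>R y)"
      by (subst zi) (simp add: scaleR_add_left mult.commute)
    finally have "a - real r *\<^sub>R y
        = of_int (z i div int p) *\<^sub>R (real p *\<^sub>R y) + (\<Sum>j\<in>UNIV - {i}. of_int (z j) *\<^sub>R x1 j)"
      by simp
    also have "\<dots> \<in> M"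
      by (intro additive_subgroupD(4)[OF M] additive_subgroup_of_int_scaleR[OF M] pyM
          additive_subgroup_sum[OF M]) (simp add: x1_def lattice_basis_mem[OF x])
    finally show "\<exists>t\<in>(\<lambda>k. real k *\<^sub>R y) ` {..<p}. a - t \<in> M" using r(2) by blast
  next
    fix a s t
    assume "s \<in> (\<lambda>k. real k *\<^sub>R y) ` {..<p}" "t \<in> (\<lambda>k. real k *\<^sub>R y) ` {..<p}" "a - s \<in> M" "a - t \<in> M"
    then show "s = t" using same[of a] by auto
  qed
  ultimately show "has_index (int_span (x(i := y))) M p"
    unfolding has_index_def by blast
qed

text \<open>Every step from \<open>M\<close> towards \<open>M'\<close> adds an element of prime order \<open>p\<close>; it divides the covolume by \<open>p\<close>
and the remaining index by \<open>p\<close>. The ratio of the covolumes is an integer, which bounds the number of steps.\<close>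

lemma lattice_index:
  fixes M :: "(real^'m) set"
  assumes "lattice_basis M x" "lattice_basis M' x'" "M \<subseteq> M'"
  shows "\<exists>k>0. has_index M' M k \<and> covol x = real k * covol x' \<and>
           (\<forall>y\<in>M'. real k *\<^sub>R y \<in> M)"
proof -
  have M': "additive_subgroup M'" "M' = int_span x'" "det (vec_lambda x') \<noteq> 0"
    using assms(2) lattice_basis_subgroup by (auto simp: lattice_basis_def)
  have ratio: "\<exists>n::nat. covol y = real n * covol x'" if "\<And>i. y i \<in> M'" for y
    using abs_det_int_multiple[of y x'] that M'(2) by blast
  have "\<exists>n::nat. covol x = real n * covol x'"
    using ratio[of x] lattice_basis_mem[OF assms(1)] assms(3) by blast
  then obtain n :: nat where "covol x = real n * covol x'" by blast
  then show ?thesis using assms(1,3)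
  proof (induction n arbitrary: M x rule: less_induct)
    case (less n)
    have M: "additive_subgroup M" "M = int_span x" "det (vec_lambda x) \<noteq> 0"
      using less.prems lattice_basis_subgroup by (auto simp: lattice_basis_def)
    show ?case
    proof (cases "M = M'")
      case True
      then have "\<And>i. x' i \<in> int_span x" using lattice_basis_mem[OF assms(2)] M(2) by simp
      then obtain e :: nat where e: "covol x' = real e * covol x"
        using abs_det_int_multiple[of x' x] by blast
      then have "covol x = real n * (real e * covol x)"
        by (simp only: e[symmetric] less.prems(1)[symmetric])
      then have "real (n * e) = 1" using M(3) by simp
      then have "n = 1" by (metis of_nat_eq_1_iff nat_mult_eq_1_iff)
      then show ?thesis
        using True has_index_refl[OF M(1)] less.prems(1) by (intro exI[of _ 1]) auto
    next
      case False
      then have psub: "M \<subset> M'" using less.prems by blast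
      have n0: "0 < n" using less.prems(1) M(3) by (cases n) auto
      have tors: "real n *\<^sub>R y \<in> M" if y: "y \<in> M'" for y
      proof -
        obtain c where c: "y = (\<Sum>j\<in>UNIV. c j *\<^sub>R x j)" using real_coordinates[OF M(3)] by blast
        have "real n * c i \<in> \<int>" for i
        proof -
          have "\<And>j. (x(i := y)) j \<in> int_span x'"
            using y lattice_basis_mem[OF less.prems(2)] psub M'(2) by auto
          then obtain k :: int where "det (vec_lambda (x(i := y))) = of_int k * det (vec_lambda x')"
            using det_int_multiple[of "x(i := y)" x'] by blast
          then have "c i * det (vec_lambda x) = of_int k * det (vec_lambda x')"
            using det_replace_row[OF c, of i] by simp
          moreover have "det (vec_lambda x) = real n * det (vec_lambda x') \<or> det (vec_lambda x) = - (real n * det (vec_lambda x'))"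
            using less.prems(1) by (auto simp: abs_if split: if_splits)
          ultimately have "(real n * c i) * det (vec_lambda x') = of_int k * det (vec_lambda x') \<or>
              (real n * c i) * det (vec_lambda x') = of_int (- k) * det (vec_lambda x')"
            by (elim disjE) (simp_all add: algebra_simps)
          then have "real n * c i = of_int k \<or> real n * c i = of_int (- k)"
            using M'(3) by (auto simp only: mult_cancel_right)
          then show ?thesis by (elim disjE) (simp_all only: Ints_of_int)
        qed
        then have "(\<Sum>j\<in>UNIV. (real n * c j) *\<^sub>R x j) \<in> M"
          using lattice_basis_mem_iff[OF less.prems(2), of "\<lambda>j. real n * c j"] by blast
        then show ?thesis by (simp add: c scaleR_sum_right)
      qed
      obtain p :: nat and i b y where p: "prime p" "y \<in> M'" and y: "y = (\<Sum>j\<in>UNIV. b j *\<^sub>R x j)"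
        and b: "b i = 1 / real p" "\<And>j. real p * b j \<in> \<int>"
        using lattice_prime_torsion_coordinate[OF less.prems(2) M'(1) psub n0 tors] by metis
      define x1 where "x1 = x(i := y)"
      note step = lattice_index_prime_step[OF less.prems(2) p(1) y b, folded x1_def]
      have p1: "1 < p" using p(1) prime_gt_1_nat by blast
      have det1: "det (vec_lambda x) = real p * det (vec_lambda x1)"
        using det_replace_row[OF y, of i] b(1) p1 by (simp add: x1_def)
      then have M1: "lattice_basis (int_span x1) x1" using M(3) by (auto simp: lattice_basis_def)
      have x1M': "x1 j \<in> M'" for j
        using p(2) lattice_basis_mem[OF less.prems(2)] psub by (auto simp: x1_def)
      obtain n1 :: nat where n1: "covol x1 = real n1 * covol x'"
        using ratio[of x1] x1M' by blast
      have "real n * covol x' = real (p * n1) * covol x'"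
        by (simp add: less.prems(1)[symmetric] det1 n1 abs_mult)
      then have "n = p * n1" using M'(3) by (metis abs_eq_0_iff mult_right_cancel of_nat_eq_iff)
      moreover from this have "1 * n1 < p * n1"
        using n0 p1 by (intro mult_strict_right_mono) auto
      ultimately have "n1 < n" by simp
      moreover have sub1: "int_span x1 \<subseteq> M'" using int_span_minimal[OF M'(1), of x1] x1M' by blast
      ultimately obtain k where k: "0 < k" "has_index M' (int_span x1) k"
        "covol x1 = real k * covol x'" "\<And>y. y \<in> M' \<Longrightarrow> real k *\<^sub>R y \<in> int_span x1"
        using less.IH[OF _ n1 M1] by blast
      have "has_index M' M (k * p)"
        by (rule has_index_trans[OF M'(1) additive_subgroup_int_span M(1) step(1) sub1 k(2) step(2)])
      moreover have "covol x = real (k * p) * covol x'"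
        using det1 k(3) by (simp add: abs_mult)
      moreover have "real (k * p) *\<^sub>R y \<in> M" if "y \<in> M'" for y
        using step(3)[OF k(4)[OF that]] by (simp add: mult.commute)
      ultimately show ?thesis using k(1) p1 by (intro exI[of _ "k * p"]) auto
    qed
  qed
qed

lemma lattice_basis_abs_det_unique:
  assumes x: "lattice_basis M x" and y: "lattice_basis M y"
  shows "covol x = covol y"
proof -
  obtain m :: nat where m: "covol x = real m * covol y"
    using abs_det_int_multiple[of x y] lattice_basis_mem[OF x] y by (auto simp: lattice_basis_def)
  obtain n :: nat where n: "covol y = real n * covol x"
    using abs_det_int_multiple[of y x] lattice_basis_mem[OF y] x by (auto simp: lattice_basis_def)
  have "covol x = real m * (real n * covol x)"
    by (simp only: n[symmetric] m[symmetric])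
  then have "real (m * n) = 1" using x by (simp add: lattice_basis_def)
  then have "m = 1" by (metis of_nat_eq_1_iff nat_mult_eq_1_iff)
  then show ?thesis using m by simp
qed

text \<open>The lattice \<open>s M'\<close> is contained in \<open>M\<close>, and its index in \<open>M'\<close> is this power of \<open>s\<close>.\<close>

lemma lattice_index_dvd_power:
  fixes M :: "(real^'m) set"
  assumes x: "lattice_basis M x" and x': "lattice_basis M' x'"
    and k: "covol x = real k * covol x'"
    and s: "\<And>y. y \<in> M' \<Longrightarrow> real s *\<^sub>R y \<in> M"
  shows "k dvd s ^ CARD('m)"
proof -
  define y where "y i = real s *\<^sub>R x' i" for i
  have "\<And>i. y i \<in> int_span x"
    using s lattice_basis_mem[OF x'] x by (simp add: y_def lattice_basis_def)
  then obtain n :: nat where n: "covol y = real n * covol x"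
    using abs_det_int_multiple[of y x] by blast
  have "det (vec_lambda y) = real s ^ CARD('m) * det (vec_lambda x')"
    using Determinants.det_rows_mul[of "\<lambda>_. real s" x'] by (simp add: y_def[abs_def] scalar_mult_eq_scaleR)
  then have "(real s ^ CARD('m)) * covol x' = real (n * k) * covol x'"
    using n k by (simp add: abs_mult)
  then have "real (s ^ CARD('m)) = real (n * k)"
    using x' by (simp add: lattice_basis_def)
  then have "s ^ CARD('m) = n * k" by (simp only: of_nat_eq_iff)
  then show ?thesis by simp
qed

lemma int_det_cong:
  fixes A B :: "int^'n^'n"
  assumes "\<And>i j. [A $ i $ j = B $ i $ j] (mod p)"
  shows "[det A = det B] (mod p)"
  unfolding Determinants.det_def by (intro cong_sum cong_mult cong_prod cong_refl assms)

text \<open>Nakayama's lemma for lattices. If \<open>M' = M + p M'\<close>, then modulo \<open>p M'\<close> each basis vector of \<open>M'\<close>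
lies in \<open>M\<close>. The resulting tuple in \<open>M\<close> has a transition matrix congruent to the identity modulo
\<open>p\<close>, so it spans a lattice of index prime to \<open>p\<close>. In particular \<open>M\<close> has full rank.\<close>

lemma sublattice_index_prime_to:
  fixes M' :: "(real^'m) set"
  assumes x': "lattice_basis M' x'" and M: "additive_subgroup M" "M \<subseteq> M'" and p: "prime (p::nat)"
    and cover: "\<And>y. y \<in> M' \<Longrightarrow> \<exists>a\<in>M. \<exists>b\<in>M'. y = a + real p *\<^sub>R b"
  obtains x k where "lattice_basis M x" "covol x = real k * covol x'"
    "\<not> p dvd k" "\<And>y. y \<in> M' \<Longrightarrow> real k *\<^sub>R y \<in> M"
proof -
  have "\<forall>i. \<exists>a z. a \<in> M \<and> x' i = a + real p *\<^sub>R (\<Sum>j\<in>UNIV. of_int (z j) *\<^sub>R x' j)"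
  proof
    fix i
    obtain a b where ab: "a \<in> M" "b \<in> M'" "x' i = a + real p *\<^sub>R b"
      using cover[OF lattice_basis_mem[OF x', of i]] by blast
    from ab(2) obtain z where "b = (\<Sum>j\<in>UNIV. of_int (z j) *\<^sub>R x' j)"
      using x' by (auto simp: lattice_basis_def int_span_def)
    then show "\<exists>a z. a \<in> M \<and> x' i = a + real p *\<^sub>R (\<Sum>j\<in>UNIV. of_int (z j) *\<^sub>R x' j)"
      using ab by blast
  qed
  then obtain a z where a: "\<And>i. a i \<in> M" "\<And>i. x' i = a i + real p *\<^sub>R (\<Sum>j\<in>UNIV. of_int (z i j) *\<^sub>R x' j)"
    by metis
  \<comment> \<open>The transition matrix from \<open>x'\<close> to \<open>a\<close> is \<open>1 - p z\<close>.\<close>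
  define w where "w i j = (if i = j then 1 else 0) - int p * z i j" for i j
  have aw: "a i = (\<Sum>j\<in>UNIV. of_int (w i j) *\<^sub>R x' j)" for i
  proof -
    have "(\<Sum>j\<in>UNIV. of_int (w i j) *\<^sub>R x' j)
        = (\<Sum>j\<in>UNIV. (if i = j then x' j else 0) - real p *\<^sub>R (of_int (z i j) *\<^sub>R x' j))"
      by (intro sum.cong refl) (simp add: w_def scaleR_left_diff_distrib)
    also have "\<dots> = x' i - real p *\<^sub>R (\<Sum>j\<in>UNIV. of_int (z i j) *\<^sub>R x' j)"
      by (simp add: sum_subtractf scaleR_sum_right)
    also have "\<dots> = a i" using a(2)[of i] by simp
    finally show ?thesis by simp
  qed
  define D where "D = det (\<chi> i j. w i j)"
  have detA: "det (vec_lambda a) = of_int D * det (vec_lambda x')"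
    unfolding D_def by (rule det_int_combinations[OF aw])
  have "[D = det (mat 1 :: int^'m^'m)] (mod int p)"
    unfolding D_def by (rule int_det_cong) (simp add: w_def Finite_Cartesian_Product.mat_def cong_def mod_diff_right_eq[symmetric])
  then have "[D = 1] (mod int p)" by simp
  then have pD: "\<not> int p dvd D"
    using p prime_gt_1_nat[OF p] by (metis cong_dvd_iff dvd_refl int_dvd_int_iff nat_dvd_1_iff_1 of_nat_1 less_irrefl)
  then have D0: "D \<noteq> 0" by auto
  then have la: "lattice_basis (int_span a) a"
    using detA x' by (simp add: lattice_basis_def)
  have sub: "int_span a \<subseteq> M" using int_span_minimal[OF M(1), of a] a(1) by blast
  obtain x where x: "lattice_basis M x"
    using lattice_basis_between[OF M(1) la sub x' M(2)] by blast
  obtain k where k: "covol x = real k * covol x'" "\<And>y. y \<in> M' \<Longrightarrow> real k *\<^sub>R y \<in> M"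
    using lattice_index[OF x x' M(2)] by blast
  obtain n :: nat where n: "covol a = real n * covol x"
    using abs_det_int_multiple[of a x] a(1) x by (auto simp: lattice_basis_def)
  have "real_of_int \<bar>D\<bar> * covol x' = real (n * k) * covol x'"
    using n k(1) detA by (simp add: abs_mult)
  then have "real_of_int \<bar>D\<bar> = of_int (int (n * k))"
    using x' by (simp add: lattice_basis_def)
  then have "\<bar>D\<bar> = int (n * k)" by (simp only: of_int_eq_iff)
  then have "\<not> p dvd k"
    using pD by (metis dvd_abs_iff dvd_mult int_dvd_int_iff)
  then show ?thesis using that x k by blast
qed

section \<open>The dual lattice\<close>

text \<open>The dual basis, given by the inverse of the matrix whose rows are the vectors \<open>H *v x i\<close>.\<close>

lemma dual_lattice_basis:
  fixes M :: "(real^'m) set" and H :: "real^'m^'m"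
  assumes x: "lattice_basis M x" and H: "det H \<noteq> 0"
  obtains y where "lattice_basis {v. \<forall>w\<in>M. v \<bullet> (H *v w) \<in> \<int>} y"
    "covol y * \<bar>det H\<bar> * covol x = 1"
proof -
  define W where "W = vec_lambda x ** transpose H"
  have Wv: "(W *v v) $ i = v \<bullet> (H *v x i)" for v i
    by (simp add: W_def matrix_vector_mult_def matrix_matrix_mult_def inner_vec_def transpose_def
        sum_distrib_left sum_distrib_right mult.commute mult.left_commute)
  have detW: "det W = det (vec_lambda x) * det H" by (simp add: W_def det_mul)
  then have "det W \<noteq> 0" using x H by (simp add: lattice_basis_def)
  then obtain B where B: "W ** B = mat 1" "B ** W = mat 1"
    by (auto simp: invertible_det_nz[symmetric] invertible_def)
  define y where "y i = column i B" for i
  have yB: "vec_lambda y = transpose B"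
    by (intro vec_eq_iff[THEN iffD2] allI) (simp add: y_def column_def transpose_def)
  have "det W * det B = 1" using B(1) by (metis det_I det_mul)
  then have dets: "det (vec_lambda y) * (det H * det (vec_lambda x)) = 1"
    by (simp add: yB detW mult.commute)
  have comb: "(\<Sum>i\<in>UNIV. c $ i *\<^sub>R y i) = B *v c" for c
    by (intro vec_eq_iff[THEN iffD2] allI)
       (simp add: y_def column_def matrix_vector_mult_def mult.commute)
  have "{v. \<forall>w\<in>M. v \<bullet> (H *v w) \<in> \<int>} = int_span y"
  proof (intro equalityI subsetI)
    fix v assume v: "v \<in> {v. \<forall>w\<in>M. v \<bullet> (H *v w) \<in> \<int>}"
    have "(W *v v) $ i \<in> \<int>" for i
      using v lattice_basis_mem[OF x, of i] by (simp add: Wv)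
    then have "\<forall>i. \<exists>z. (W *v v) $ i = of_int z" by (auto elim: Ints_cases)
    then obtain z where z: "\<And>i. (W *v v) $ i = of_int (z i)" by metis
    have "v = B *v (W *v v)" by (simp add: matrix_vector_mul_assoc B)
    also have "\<dots> = (\<Sum>i\<in>UNIV. of_int (z i) *\<^sub>R y i)" by (simp add: comb[symmetric] z)
    finally show "v \<in> int_span y" using int_spanI[of z y] by simp
  next
    fix v assume "v \<in> int_span y"
    then obtain z where z: "v = (\<Sum>i\<in>UNIV. of_int (z i) *\<^sub>R y i)" by (auto simp: int_span_def)
    then have "v = B *v (\<chi> i. of_int (z i))" by (simp add: comb[symmetric])
    then have "W *v v = (\<chi> i. of_int (z i))" by (simp add: matrix_vector_mul_assoc B)
    then have "v \<bullet> (H *v x i) = of_int (z i)" for i using Wv[of v i] by simp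
    then have gen: "v \<bullet> (H *v x i) \<in> \<int>" for i by simp
    have "v \<bullet> (H *v w) \<in> \<int>" if "w \<in> M" for w
    proof -
      have "w \<in> int_span x" using that x by (simp add: lattice_basis_def)
      then obtain u where "w = (\<Sum>i\<in>UNIV. of_int (u i) *\<^sub>R x i)"
        by (auto simp: int_span_def)
      then have "v \<bullet> (H *v w) = (\<Sum>i\<in>UNIV. of_int (u i) * (v \<bullet> (H *v x i)))"
        by (simp add: linear_sum[OF matrix_vector_mul_linear] linear_scale[OF matrix_vector_mul_linear] inner_sum_right)
      then show ?thesis using gen by (auto intro!: Ints_sum Ints_mult)
    qed
    then show "v \<in> {v. \<forall>w\<in>M. v \<bullet> (H *v w) \<in> \<int>}" by blast
  qed
  moreover have "det (vec_lambda y) \<noteq> 0" using dets by auto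
  moreover have "covol y * \<bar>det H\<bar> * covol x = 1"
    using dets by (metis abs_mult abs_one mult.assoc)
  ultimately show ?thesis using that by (auto simp: lattice_basis_def)
qed

section \<open>Determinants of block diagonal matrices\<close>

lemma det_shear:
  assumes "m \<noteq> n"
  shows "det (\<chi> i j. (if i = m \<and> j = n then c else of_bool (i = j) :: real)) = 1"
proof -
  have "det (\<chi> k. if k = m then row m (mat 1 :: real^'a^'a) + c *s row n (mat 1) else row k (mat 1)) = 1"
    using det_row_operation[OF assms, of "mat 1 :: real^'a^'a" c] by simp
  moreover have "(\<chi> k. if k = m then row m (mat 1 :: real^'a^'a) + c *s row n (mat 1) else row k (mat 1))
      = (\<chi> i j. if i = m \<and> j = n then c else of_bool (i = j))"
    using assms by (intro vec_eq_iff[THEN iffD2] allI) (auto simp: row_def mat_def)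
  ultimately show ?thesis by simp
qed

lemma det_swap:
  assumes "m \<noteq> n"
  shows "det (\<chi> i j. (mat 1 :: real^'a^'a) $ i $ Transposition.transpose m n j) = - 1"
  using det_permute_columns[OF permutes_swap_id[of m UNIV n], of "mat 1 :: real^'a^'a"] assms
  by (simp add: sign_swap_id)

context
  fixes f :: "'m::finite \<Rightarrow> 'q::finite" and g :: "'m \<Rightarrow> 'p::finite"
  assumes bij: "bij (\<lambda>r. (f r, g r))"
begin

text \<open>The index set \<open>'m\<close> is a product of \<open>'q\<close> and \<open>'p\<close>, with projections \<open>f\<close> and \<open>g\<close>. Keeping the
projections abstract lets the same lemma treat blocks indexed by either factor. The matrix below is
\<open>A\<close> on the block over \<open>t\<close> and the identity elsewhere.\<close>

definition fibre_block :: "'q \<Rightarrow> real^'p^'p \<Rightarrow> real^'m^'m" where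
  "fibre_block t A = (\<chi> r c. if f r = t \<and> f c = t then A $ g r $ g c else of_bool (r = c))"

lemma fibre_eqI: "f r = f s \<Longrightarrow> g r = g s \<Longrightarrow> r = s"
  using bij by (auto simp: bij_def inj_def)

lemma fibre_eq_iff: "r = s \<longleftrightarrow> f r = f s \<and> g r = g s"
  using fibre_eqI by blast

lemma fibre_obtain: obtains r where "f r = t" "g r = a"
proof -
  have "(t, a) \<in> range (\<lambda>r. (f r, g r))" using bij by (simp add: bij_def)
  then show ?thesis using that by auto
qed

lemma bij_betw_fibre: "bij_betw g {r. f r = t} UNIV"
  unfolding bij_betw_def
proof
  show "inj_on g {r. f r = t}" using fibre_eqI by (auto simp: inj_on_def)
  have "a \<in> g ` {r. f r = t}" for a
    by (rule fibre_obtain[of t a]) auto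
  then show "g ` {r. f r = t} = UNIV" by blast
qed

lemma sum_fibre: "(\<Sum>r\<in>{r. f r = t}. F (g r)) = (\<Sum>a\<in>UNIV. F a)"
  by (rule sum.reindex_bij_betw[OF bij_betw_fibre])

lemma fibre_block_mult: "fibre_block t (A ** B) = fibre_block t A ** fibre_block t B"
proof (intro vec_eq_iff[THEN iffD2] allI)
  fix r c
  show "fibre_block t (A ** B) $ r $ c = (fibre_block t A ** fibre_block t B) $ r $ c"
  proof (cases "f r = t")
    case True
    have "(fibre_block t A ** fibre_block t B) $ r $ c
        = (\<Sum>k\<in>{k. f k = t}. A $ g r $ g k * fibre_block t B $ k $ c)"
      unfolding matrix_matrix_mult_def
      using True by (simp add: fibre_block_def) (intro sum.mono_neutral_cong_right, auto)
    also have "\<dots> = (if f c = t then (\<Sum>k\<in>{k. f k = t}. A $ g r $ g k * B $ g k $ g c) else 0)"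
      by (auto simp: fibre_block_def intro!: sum.neutral)
    also have "(\<Sum>k\<in>{k. f k = t}. A $ g r $ g k * B $ g k $ g c) = (A ** B) $ g r $ g c"
      by (simp add: sum_fibre[of "\<lambda>k. A $ g r $ k * B $ k $ g c"] matrix_matrix_mult_def)
    finally show ?thesis using True by (auto simp: fibre_block_def)
  next
    case False
    then have "(fibre_block t A ** fibre_block t B) $ r $ c = (\<Sum>k\<in>UNIV. of_bool (r = k) * fibre_block t B $ k $ c)"
      by (simp add: matrix_matrix_mult_def fibre_block_def)
    also have "\<dots> = fibre_block t B $ r $ c" by simp
    finally show ?thesis using False by (simp add: fibre_block_def)
  qed
qed

text \<open>Both sides are multiplicative in \<open>A\<close>, so it suffices that \<open>A\<close> has a zero row, is diagonal, exchanges two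
coordinates, or differs from the identity in one entry off the diagonal. The block matrix is then of the same kind.\<close>

lemma det_fibre_block: "det (fibre_block t A) = det A"
proof (induction A rule: induct_matrix_elementary)
  case (1 A B)
  then show ?case by (simp add: fibre_block_mult det_mul)
next
  case (2 A i)
  obtain r where r: "f r = t" "g r = i" by (rule fibre_obtain)
  have "A $ i $ b = 0" for b using 2 by (simp add: row_def vec_eq_iff)
  then have "row r (fibre_block t A) = 0"
    using r by (auto simp: row_def fibre_block_def vec_eq_iff)
  then show ?case using det_zero_row 2 by metis
next
  case (3 A)
  have "fibre_block t A $ r $ c = 0" if "r \<noteq> c" for r c
    using that 3[of "g r" "g c"] fibre_eqI[of r c] by (cases "g r = g c") (auto simp: fibre_block_def)
  then have "det (fibre_block t A) = (\<Prod>r\<in>UNIV. fibre_block t A $ r $ r)"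
    by (rule det_diagonal)
  also have "\<dots> = (\<Prod>r\<in>{r. f r = t}. A $ g r $ g r)"
    by (intro prod.mono_neutral_cong_right) (auto simp: fibre_block_def)
  also have "\<dots> = (\<Prod>a\<in>UNIV. A $ a $ a)"
    by (rule prod.reindex_bij_betw[OF bij_betw_fibre])
  also have "\<dots> = det A" using det_diagonal[OF 3] by simp
  finally show ?case .
next
  case (4 m n)
  obtain r where r0: "f r = t" "g r = m" by (rule fibre_obtain)
  obtain s where s0: "f s = t" "g s = n" by (rule fibre_obtain)
  note r = r0 s0
  then have "r \<noteq> s" using 4 by auto
  have "fibre_block t (\<chi> i j. mat 1 $ i $ Transposition.transpose m n j)
      = (\<chi> i j. mat 1 $ i $ Transposition.transpose r s j)"
  proof (intro vec_eq_iff[THEN iffD2] allI)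
    fix x y
    have tf: "f (Transposition.transpose r s y) = f y"
      by (simp add: Transposition.transpose_def r0(1) s0(1))
    show "fibre_block t (\<chi> i j. mat 1 $ i $ Transposition.transpose m n j) $ x $ y
        = (\<chi> i j. mat 1 $ i $ Transposition.transpose r s j) $ x $ y"
    proof (cases "f x = t \<and> f y = t")
      case True
      have "y = r \<longleftrightarrow> g y = m" "y = s \<longleftrightarrow> g y = n"
        using fibre_eq_iff[of y r] fibre_eq_iff[of y s] True r by simp_all
      then have "g (Transposition.transpose r s y) = Transposition.transpose m n (g y)"
        by (simp add: Transposition.transpose_def r)
      then have "x = Transposition.transpose r s y \<longleftrightarrow> g x = Transposition.transpose m n (g y)"
        using fibre_eq_iff[of x "Transposition.transpose r s y"] True tf by simp
      then show ?thesis using True by (simp add: fibre_block_def mat_def)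
    next
      case False
      have "x = Transposition.transpose r s y \<longleftrightarrow> x = y"
      proof (cases "f y = t")
        case True
        then have "f x \<noteq> f y" using False by simp
        then show ?thesis using tf by auto
      next
        case False
        then have "y \<noteq> r" "y \<noteq> s" using r by auto
        then show ?thesis by simp
      qed
      then show ?thesis using False by (auto simp: fibre_block_def mat_def)
    qed
  qed
  then show ?case by (simp only: det_swap[OF 4] det_swap[OF \<open>r \<noteq> s\<close>])
next
  case (5 m n c)
  obtain r where r0: "f r = t" "g r = m" by (rule fibre_obtain)
  obtain s where s0: "f s = t" "g s = n" by (rule fibre_obtain)
  note r = r0 s0
  then have "r \<noteq> s" using 5 by auto
  have "fibre_block t (\<chi> i j. if i = m \<and> j = n then c else of_bool (i = j))
      = (\<chi> i j. if i = r \<and> j = s then c else of_bool (i = j))"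
  proof (intro vec_eq_iff[THEN iffD2] allI)
    fix x y
    show "fibre_block t (\<chi> i j. if i = m \<and> j = n then c else of_bool (i = j)) $ x $ y
        = (\<chi> i j. if i = r \<and> j = s then c else of_bool (i = j)) $ x $ y"
    proof (cases "f x = t \<and> f y = t")
      case True
      have "x = r \<longleftrightarrow> g x = m" "y = s \<longleftrightarrow> g y = n" "x = y \<longleftrightarrow> g x = g y"
        using fibre_eq_iff[of x r] fibre_eq_iff[of y s] fibre_eq_iff[of x y] True r by simp_all
      then show ?thesis using True by (simp add: fibre_block_def)
    next
      case False
      then have "\<not> (x = r \<and> y = s)" using r by auto
      then show ?thesis using False by (auto simp: fibre_block_def)
    qed
  qed
  then show ?case by (simp only: det_shear[OF 5] det_shear[OF \<open>r \<noteq> s\<close>])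
qed

text \<open>A block diagonal matrix is the product of matrices with a single nontrivial block.\<close>

lemma det_block_diagonal:
  "det (\<chi> r c. if f r = f c then A (f r) $ g r $ g c else 0) = (\<Prod>t\<in>UNIV. det (A t :: real^'p^'p))"
proof -
  define Bl where "Bl F = (\<chi> r c. if f r = f c then (if f r \<in> F then A (f r) $ g r $ g c else of_bool (g r = g c)) else 0)" for F
  have "det (Bl F) = (\<Prod>t\<in>F. det (A t))" if "finite F" for F
    using that
  proof (induction F)
    case empty
    have "Bl {} = mat 1"
      by (intro vec_eq_iff[THEN iffD2] allI) (auto simp: Bl_def mat_def fibre_eq_iff)
    then show ?case by simp
  next
    case (insert t F)
    have "Bl (insert t F) = fibre_block t (A t) ** Bl F"
    proof (intro vec_eq_iff[THEN iffD2] allI)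
      fix r c
      show "Bl (insert t F) $ r $ c = (fibre_block t (A t) ** Bl F) $ r $ c"
      proof (cases "f r = t")
        case True
        have "(fibre_block t (A t) ** Bl F) $ r $ c = (\<Sum>k\<in>{k. f k = t}. A t $ g r $ g k * Bl F $ k $ c)"
          unfolding matrix_matrix_mult_def
          using True by (simp add: fibre_block_def) (intro sum.mono_neutral_cong_right, auto)
        also have "\<dots> = (\<Sum>k\<in>{k. f k = t}. if f c = t \<and> g k = g c then A t $ g r $ g k else 0)"
          using insert.hyps by (intro sum.cong refl) (auto simp: Bl_def)
        also have "\<dots> = (\<Sum>a\<in>UNIV. if f c = t \<and> a = g c then A t $ g r $ a else 0)"
          by (rule sum_fibre)
        also have "\<dots> = (if f c = t then A t $ g r $ g c else 0)" by auto
        finally show ?thesis using True by (auto simp: Bl_def)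
      next
        case False
        then have "(fibre_block t (A t) ** Bl F) $ r $ c = (\<Sum>k\<in>UNIV. of_bool (r = k) * Bl F $ k $ c)"
          by (simp add: matrix_matrix_mult_def fibre_block_def)
        also have "\<dots> = Bl F $ r $ c" by simp
        finally show ?thesis using False by (simp add: Bl_def)
      qed
    qed
    then show ?case using insert by (simp add: det_mul det_fibre_block)
  qed
  from this[of UNIV] show ?thesis by (simp add: Bl_def cong: if_cong)
qed

end

section \<open>Embeddings of fields\<close>

lemma field_embeddingD:
  assumes "field_embedding \<tau>"
  shows "\<tau> 1 = 1" "\<tau> (x + y) = \<tau> x + \<tau> y" "\<tau> (x * y) = \<tau> x * \<tau> y" "\<tau> 0 = 0" "\<tau> (- x) = - \<tau> x"
    "\<tau> (x - y) = \<tau> x - \<tau> y" "\<tau> x = 0 \<longleftrightarrow> x = 0" "\<tau> (x ^ n) = \<tau> x ^ n"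
proof -
  show one: "\<tau> 1 = 1" and add: "\<tau> (x + y) = \<tau> x + \<tau> y" and mult: "\<tau> (x * y) = \<tau> x * \<tau> y" for x y
    using assms by (auto simp: field_embedding_def)
  show zero: "\<tau> 0 = 0" using add[of 0 0] by (metis add_0 add_cancel_left_right)
  show minus: "\<tau> (- x) = - \<tau> x" for x using add[of x "- x"] zero by (simp add: eq_neg_iff_add_eq_0 add.commute)
  show "\<tau> (x - y) = \<tau> x - \<tau> y" using add[of x "- y"] minus by simp
  show "\<tau> x = 0 \<longleftrightarrow> x = 0"
  proof
    assume "\<tau> x = 0"
    then have "\<tau> (x * inverse x) = 0" by (simp add: mult)
    then show "x = 0" using one by (cases "x = 0") auto
  qed (simp add: zero)
  show "\<tau> (x ^ n) = \<tau> x ^ n" by (induction n) (simp_all add: one mult)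
qed

lemma field_embedding_of_nat:
  fixes \<tau> :: "'k::field_char_0 \<Rightarrow> 'l::field_char_0"
  assumes "field_embedding \<tau>"
  shows "\<tau> (of_nat n) = of_nat n"
  by (induction n) (simp_all add: field_embeddingD[OF assms])

lemma field_embedding_of_int:
  fixes \<tau> :: "'k::field_char_0 \<Rightarrow> 'l::field_char_0"
  assumes "field_embedding \<tau>"
  shows "\<tau> (of_int z) = of_int z"
  by (cases z) (simp_all add: field_embeddingD[OF assms] field_embedding_of_nat[OF assms] del: of_nat_Suc)

lemma field_embedding_of_rat:
  fixes \<tau> :: "'k::field_char_0 \<Rightarrow> 'l::field_char_0"
  assumes "field_embedding \<tau>"
  shows "\<tau> (of_rat q) = of_rat q"
proof (cases q)
  case (Fract a b)
  have "\<tau> (of_rat q) * of_int b = \<tau> (of_rat q * of_int b)"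
    by (simp add: field_embeddingD[OF assms] field_embedding_of_int[OF assms])
  also have "\<dots> = of_int a"
    using Fract by (simp add: of_rat_rat field_embedding_of_int[OF assms])
  finally show ?thesis using Fract by (simp add: of_rat_rat field_simps)
qed

lemma field_embedding_prod:
  assumes "field_embedding \<tau>"
  shows "\<tau> (\<Prod>a\<in>A. g a) = (\<Prod>a\<in>A. \<tau> (g a))"
  by (induction A rule: infinite_finite_induct) (simp_all add: field_embeddingD[OF assms])

lemma field_embedding_det:
  fixes \<tau> :: "'k::field_char_0 \<Rightarrow> 'l::field_char_0" and A :: "'k^'n^'n"
  assumes "field_embedding \<tau>"
  shows "\<tau> (det A) = det (\<chi> i j. \<tau> (A $ i $ j))"
  unfolding Determinants.det_def
  by (subst field_embedding_sum[OF assms])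
     (simp_all add: field_embeddingD[OF assms] field_embedding_prod[OF assms] field_embedding_of_int[OF assms])

lemma algebraic_int_field_embedding:
  fixes \<tau> :: "'k::field_char_0 \<Rightarrow> 'l::field_char_0"
  assumes \<tau>: "field_embedding \<tau>" and x: "algebraic_int x"
  shows "algebraic_int (\<tau> x)"
proof -
  obtain p :: "int poly" where p: "poly (of_int_poly p) x = 0" "lead_coeff p = 1"
    using x unfolding algebraic_int_altdef_ipoly by blast
  have "poly (of_int_poly p) (\<tau> x) = \<tau> (poly (of_int_poly p) x)"
    by (simp add: poly_altdef field_embedding_sum[OF \<tau>] field_embeddingD[OF \<tau>] field_embedding_of_int[OF \<tau>])
  then show ?thesis
    unfolding algebraic_int_altdef_ipoly using p by (intro exI[of _ p]) (simp add: field_embeddingD(4)[OF \<tau>])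
qed

text \<open>Dedekind's lemma. Replacing \<open>x\<close> by \<open>y * x\<close> in a relation and subtracting \<open>\<tau>0 y\<close> times the relation
removes \<open>\<tau>0\<close>; the remaining coefficients vanish by induction, and \<open>y\<close> can be chosen to separate a given
\<open>\<tau>\<close> from \<open>\<tau>0\<close>.\<close>

lemma field_embeddings_independent:
  fixes S :: "('k::field \<Rightarrow> 'l::field) set"
  assumes "finite S" "\<And>\<tau>. \<tau> \<in> S \<Longrightarrow> field_embedding \<tau>" "\<And>x. (\<Sum>\<tau>\<in>S. c \<tau> * \<tau> x) = 0" "\<tau> \<in> S"
  shows "c \<tau> = 0"
  using assms
proof (induction S arbitrary: c \<tau>)
  case (insert \<tau>0 S)
  have rel: "c \<tau>0 * \<tau>0 x + (\<Sum>\<tau>\<in>S. c \<tau> * \<tau> x) = 0" for x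
    using insert.prems(2)[of x] insert.hyps by simp
  have cS: "c \<rho> = 0" if \<rho>: "\<rho> \<in> S" for \<rho>
  proof -
    have "\<rho> \<noteq> \<tau>0" using \<rho> insert.hyps by blast
    then obtain y where y: "\<rho> y \<noteq> \<tau>0 y" by blast
    have "(\<Sum>\<tau>\<in>S. (c \<tau> * (\<tau> y - \<tau>0 y)) * \<tau> x) = 0" for x
    proof -
      have "(\<Sum>\<tau>\<in>S. (c \<tau> * (\<tau> y - \<tau>0 y)) * \<tau> x) = (\<Sum>\<tau>\<in>S. c \<tau> * \<tau> (y * x)) - \<tau>0 y * (\<Sum>\<tau>\<in>S. c \<tau> * \<tau> x)"
        unfolding sum_distrib_left sum_subtractf[symmetric]
        using insert.prems(1) by (intro sum.cong refl) (simp add: field_embeddingD(3) algebra_simps)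
      also have "\<dots> = - (c \<tau>0 * \<tau>0 (y * x)) + \<tau>0 y * (c \<tau>0 * \<tau>0 x)"
        using rel[of "y * x"] rel[of x] by (simp add: eq_neg_iff_add_eq_0[symmetric] add.commute)
      also have "\<dots> = 0"
        using insert.prems(1)[of \<tau>0] by (simp add: field_embeddingD(3))
      finally show ?thesis .
    qed
    then have "c \<rho> * (\<rho> y - \<tau>0 y) = 0"
      using insert.IH[of "\<lambda>\<tau>. c \<tau> * (\<tau> y - \<tau>0 y)" \<rho>] insert.prems(1) \<rho> by blast
    then show ?thesis using y by simp
  qed
  then have "c \<tau>0 * \<tau>0 1 = 0" using rel[of 1] by simp
  then have "c \<tau>0 = 0" using insert.prems(1)[of \<tau>0] by (simp add: field_embeddingD(1))
  then show ?case using cS insert.prems(3) by blast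
qed simp

section \<open>Trace, integral bases and discriminant\<close>

lemma common_denominator:
  assumes "finite A"
  shows "\<exists>N>0. \<forall>q\<in>A. of_nat N * (q::rat) \<in> \<int>"
  using assms
proof (induction A)
  case empty
  show ?case by (intro exI[of _ 1]) simp
next
  case (insert q A)
  then obtain N where N: "0 < N" "\<And>r. r \<in> A \<Longrightarrow> of_nat N * r \<in> \<int>" by blast
  obtain a b where q: "q = of_int a / of_int b" "b > 0"
    by (metis Fract_of_int_quotient Rat_cases)
  have eq: "of_nat (nat b * N) * q = of_nat N * of_int a"
    using q by (simp add: field_simps)
  have "of_nat (nat b * N) * q \<in> \<int>"
    unfolding eq by (intro Ints_mult Ints_of_nat Ints_of_int)
  moreover have "of_nat (nat b * N) * r \<in> \<int>" if "r \<in> A" for r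
  proof -
    have eq: "of_nat (nat b * N) * r = of_nat (nat b) * (of_nat N * r)" by (simp add: mult.assoc)
    show ?thesis unfolding eq by (intro Ints_mult Ints_of_nat N(2) that)
  qed
  ultimately show ?case using N(1) q(2) by (intro exI[of _ "nat b * N"]) auto
qed

interpretation rat_module: vector_space "rat_scale :: rat \<Rightarrow> 'k::field_char_0 \<Rightarrow> 'k"
  by unfold_locales (simp_all add: algebra_simps of_rat_add of_rat_mult)

text \<open>That \<open>K\<close> is totally real is expressed by the existence of as many real embeddings as its degree.\<close>

locale real_embedding_family =
  fixes \<sigma> :: "'d::finite \<Rightarrow> 'k::field_char_0 \<Rightarrow> real"
  assumes degree: "field_degree TYPE('k) = CARD('d)"
    and embeddings: "bij_betw \<sigma> UNIV real_embeddings"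
begin

text \<open>The Minkowski embedding of \<open>K\<close>, which turns ideals into lattices in Euclidean space.\<close>

definition minkowski :: "'k \<Rightarrow> real^'d" where
  "minkowski x = (\<chi> j. \<sigma> j x)"

text \<open>The absolute value of the norm of \<open>x\<close> over the rational numbers.\<close>

definition abs_norm :: "'k \<Rightarrow> real" where
  "abs_norm x = \<bar>\<Prod>j\<in>UNIV. \<sigma> j x\<bar>"

lemma emb: "field_embedding (\<sigma> j)"
  using embeddings by (auto simp: bij_betw_def real_embeddings_def)

lemmas emb_simps = field_embeddingD[OF emb] field_embedding_of_nat[OF emb] field_embedding_of_int[OF emb]
  field_embedding_of_rat[OF emb]

lemma minkowski_simps:
  "minkowski 0 = 0" "minkowski (x + y) = minkowski x + minkowski y"
  "minkowski (x - y) = minkowski x - minkowski y"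
  "minkowski (of_int z * x) = of_int z *\<^sub>R minkowski x"
  "minkowski (of_nat n * x) = of_nat n *\<^sub>R minkowski x"
  by (simp_all add: minkowski_def vec_eq_iff emb_simps)

lemma minkowski_sum: "minkowski (\<Sum>i\<in>A. f i) = (\<Sum>i\<in>A. minkowski (f i))"
  by (induction A rule: infinite_finite_induct) (simp_all add: minkowski_simps)

lemma inj_minkowski: "inj minkowski"
proof (rule injI)
  fix x y assume "minkowski x = minkowski y"
  then have "minkowski (x - y) = 0" by (simp add: minkowski_simps)
  then have "\<sigma> undefined (x - y) = 0" by (simp add: minkowski_def vec_eq_iff)
  then have "x - y = 0" using field_embeddingD(7)[OF emb] by blast
  then show "x = y" by simp
qed

text \<open>A vector in the kernel of this matrix is a linear relation between the embeddings on a basis of \<open>K\<close>,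
hence on all of \<open>K\<close>.\<close>

lemma embeddings_det_nonzero:
  assumes gen: "\<And>x. \<exists>q::'d \<Rightarrow> rat. x = (\<Sum>i\<in>UNIV. of_rat (q i) * b i)"
  shows "det (\<chi> i j. \<sigma> j (b i)) \<noteq> 0"
proof
  assume zero: "det (\<chi> i j. \<sigma> j (b i)) = 0"
  have "\<not> (\<exists>B::real^'d^'d. B ** (\<chi> i j. \<sigma> j (b i)) = mat 1)"
  proof
    assume "\<exists>B::real^'d^'d. B ** (\<chi> i j. \<sigma> j (b i)) = mat 1"
    then obtain B :: "real^'d^'d" where "B ** (\<chi> i j. \<sigma> j (b i)) = mat 1" by blast
    then have "det B * det (\<chi> i j. \<sigma> j (b i)) = 1" by (simp flip: Determinants.det_mul)
    then show False using zero by simp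
  qed
  then obtain v :: "real^'d" where v: "v \<noteq> 0" "(\<chi> i j. \<sigma> j (b i)) *v v = 0"
    unfolding matrix_left_invertible_ker by blast
  have "(\<Sum>j\<in>UNIV. \<sigma> j (b i) * v $ j) = 0" for i
    using v(2) by (simp add: vec_eq_iff matrix_vector_mult_def)
  then have bi: "(\<Sum>j\<in>UNIV. v $ j * \<sigma> j (b i)) = 0" for i
    by (simp add: mult.commute)
  have rel: "(\<Sum>j\<in>UNIV. v $ j * \<sigma> j x) = 0" for x
  proof -
    obtain q where q: "x = (\<Sum>i\<in>UNIV. of_rat (q i) * b i)" using gen by blast
    have "(\<Sum>j\<in>UNIV. v $ j * \<sigma> j x) = (\<Sum>j\<in>UNIV. \<Sum>i\<in>UNIV. of_rat (q i) * (v $ j * \<sigma> j (b i)))"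
      by (simp add: q field_embedding_sum[OF emb] emb_simps sum_distrib_left mult.left_commute)
    also have "\<dots> = (\<Sum>i\<in>UNIV. of_rat (q i) * (\<Sum>j\<in>UNIV. v $ j * \<sigma> j (b i)))"
      by (subst sum.swap) (simp add: sum_distrib_left)
    finally show ?thesis by (simp add: bi)
  qed
  have inj: "inj \<sigma>" using embeddings by (simp add: bij_betw_def)
  have "v $ j = 0" for j
  proof -
    have "(\<Sum>\<tau>\<in>range \<sigma>. v $ (inv_into UNIV \<sigma> \<tau>) * \<tau> x) = 0" for x
      by (subst sum.reindex[OF inj]) (simp add: inj rel)
    then have "v $ (inv_into UNIV \<sigma> (\<sigma> j)) = 0"
      by (rule field_embeddings_independent[of "range \<sigma>" "\<lambda>\<tau>. v $ (inv_into UNIV \<sigma> \<tau>)" "\<sigma> j", rotated 2])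
        (auto simp: emb)
    then show ?thesis by (simp add: inj inv_into_f_f)
  qed
  then show False using v(1) by (simp add: vec_eq_iff)
qed

lemma rational_basis_enumeration:
  assumes B: "rat_module.independent (B :: 'k set)" "rat_module.span B = UNIV"
  shows "\<exists>\<beta> :: 'd \<Rightarrow> 'k. bij_betw \<beta> UNIV B \<and>
    (\<forall>x. x = (\<Sum>i\<in>UNIV. of_rat (rat_module.representation B x (\<beta> i)) * \<beta> i))"
proof -
  have "rat_module.span B = rat_module.span UNIV" by (simp add: B(2))
  then have "card B = CARD('d)"
    using rat_module.dim_eq_card[of B UNIV] B(1) degree by (simp add: field_degree_def)
  then have "finite B" using card_gt_0_iff by fastforce
  then obtain \<beta> :: "'d \<Rightarrow> 'k" where \<beta>: "bij_betw \<beta> UNIV B"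
    using finite_same_card_bij[of "UNIV :: 'd set" B] \<open>card B = CARD('d)\<close> by auto
  have "x = (\<Sum>i\<in>UNIV. of_rat (rat_module.representation B x (\<beta> i)) * \<beta> i)" for x
  proof -
    have "x = (\<Sum>b\<in>B. of_rat (rat_module.representation B x b) * b)"
      using rat_module.sum_representation_eq[OF B(1), of x B] B(2) \<open>finite B\<close> by simp
    also have "\<dots> = (\<Sum>i\<in>UNIV. of_rat (rat_module.representation B x (\<beta> i)) * \<beta> i)"
      by (rule sum.reindex_bij_betw[OF \<beta>, symmetric])
    finally show ?thesis .
  qed
  then show ?thesis using \<beta> by blast
qed

lemma rational_basis_exists:
  "\<exists>\<beta> :: 'd \<Rightarrow> 'k. \<forall>x. \<exists>q::'d \<Rightarrow> rat. x = (\<Sum>i\<in>UNIV. of_rat (q i) * \<beta> i)"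
proof -
  obtain B :: "'k set" where B: "rat_module.independent B" "UNIV \<subseteq> rat_module.span B"
    by (rule rat_module.basis_exists[of UNIV])
  then have B': "rat_module.span B = UNIV" by blast
  obtain \<beta> :: "'d \<Rightarrow> 'k" where \<beta>: "bij_betw \<beta> UNIV B"
    "\<And>x. x = (\<Sum>i\<in>UNIV. of_rat (rat_module.representation B x (\<beta> i)) * \<beta> i)"
    using rational_basis_enumeration[OF B(1) B'] by blast
  show ?thesis by (rule exI[of _ \<beta>], rule allI, rule exI, rule \<beta>(2))
qed

text \<open>In the basis \<open>\<beta>\<close> multiplication by \<open>x\<close> has a rational matrix \<open>M\<close>, and applying the embeddings to
\<open>x * \<beta> i\<close> gives \<open>S ** D = M ** S\<close> with \<open>D\<close> diagonal. So \<open>M\<close> and \<open>D\<close> have the same trace.\<close>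

lemma field_trace_eq: "of_rat (field_trace x) = (\<Sum>j\<in>UNIV. \<sigma> j x)"
proof -
  define P where "P = (\<lambda>B :: 'k set. \<not> rat_module.dependent B \<and> rat_module.span B = UNIV)"
  obtain B0 :: "'k set" where "rat_module.independent B0" "UNIV \<subseteq> rat_module.span B0"
    by (rule rat_module.basis_exists[of UNIV])
  then have "\<exists>B. P B"
    unfolding P_def by blast
  define B where "B = (SOME B. P B)"
  have "P B" unfolding B_def using \<open>\<exists>B. P B\<close> by (rule someI_ex)
  then have B: "rat_module.independent B" "rat_module.span B = UNIV" by (auto simp: P_def)
  obtain \<beta> :: "'d \<Rightarrow> 'k" where \<beta>: "bij_betw \<beta> UNIV B"
    "\<And>x. x = (\<Sum>i\<in>UNIV. of_rat (rat_module.representation B x (\<beta> i)) * \<beta> i)"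
    using rational_basis_enumeration[OF B] by blast
  define S :: "real^'d^'d" where "S = (\<chi> i j. \<sigma> j (\<beta> i))"
  define M :: "real^'d^'d" where "M = (\<chi> i l. of_rat (rat_module.representation B (x * \<beta> i) (\<beta> l)))"
  define D :: "real^'d^'d" where "D = (\<chi> i j. if i = j then \<sigma> j x else 0)"
  have "det S \<noteq> 0"
    unfolding S_def by (rule embeddings_det_nonzero, rule exI, rule \<beta>(2))
  then obtain R where R: "S ** R = mat 1" "R ** S = mat 1"
    by (auto simp: invertible_det_nz[symmetric] invertible_def)
  have "S ** D = M ** S"
  proof (intro vec_eq_iff[THEN iffD2] allI)
    fix i j
    have "(S ** D) $ i $ j = \<sigma> j (\<beta> i) * \<sigma> j x"
      by (simp add: S_def D_def matrix_matrix_mult_def if_distrib[where f = "(*) _"] cong: if_cong)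
    also have "\<dots> = \<sigma> j (x * \<beta> i)" by (simp add: emb_simps)
    also have "\<dots> = \<sigma> j (\<Sum>l\<in>UNIV. of_rat (rat_module.representation B (x * \<beta> i) (\<beta> l)) * \<beta> l)"
      by (rule arg_cong[OF \<beta>(2)])
    also have "\<dots> = (M ** S) $ i $ j"
      by (simp add: S_def M_def matrix_matrix_mult_def field_embedding_sum[OF emb] emb_simps)
    finally show "(S ** D) $ i $ j = (M ** S) $ i $ j" .
  qed
  then have "trace M = trace ((S ** D) ** R)"
    by (simp add: matrix_mul_assoc[symmetric] R)
  also have "\<dots> = trace D"
    by (subst trace_mul_sym) (simp add: matrix_mul_assoc R)
  finally have "trace M = trace D" .
  moreover have "field_trace x = (\<Sum>b\<in>B. rat_module.representation B (x * b) b)"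
    by (simp add: field_trace_def endo_trace_def B_def P_def Let_def)
  then have "of_rat (field_trace x) = (\<Sum>i\<in>UNIV. of_rat (rat_module.representation B (x * \<beta> i) (\<beta> i)) :: real)"
    using sum.reindex_bij_betw[OF \<beta>(1), of "\<lambda>b. rat_module.representation B (x * b) b"]
    by (simp add: of_rat_sum[symmetric])
  ultimately show ?thesis
    by (simp add: trace_def M_def D_def)
qed

text \<open>Multiplication by \<open>k\<close> has a rational matrix in a \<open>\<rat>\<close>-basis of \<open>K\<close>. A common denominator of its
entries makes the module spanned by this basis stable.\<close>

lemma integral_denominator:
  "\<exists>N::nat. 0 < N \<and> of_nat N * (k :: 'k) \<in> ring_of_integers"
proof -
  obtain \<beta> :: "'d \<Rightarrow> 'k" where \<beta>: "\<And>x. \<exists>q::'d \<Rightarrow> rat. x = (\<Sum>i\<in>UNIV. of_rat (q i) * \<beta> i)"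
    using rational_basis_exists by blast
  then have "\<forall>i. \<exists>q::'d \<Rightarrow> rat. k * \<beta> i = (\<Sum>j\<in>UNIV. of_rat (q j) * \<beta> j)" by blast
  then obtain q :: "'d \<Rightarrow> 'd \<Rightarrow> rat" where q: "\<And>i. k * \<beta> i = (\<Sum>j\<in>UNIV. of_rat (q i j) * \<beta> j)" by metis
  obtain N where N: "0 < N" "\<And>i j. of_nat N * q i j \<in> \<int>"
    using common_denominator[of "range (\<lambda>(i, j). q i j)"] by auto
  then have "\<forall>i j. \<exists>z. of_nat N * q i j = of_int z" by (metis Ints_cases)
  then obtain z where z: "\<And>i j. of_nat N * q i j = of_int (z i j)" by metis
  have ex: "\<exists>i. \<beta> i \<noteq> 0"
  proof (rule ccontr)
    assume "\<nexists>i. \<beta> i \<noteq> 0"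
    then show False using \<beta>[of 1] by simp
  qed
  then obtain u where u: "\<beta> u \<noteq> 0" by blast
  have "algebraic_int (of_nat N * k)"
  proof (rule algebraic_int_if_stable_module[of UNIV u \<beta>])
    fix i
    have "of_nat N * k * \<beta> i = (\<Sum>j\<in>UNIV. of_rat (of_nat N * q i j) * \<beta> j)"
      by (simp add: q mult.assoc sum_distrib_left of_rat_mult)
    also have "\<dots> = (\<Sum>j\<in>UNIV. of_int (z i j) * \<beta> j)" by (simp add: z)
    finally show "\<exists>a::'d \<Rightarrow> int. of_nat N * k * \<beta> i = (\<Sum>j\<in>UNIV. of_int (a j) * \<beta> j)" by - (rule exI)
  qed (use u in auto)
  then show ?thesis using N(1) by (auto simp: ring_of_integers_def)
qed

lemma trace_integral:
  assumes "(x :: 'k) \<in> ring_of_integers"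
  shows "field_trace x \<in> \<int>"
proof -
  have "algebraic_int (\<Sum>j\<in>UNIV. \<sigma> j x)"
    using ring_of_integers_sum[of UNIV "\<lambda>j. \<sigma> j x"] algebraic_int_field_embedding[OF emb] assms
    by (simp add: ring_of_integers_def)
  then have "of_rat (field_trace x) \<in> (\<int> :: real set)"
    unfolding field_trace_eq[symmetric] by (intro rational_algebraic_int_is_int) auto
  then obtain z where "(of_rat (field_trace x) :: real) = of_int z" by (auto elim: Ints_cases)
  then have "field_trace x = of_int z" by (metis of_rat_eq_iff of_rat_of_int_eq)
  then show ?thesis by simp
qed

text \<open>The trace formula writes the Gram matrix of the trace form as \<open>S S\<^sup>T\<close>, where the rows of \<open>S\<close> are the
Minkowski vectors.\<close>

lemma trace_form_det:
  "of_rat (det (\<chi> i k. field_trace (b i * b k))) = (det (vec_lambda (\<lambda>i. minkowski (b i))))\<^sup>2"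
proof -
  let ?S = "vec_lambda (\<lambda>i. minkowski (b i)) :: real^'d^'d"
  have "of_rat (det (\<chi> i k. field_trace (b i * b k))) = det (\<chi> i k. (of_rat (field_trace (b i * b k)) :: real))"
    by (simp add: Determinants.det_def of_rat_sum of_rat_mult of_rat_prod)
  also have "(\<chi> i k. of_rat (field_trace (b i * b k))) = ?S ** transpose ?S"
    by (intro vec_eq_iff[THEN iffD2] allI)
       (simp add: field_trace_eq emb_simps matrix_matrix_mult_def transpose_def minkowski_def)
  finally show ?thesis by (simp add: det_mul power2_eq_square)
qed

abbreviation "O_image \<equiv> minkowski ` (ring_of_integers :: 'k set)"

lemma subgroup_O_image: "additive_subgroup O_image"
  unfolding additive_subgroup_def
proof (intro conjI ballI)
  show "0 \<in> O_image" using ring_of_integers_closed(3) minkowski_simps(1) by (metis imageI)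
next
  fix x y assume "x \<in> O_image" "y \<in> O_image"
  then obtain a b where "x = minkowski a" "y = minkowski b" "a \<in> ring_of_integers" "b \<in> ring_of_integers" by blast
  then show "x - y \<in> O_image"
    using ring_of_integers_closed(7)[of a b] minkowski_simps(3)[of a b] by (metis imageI)
qed

lemma minkowski_det_square_nat:
  fixes x :: "'d \<Rightarrow> real^'d"
  assumes "\<And>i. x i \<in> O_image"
  shows "\<exists>n::nat. (det (vec_lambda x))\<^sup>2 = real n"
proof -
  have "\<forall>i. \<exists>a. x i = minkowski a \<and> a \<in> ring_of_integers" using assms by blast
  then obtain a where a: "\<And>i. x i = minkowski (a i)" "\<And>i. a i \<in> ring_of_integers" by metis
  have "\<forall>i k. \<exists>z. field_trace (a i * a k) = of_int z"
    using trace_integral[OF ring_of_integers_closed(8)[OF a(2) a(2)]] by (metis Ints_cases)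
  then obtain z where z: "\<And>i k. field_trace (a i * a k) = of_int (z i k)" by metis
  have "(det (vec_lambda x))\<^sup>2 = of_rat (det (\<chi> i k. (of_int (z i k) :: rat)))"
    using trace_form_det[of a] by (simp add: a(1)[abs_def] z)
  also have "det (\<chi> i k. (of_int (z i k) :: rat)) = of_int (det (\<chi> i k. (z i k :: int)))"
    by (simp add: Determinants.det_def)
  finally have "(det (vec_lambda x))\<^sup>2 = real_of_int (det (\<chi> i k. (z i k :: int)))" by simp
  moreover from this have "0 \<le> det (\<chi> i k. (z i k :: int))"
    by (metis of_int_0_le_iff zero_le_power2)
  ultimately have "(det (vec_lambda x))\<^sup>2 = real (nat (det (\<chi> i k. (z i k :: int))))" by simp
  then show ?thesis by blast
qed

text \<open>The ring of integers has an integral basis: it contains multiples of a \<open>\<rat>\<close>-basis, and the squares of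
the determinants of its tuples are integers, because they are discriminants for the trace form.\<close>

lemma O_image_lattice: "\<exists>y. lattice_basis O_image y"
proof -
  obtain \<beta> :: "'d \<Rightarrow> 'k" where \<beta>: "\<And>x. \<exists>q::'d \<Rightarrow> rat. x = (\<Sum>i\<in>UNIV. of_rat (q i) * \<beta> i)"
    using rational_basis_exists by blast
  have "\<forall>i. \<exists>N::nat. 0 < N \<and> of_nat N * \<beta> i \<in> ring_of_integers"
    using integral_denominator by blast
  then obtain N :: "'d \<Rightarrow> nat" where N: "\<And>i. 0 < N i" "\<And>i. of_nat (N i) * \<beta> i \<in> ring_of_integers" by metis
  have "det (vec_lambda (\<lambda>i. minkowski (of_nat (N i) * \<beta> i))) = (\<Prod>i\<in>UNIV. real (N i)) * det (\<chi> i. minkowski (\<beta> i))"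
    using Determinants.det_rows_mul[of "\<lambda>i. real (N i)" "\<lambda>i. minkowski (\<beta> i)"]
    by (simp add: minkowski_simps scalar_mult_eq_scaleR)
  moreover have "det (\<chi> i. minkowski (\<beta> i)) \<noteq> 0"
    using embeddings_det_nonzero[OF \<beta>] by (simp add: minkowski_def)
  moreover have "(\<Prod>i\<in>UNIV. real (N i)) \<noteq> 0" using N(1) by auto
  ultimately have d: "det (vec_lambda (\<lambda>i. minkowski (of_nat (N i) * \<beta> i))) \<noteq> 0" by simp
  show ?thesis
    by (rule lattice_basis_exists[OF subgroup_O_image _ d, of 1])
       (use N minkowski_det_square_nat in auto)
qed

lemma integral_basis_iff: "integral_basis b \<longleftrightarrow> lattice_basis O_image (\<lambda>i. minkowski (b i))"
proof -
  let ?c = "\<lambda>c :: 'd \<Rightarrow> int. \<Sum>i\<in>UNIV. of_int (c i) * b i"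
  have mc: "minkowski (?c c) = (\<Sum>i\<in>UNIV. of_int (c i) *\<^sub>R minkowski (b i))" for c
    by (simp add: minkowski_sum minkowski_simps)
  have span: "int_span (\<lambda>i. minkowski (b i)) = minkowski ` range ?c"
    by (simp add: int_span_def image_image mc)
  show ?thesis
  proof
    assume ib: "integral_basis b"
    then have "range ?c = ring_of_integers" by (simp add: integral_basis_def bij_betw_def)
    then have sp: "O_image = int_span (\<lambda>i. minkowski (b i))" using span by simp
    obtain y where y: "lattice_basis O_image y" using O_image_lattice by blast
    then have "\<And>i. y i \<in> int_span (\<lambda>i. minkowski (b i))" using lattice_basis_mem[OF y] sp by simp
    then obtain k :: int where "det (vec_lambda y) = of_int k * det (vec_lambda (\<lambda>i. minkowski (b i)))"
      using det_int_multiple[of y "\<lambda>i. minkowski (b i)"] by blast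
    then show "lattice_basis O_image (\<lambda>i. minkowski (b i))"
      using y sp by (auto simp: lattice_basis_def)
  next
    assume lb: "lattice_basis O_image (\<lambda>i. minkowski (b i))"
    then have "minkowski ` range ?c = minkowski ` ring_of_integers"
      using span by (simp add: lattice_basis_def)
    then have "range ?c = ring_of_integers"
      by (simp only: inj_image_eq_iff[OF inj_minkowski])
    moreover have "inj ?c"
    proof (rule injI)
      fix u v assume "?c u = ?c v"
      then have "minkowski (?c u) = minkowski (?c v)" by (rule arg_cong)
      then have "(\<Sum>i\<in>UNIV. of_int (u i) *\<^sub>R minkowski (b i)) = (\<Sum>i\<in>UNIV. of_int (v i) *\<^sub>R minkowski (b i))"
        by (simp only: mc)
      then have "(\<lambda>i. real_of_int (u i)) = (\<lambda>i. real_of_int (v i))"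
        using lb real_coordinates_unique[of "\<lambda>i. minkowski (b i)" "\<lambda>i. of_int (u i)" "\<lambda>i. of_int (v i)"]
        by (simp add: lattice_basis_def)
      then show "u = v" by (simp add: fun_eq_iff)
    qed
    ultimately show "integral_basis b" by (simp add: integral_basis_def bij_betw_def)
  qed
qed

lemma integral_basis_exists:
  obtains b :: "'d \<Rightarrow> 'k" where "integral_basis b"
proof -
  obtain y where y: "lattice_basis O_image y" using O_image_lattice by blast
  then have "\<forall>i. \<exists>a. y i = minkowski a" using lattice_basis_mem[OF y] by blast
  then obtain b where "\<And>i. y i = minkowski (b i)" by metis
  then have "y = (\<lambda>i. minkowski (b i))" by blast
  then show ?thesis using that y integral_basis_iff by blast
qed

text \<open>Two integral bases span the same lattice, so the squares of their determinants agree and the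
description by \<open>THE\<close> in \<open>field_disc\<close> is met by any integral basis.\<close>

lemma field_disc_eq:
  assumes b: "integral_basis (b :: 'd \<Rightarrow> 'k)"
  shows "of_rat (field_disc TYPE('d) TYPE('k)) = (det (vec_lambda (\<lambda>i. minkowski (b i))))\<^sup>2"
proof -
  have "D = det (\<chi> i j. field_trace (b i * b j))"
    if "\<exists>b' :: 'd \<Rightarrow> 'k. integral_basis b' \<and> D = det (\<chi> i j. field_trace (b' i * b' j))" for D
  proof -
    obtain b' :: "'d \<Rightarrow> 'k" where b': "integral_basis b'" "D = det (\<chi> i j. field_trace (b' i * b' j))"
      using \<open>\<exists>b' :: 'd \<Rightarrow> 'k. _ b'\<close> by blast
    have "covol (\<lambda>i. minkowski (b' i)) = covol (\<lambda>i. minkowski (b i))"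
      using lattice_basis_abs_det_unique b b' integral_basis_iff by blast
    then have "(of_rat D :: real) = of_rat (det (\<chi> i j. field_trace (b i * b j)))"
      unfolding b'(2) trace_form_det by (metis power2_abs)
    then show ?thesis by simp
  qed
  then have "field_disc TYPE('d) TYPE('k) = det (\<chi> i j. field_trace (b i * b j))"
    unfolding field_disc_def using b by (intro the_equality) blast+
  then show ?thesis by (simp add: trace_form_det)
qed

end

section \<open>Modules over the ring of integers, locally at a prime number\<close>

context real_embedding_family
begin

text \<open>Since \<open>O/pO\<close> is finite, two powers of \<open>w\<close> agree modulo \<open>p\<close>. The powers are then eventually periodic, and
a large multiple of the period is an exponent at which the power is idempotent.\<close>

lemma power_idempotent_mod_prime:
  assumes w: "(w :: 'k) \<in> ring_of_integers" and p: "0 < (p::nat)"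
  shows "\<exists>N r. 0 < N \<and> r \<in> ring_of_integers \<and> w ^ N * (1 - w ^ N) = of_nat p * r"
proof -
  obtain b :: "'d \<Rightarrow> 'k" where b: "integral_basis b" using integral_basis_exists by blast
  then have rng: "range (\<lambda>c :: 'd \<Rightarrow> int. \<Sum>i\<in>UNIV. of_int (c i) * b i) = ring_of_integers"
    by (simp add: integral_basis_def bij_betw_def)
  have "\<forall>i. \<exists>c :: 'd \<Rightarrow> int. w ^ i = (\<Sum>t\<in>UNIV. of_int (c t) * b t)"
  proof
    fix i
    have "w ^ i \<in> range (\<lambda>c :: 'd \<Rightarrow> int. \<Sum>i\<in>UNIV. of_int (c i) * b i)"
      unfolding rng by (rule ring_of_integers_closed(9)[OF w])
    then show "\<exists>c :: 'd \<Rightarrow> int. w ^ i = (\<Sum>t\<in>UNIV. of_int (c t) * b t)" by (elim rangeE) (rule exI)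
  qed
  then obtain c where c: "\<And>i. w ^ i = (\<Sum>t\<in>UNIV. of_int (c i t) * b t)" by metis
  define F where "F i = (\<lambda>t. c i t mod int p)" for i
  have "range F \<subseteq> UNIV \<rightarrow>\<^sub>E {0..<int p}" using p by (auto simp: F_def)
  then have "finite (range F)" by (rule finite_subset) (simp add: finite_PiE)
  then have "\<not> inj F" using finite_imageD infinite_UNIV_nat by blast
  then obtain i' j' where "F i' = F j'" "i' \<noteq> j'" by (auto simp: inj_def)
  then obtain i j where ij: "i < j" "F i = F j" by (metis linorder_neqE_nat)
  define m where "m = j - i"
  have m: "0 < m" "j = i + m" using ij by (auto simp: m_def)
  define z where "z t = (c j t - c i t) div int p" for t
  have z: "c j t = int p * z t + c i t" for t
  proof -
    have "c j t mod int p = c i t mod int p" using ij(2) by (simp add: F_def fun_eq_iff)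
    then have "int p dvd c j t - c i t" by (simp add: mod_eq_dvd_iff)
    then show ?thesis by (simp add: z_def)
  qed
  define r0 where "r0 = (\<Sum>t\<in>UNIV. of_int (z t) * b t)"
  have r0: "r0 \<in> ring_of_integers"
    unfolding r0_def rng[symmetric] by (rule rangeI)
  have base: "w ^ (i + m) = of_nat p * r0 + w ^ i"
    unfolding m(2)[symmetric] c[of j] c[of i] r0_def
    by (simp add: z sum_distrib_left sum.distrib[symmetric] algebra_simps)
  have step: "\<exists>r \<in> ring_of_integers. w ^ (l + s * m) = of_nat p * r + w ^ l" if l: "i \<le> l" for l s
  proof (induction s)
    case 0
    show ?case by (intro bexI[of _ 0]) (simp_all add: ring_of_integers_closed)
  next
    case (Suc s)
    then obtain r where r: "r \<in> ring_of_integers" "w ^ (l + s * m) = of_nat p * r + w ^ l" by blast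
    have exps: "l + Suc s * m = (l - i + s * m) + (i + m)" "l + s * m = (l - i + s * m) + i"
      using l by simp_all
    have "w ^ (l + Suc s * m) = w ^ (l - i + s * m) * (of_nat p * r0) + w ^ (l + s * m)"
      unfolding exps power_add[of w "l - i + s * m"] base by (simp add: algebra_simps)
    also have "\<dots> = of_nat p * (w ^ (l - i + s * m) * r0 + r) + w ^ l"
      unfolding r(2) by (simp add: algebra_simps)
    finally have eq: "w ^ (l + Suc s * m) = of_nat p * (w ^ (l - i + s * m) * r0 + r) + w ^ l" .
    show ?case by (rule bexI, rule eq) (intro ring_of_integers_closed w r0 r(1))
  qed
  \<comment> \<open>A multiple of the period \<open>m\<close> that is at least \<open>i\<close>, where periodicity begins.\<close>
  define N where "N = Suc i * m"
  have "i \<le> N" "0 < N" using m(1) by (cases m; simp add: N_def)+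
  then obtain r where r: "r \<in> ring_of_integers" "w ^ (N + Suc i * m) = of_nat p * r + w ^ N"
    using step by blast
  then have "w ^ N * (1 - w ^ N) = of_nat p * (- r)"
    unfolding N_def[symmetric] by (simp add: power_add algebra_simps)
  then show ?thesis
    using \<open>0 < N\<close> ring_of_integers_closed(5)[OF r(1)] by (intro exI[of _ N] exI[of _ "- r"]) simp
qed

text \<open>The element \<open>g = \<epsilon> + (1 - \<epsilon>) c\<close> generates the fractional ideal \<open>I\<close> spanned by \<open>1\<close> and \<open>c\<close> modulo \<open>p I\<close>: the
identity gives \<open>1 = g j + p r\<close> and \<open>c = g (c j) + p (r c)\<close>, with integral \<open>j\<close> and \<open>c j\<close>. To find \<open>\<epsilon>\<close>,
write \<open>1 = w + c y\<close> with \<open>w\<close> and \<open>y\<close> in the inverse of \<open>I\<close>. A power \<open>\<epsilon>\<close> of \<open>w\<close> is idempotent modulo \<open>p\<close>. On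
the part of \<open>O/pO\<close> where \<open>\<epsilon> = 1\<close> the element \<open>w\<close> is a unit and \<open>1\<close> generates \<open>I\<close>; on the part where
\<open>\<epsilon> = 0\<close> it is nilpotent, so \<open>c y = 1 - w\<close> is a unit and \<open>c\<close> generates \<open>I\<close>.\<close>

lemma local_bezout:
  assumes p: "0 < (p::nat)"
  shows "\<exists>\<epsilon> j r. \<epsilon> \<in> ring_of_integers \<and> j \<in> ring_of_integers \<and> c * j \<in> ring_of_integers \<and>
    r \<in> ring_of_integers \<and> (\<epsilon> + (1 - \<epsilon>) * c) * j + of_nat p * r = (1 :: 'k)"
proof -
  obtain D :: nat where "0 < D" "of_nat D * c \<in> ring_of_integers"
    using integral_denominator by blast
  then obtain w y where wy: "w \<in> ring_of_integers" "c * w \<in> ring_of_integers"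
    "y \<in> ring_of_integers" "c * y \<in> ring_of_integers" "w + c * y = 1"
    using bezout_in_fractional_ideal[of D c] by (auto simp: ring_of_integers_def)
  obtain N r where N: "0 < N" "r \<in> ring_of_integers" "w ^ N * (1 - w ^ N) = of_nat p * r"
    using power_idempotent_mod_prime[OF wy(1) p] by blast
  define \<epsilon> where "\<epsilon> = w ^ N"
  define S where "S = (\<Sum>i<N. w ^ i)"
  define v where "v = w ^ (N - 1)"
  have vw: "v * w = \<epsilon>" by (simp only: v_def \<epsilon>_def power_minus_mult[OF N(1)])
  have SO: "S \<in> ring_of_integers"
    unfolding S_def by (intro ring_of_integers_sum ring_of_integers_closed wy)
  have vO: "v \<in> ring_of_integers" "\<epsilon> \<in> ring_of_integers"
    unfolding v_def \<epsilon>_def by (intro ring_of_integers_closed wy)+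
  have geo: "S * (1 - w) = 1 - \<epsilon>"
    by (simp add: S_def \<epsilon>_def one_diff_power_eq mult.commute)
  have cy: "c * y = 1 - w" using wy(5) by (simp add: algebra_simps)
  have pr: "\<epsilon> * (1 - \<epsilon>) = of_nat p * r" using N(3) by (simp add: \<epsilon>_def)
  \<comment> \<open>Modulo \<open>p\<close>, the first term inverts \<open>w\<close> where \<open>\<epsilon> = 1\<close>, as \<open>v w = \<epsilon>\<close>, and the second inverts \<open>c y\<close>
        where \<open>\<epsilon> = 0\<close>, as \<open>S\<close> is the geometric sum with \<open>S (1 - w) = 1 - \<epsilon>\<close>.\<close>
  define j where "j = v * \<epsilon> * w + (1 - \<epsilon>) * S * y"
  have "(\<epsilon> + (1 - \<epsilon>) * c) * j
      = \<epsilon> * \<epsilon> * (v * w) + (\<epsilon> * (1 - \<epsilon>)) * (v * (c * w)) + (\<epsilon> * (1 - \<epsilon>)) * (S * y) + (1 - \<epsilon>) * (1 - \<epsilon>) * (S * (c * y))"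
    by (simp add: j_def algebra_simps)
  also have "\<dots> = \<epsilon> * \<epsilon> * \<epsilon> + (1 - \<epsilon>) * (1 - \<epsilon>) * (1 - \<epsilon>) + (\<epsilon> * (1 - \<epsilon>)) * (v * (c * w) + S * y)"
    by (simp only: vw cy geo) (simp add: algebra_simps)
  also have "\<epsilon> * \<epsilon> * \<epsilon> + (1 - \<epsilon>) * (1 - \<epsilon>) * (1 - \<epsilon>) = 1 - 3 * (\<epsilon> * (1 - \<epsilon>))"
    by (simp add: algebra_simps)
  finally have "(\<epsilon> + (1 - \<epsilon>) * c) * j + of_nat p * (r * (3 - (v * (c * w) + S * y))) = 1"
    unfolding pr by (simp add: algebra_simps)
  moreover have "r * (3 - (v * (c * w) + S * y)) \<in> ring_of_integers"
    using ring_of_integers_closed(2)[of 3, where 'a = 'k]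
    by (intro ring_of_integers_closed N vO SO wy) simp
  moreover have "j \<in> ring_of_integers"
    unfolding j_def by (intro ring_of_integers_closed vO SO wy)
  moreover have "c * j = v * \<epsilon> * (c * w) + (1 - \<epsilon>) * S * (c * y)"
    by (simp add: j_def algebra_simps)
  then have "c * j \<in> ring_of_integers"
    by (simp only:) (intro ring_of_integers_closed vO SO wy)
  ultimately show ?thesis using vO(2) by blast
qed

end

definition integer_submodule :: "('k::field_char_0 \<Rightarrow> 'v::ab_group_add \<Rightarrow> 'v) \<Rightarrow> 'v set \<Rightarrow> bool" where
  "integer_submodule smul M \<longleftrightarrow> 0 \<in> M \<and> (\<forall>x\<in>M. \<forall>y\<in>M. x + y \<in> M) \<and>
     (\<forall>a\<in>ring_of_integers. \<forall>x\<in>M. smul a x \<in> M)"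

lemma integer_submoduleD:
  assumes "integer_submodule smul M"
  shows "0 \<in> M" "x \<in> M \<Longrightarrow> y \<in> M \<Longrightarrow> x + y \<in> M" "a \<in> ring_of_integers \<Longrightarrow> x \<in> M \<Longrightarrow> smul a x \<in> M"
  using assms by (auto simp: integer_submodule_def)

lemma integer_submodule_sum:
  assumes "integer_submodule smul M" "\<And>i. i \<in> I \<Longrightarrow> f i \<in> M"
  shows "(\<Sum>i\<in>I. f i) \<in> M"
  using assms(2) by (induction I rule: infinite_finite_induct) (auto intro: integer_submoduleD[OF assms(1)])

locale rational_vector_space = vector_space smul
  for smul :: "'k::field_char_0 \<Rightarrow> 'v::ab_group_add \<Rightarrow> 'v"
begin

lemma integer_submodule_diff:
  assumes "integer_submodule smul M" "x \<in> M" "y \<in> M"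
  shows "x - y \<in> M"
proof -
  have "smul (- 1) y \<in> M"
    by (intro integer_submoduleD(3)[OF assms(1)] assms(3) ring_of_integers_closed)
  then show ?thesis using integer_submoduleD(2)[OF assms(1,2)] by fastforce
qed

lemma integer_submodule_integer_span: "integer_submodule smul (integer_span smul S)"
  unfolding integer_submodule_def
proof (intro conjI ballI)
  show "0 \<in> integer_span smul S"
    unfolding integer_span_def by (rule CollectI, rule exI[of _ "{}"]) simp
next
  fix x y assume "x \<in> integer_span smul S" "y \<in> integer_span smul S"
  then obtain T c U d where x: "x = (\<Sum>s\<in>T. smul (c s) s)" "finite T" "T \<subseteq> S" "c ` T \<subseteq> ring_of_integers"
    and y: "y = (\<Sum>s\<in>U. smul (d s) s)" "finite U" "U \<subseteq> S" "d ` U \<subseteq> ring_of_integers"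
    unfolding integer_span_def by auto
  define h where "h s = (if s \<in> T then c s else 0) + (if s \<in> U then d s else 0)" for s
  have "(\<Sum>s\<in>T \<union> U. smul (h s) s)
      = (\<Sum>s\<in>T \<union> U. smul (if s \<in> T then c s else 0) s) + (\<Sum>s\<in>T \<union> U. smul (if s \<in> U then d s else 0) s)"
    by (simp add: h_def scale_left_distrib sum.distrib)
  also have "(\<Sum>s\<in>T \<union> U. smul (if s \<in> T then c s else 0) s) = x"
    unfolding x(1) using x(2) y(2) by (intro sum.mono_neutral_cong_right) auto
  also have "(\<Sum>s\<in>T \<union> U. smul (if s \<in> U then d s else 0) s) = y"
    unfolding y(1) using x(2) y(2) by (intro sum.mono_neutral_cong_right) auto
  finally have "x + y = (\<Sum>s\<in>T \<union> U. smul (h s) s)" by simp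
  moreover have "h ` (T \<union> U) \<subseteq> ring_of_integers"
    using x(4) y(4) by (auto simp: h_def ring_of_integers_closed image_subset_iff)
  ultimately show "x + y \<in> integer_span smul S"
    unfolding integer_span_def using x y by blast
next
  fix a :: 'k and x assume a: "a \<in> ring_of_integers" and "x \<in> integer_span smul S"
  then obtain T c where x: "x = (\<Sum>s\<in>T. smul (c s) s)" "finite T" "T \<subseteq> S" "c ` T \<subseteq> ring_of_integers"
    unfolding integer_span_def by auto
  have "smul a x = (\<Sum>s\<in>T. smul (a * c s) s)" by (simp add: x(1) scale_sum_right)
  moreover have "(\<lambda>s. a * c s) ` T \<subseteq> ring_of_integers"
    using x(4) a by (auto simp: image_subset_iff ring_of_integers_closed)
  ultimately show "smul a x \<in> integer_span smul S"
    unfolding integer_span_def mem_Collect_eq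
    using x by (intro exI[of _ T] exI[of _ "\<lambda>s. a * c s"]) simp
qed

lemma integer_span_superset: "s \<in> S \<Longrightarrow> s \<in> integer_span smul S"
  unfolding integer_span_def mem_Collect_eq
  by (rule exI[of _ "{s}"], rule exI[of _ "\<lambda>_. 1"]) (simp add: ring_of_integers_closed)

lemma integer_span_least:
  assumes "integer_submodule smul M" "S \<subseteq> M"
  shows "integer_span smul S \<subseteq> M"
  unfolding integer_span_def
  using assms(2) by (auto intro!: integer_submodule_sum[OF assms(1)] integer_submoduleD(3)[OF assms(1)])

text \<open>Because this set is a submodule, generation of \<open>M\<close> modulo \<open>q\<close> by the \<open>x i\<close> can be checked on generators of \<open>M\<close>.\<close>

lemma integer_submodule_combinations:
  assumes M: "integer_submodule smul M"
  shows "integer_submodule smul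
    {v. \<exists>r l. (\<forall>i. r i \<in> ring_of_integers) \<and> l \<in> M \<and> v = (\<Sum>i\<in>A. smul (r i) (x i)) + smul q l}"
    (is "integer_submodule smul ?R")
  unfolding integer_submodule_def
proof (intro conjI ballI)
  show "0 \<in> ?R"
    by (intro CollectI exI[of _ "\<lambda>_. 0"] exI[of _ 0])
       (simp add: integer_submoduleD(1)[OF M] ring_of_integers_closed)
next
  fix v w assume "v \<in> ?R" "w \<in> ?R"
  then obtain r l s m where r: "\<And>i. r i \<in> ring_of_integers" "l \<in> M" "v = (\<Sum>i\<in>A. smul (r i) (x i)) + smul q l"
    and s: "\<And>i. s i \<in> ring_of_integers" "m \<in> M" "w = (\<Sum>i\<in>A. smul (s i) (x i)) + smul q m"
    by auto
  have "v + w = (\<Sum>i\<in>A. smul (r i + s i) (x i)) + smul q (l + m)"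
    by (simp add: r(3) s(3) scale_left_distrib scale_right_distrib sum.distrib)
  then show "v + w \<in> ?R"
    using r s by (intro CollectI exI[of _ "\<lambda>i. r i + s i"] exI[of _ "l + m"])
      (simp add: integer_submoduleD(2)[OF M] ring_of_integers_closed)
next
  fix a :: 'k and v assume a: "a \<in> ring_of_integers" and "v \<in> ?R"
  then obtain r l where r: "\<And>i. r i \<in> ring_of_integers" "l \<in> M" "v = (\<Sum>i\<in>A. smul (r i) (x i)) + smul q l"
    by auto
  have "smul a v = (\<Sum>i\<in>A. smul (a * r i) (x i)) + smul q (smul a l)"
    by (simp add: r(3) scale_right_distrib scale_sum_right mult.commute)
  then show "smul a v \<in> ?R"
    using r a by (intro CollectI exI[of _ "\<lambda>i. a * r i"] exI[of _ "smul a l"])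
      (simp add: integer_submoduleD(3)[OF M] ring_of_integers_closed)
qed

end

text \<open>A vector space over \<open>K\<close> with a basis \<open>e\<close>, which provides the coordinates used for elimination and for
the embedding into Euclidean space.\<close>

locale real_embedding_space = real_embedding_family \<sigma> + rational_vector_space smul
  for \<sigma> :: "'d::finite \<Rightarrow> 'k::field_char_0 \<Rightarrow> real" and smul :: "'k \<Rightarrow> 'v::ab_group_add \<Rightarrow> 'v" +
  fixes e :: "'n::finite \<Rightarrow> 'v"
  assumes basis: "basis_family smul e"
begin

abbreviation "ispan \<equiv> integer_span smul"

definition coord :: "'n \<Rightarrow> 'v \<Rightarrow> 'k" where
  "coord a v = representation (range e) v (e a)"

lemma coord_simps:
  "coord a (v + w) = coord a v + coord a w" "coord a (smul k v) = k * coord a v"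
  "coord a 0 = 0" "coord a (v - w) = coord a v - coord a w"
  using basis
  by (simp_all add: coord_def basis_family_def representation_add representation_scale representation_zero representation_diff)

lemma coord_sum: "coord a (\<Sum>i\<in>A. f i) = (\<Sum>i\<in>A. coord a (f i))"
  by (induction A rule: infinite_finite_induct) (simp_all add: coord_simps)

lemma coord_e: "coord a (e b) = (if a = b then 1 else 0)"
proof -
  have "representation (range e) (e b) = (\<lambda>v. if v = e b then 1 else 0)"
    using basis by (intro representation_basis) (auto simp: basis_family_def)
  then show ?thesis using basis by (auto simp: coord_def basis_family_def inj_eq)
qed

lemma coord_expansion: "v = (\<Sum>a\<in>UNIV. smul (coord a v) (e a))"
  unfolding coord_def by (rule basis_family_expansion[OF vector_space_axioms basis])

lemma coord_eqI: "(\<And>a. coord a v = coord a w) \<Longrightarrow> v = w"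
  using coord_expansion[of v] coord_expansion[of w] by simp

lemma integer_submodule_coord_zero: "integer_submodule smul {v. \<forall>a\<in>A. coord a v = 0}"
  by (simp add: integer_submodule_def coord_simps)

definition pivot_decomposition :: "nat \<Rightarrow> 'v \<Rightarrow> 'v set \<Rightarrow> 'v set \<Rightarrow> 'v \<Rightarrow> bool" where
  "pivot_decomposition p u S0 S s \<longleftrightarrow>
     (\<exists>a t l. a \<in> ring_of_integers \<and> t \<in> ispan S0 \<and> l \<in> ispan S \<and> s = smul a u + t + smul (of_nat p) l)"

lemma pivot_decompositionI:
  "a \<in> ring_of_integers \<Longrightarrow> t \<in> ispan S0 \<Longrightarrow> l \<in> ispan S \<Longrightarrow> s = smul a u + t + smul (of_nat p) l \<Longrightarrow>
    pivot_decomposition p u S0 S s"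
  unfolding pivot_decomposition_def by (intro exI conjI)

lemma pivot_decompositionE:
  assumes "pivot_decomposition p u S0 S s"
  obtains a t l where "a \<in> ring_of_integers" "t \<in> ispan S0" "l \<in> ispan S" "s = smul a u + t + smul (of_nat p) l"
  using assms unfolding pivot_decomposition_def by (elim exE conjE)

text \<open>One step of Gaussian elimination modulo \<open>p\<close>: up to \<open>p\<close> times the module, all generators are replaced by a
single \<open>u\<close> and by vectors \<open>S0\<close> whose \<open>i\<close>-th coordinate is zero. The set \<open>S0\<close> may be
larger than \<open>S\<close>; the next coordinate reduces it in the same way. Generators are added one at a
time. A new generator \<open>s\<close> and the current pivot \<open>u\<close> are combined by \<open>local_bezout\<close>, applied to the
quotient \<open>c\<close> of their \<open>i\<close>-th coordinates.\<close>

lemma pivot_generator: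
  assumes p: "0 < (p::nat)" and S: "finite S"
  shows "\<exists>u S0. u \<in> ispan S \<and> finite S0 \<and> S0 \<subseteq> ispan S \<and> (\<forall>t\<in>S0. coord i t = 0) \<and>
    (\<forall>s\<in>S. pivot_decomposition p u S0 S s)"
  using S
proof (induction S)
  case empty
  show ?case
    using integer_submoduleD(1)[OF integer_submodule_integer_span] by (intro exI[of _ 0] exI[of _ "{}"]) simp
next
  case (insert s S)
  then obtain u S0 where u: "u \<in> ispan S" "finite S0" "S0 \<subseteq> ispan S" "\<forall>t\<in>S0. coord i t = 0"
    and rep: "\<forall>s\<in>S. pivot_decomposition p u S0 S s"
    by blast
  let ?M = "ispan (insert s S)"
  have M: "integer_submodule smul ?M" by (rule integer_submodule_integer_span)
  note MD = integer_submoduleD[OF M] integer_submodule_diff[OF M]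
  have sM: "s \<in> ?M" by (rule integer_span_superset) simp
  have SM: "ispan S \<subseteq> ?M"
    by (rule integer_span_least[OF M]) (auto intro: integer_span_superset)
  show ?case
  proof (cases "coord i u = 0")
    case True
    let ?S0 = "insert u S0"
    have sub: "ispan S0 \<subseteq> ispan ?S0"
      by (rule integer_span_least[OF integer_submodule_integer_span]) (auto intro: integer_span_superset)
    have uS: "u \<in> ispan ?S0" by (rule integer_span_superset) simp
    note ID = integer_submoduleD[OF integer_submodule_integer_span[of ?S0]]
    have "pivot_decomposition p s ?S0 (insert s S) s'"
      if s': "s' \<in> insert s S" for s'
    proof (cases "s' = s")
      case True
      then have "s' = smul 1 s + 0 + smul (of_nat p) 0" by simp
      then show ?thesis by (rule pivot_decompositionI[OF ring_of_integers_closed(4) ID(1) MD(1)])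
    next
      case False
      then have "pivot_decomposition p u S0 S s'" using rep s' by blast
      then obtain a t l where al: "a \<in> ring_of_integers" "t \<in> ispan S0" "l \<in> ispan S" "s' = smul a u + t + smul (of_nat p) l"
        by (rule pivot_decompositionE)
      have tl: "t \<in> ispan ?S0" "l \<in> ?M" using al sub SM by blast+
      have "s' = smul 0 s + (smul a u + t) + smul (of_nat p) l" by (simp add: al(4))
      then show ?thesis
        by (rule pivot_decompositionI[OF ring_of_integers_closed(3) ID(2)[OF ID(3)[OF al(1) uS] tl(1)] tl(2)])
    qed
    moreover have "finite ?S0" "?S0 \<subseteq> ?M" "\<forall>t\<in>?S0. coord i t = 0"
      using u True SM by auto
    ultimately show ?thesis using sM by (intro exI[of _ s] exI[of _ ?S0]) simp
  next
    case False
    define c where "c = coord i s / coord i u"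
    have cs: "coord i s = c * coord i u" using False by (simp add: c_def)
    obtain \<epsilon> j r where O: "\<epsilon> \<in> ring_of_integers" "j \<in> ring_of_integers" "c * j \<in> ring_of_integers" "r \<in> ring_of_integers"
      and bez: "(\<epsilon> + (1 - \<epsilon>) * c) * j + of_nat p * r = 1"
      using local_bezout[OF p, of c] by blast
    \<comment> \<open>The \<open>i\<close>-th coordinate of \<open>u'\<close> generates those of \<open>u\<close> and \<open>s\<close> modulo \<open>p\<close>; the corrections by
            \<open>1 - p r\<close> make the coordinates of \<open>s1\<close> and \<open>t1\<close> exactly zero.\<close>
    define u' where "u' = smul \<epsilon> u + smul (1 - \<epsilon>) s"
    define s1 where "s1 = smul (1 - of_nat p * r) s - smul (c * j) u'"
    define t1 where "t1 = smul (1 - of_nat p * r) u - smul j u'"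
    have uM: "u \<in> ?M" using u(1) SM by blast
    have u'M: "u' \<in> ?M"
      unfolding u'_def by (intro MD ring_of_integers_closed O uM sM)
    have s1M: "s1 \<in> ?M" and t1M: "t1 \<in> ?M"
      unfolding s1_def t1_def by (intro MD ring_of_integers_closed O uM sM u'M)+
    have bez': "1 - of_nat p * r = (\<epsilon> + (1 - \<epsilon>) * c) * j" using bez by (simp add: algebra_simps)
    have cu': "coord i u' = (\<epsilon> + (1 - \<epsilon>) * c) * coord i u"
      by (simp add: u'_def coord_simps cs algebra_simps)
    have "coord i s1 = 0" "coord i t1 = 0"
      by (simp_all add: s1_def t1_def coord_simps bez' cu' cs)
    let ?S0 = "insert s1 (insert t1 S0)"
    have sub: "ispan S0 \<subseteq> ispan ?S0"
      by (rule integer_span_least[OF integer_submodule_integer_span]) (auto intro: integer_span_superset)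
    have in0: "s1 \<in> ispan ?S0" "t1 \<in> ispan ?S0" by (rule integer_span_superset; simp)+
    note ID = integer_submoduleD[OF integer_submodule_integer_span[of ?S0]]
    have "pivot_decomposition p u' ?S0 (insert s S) s'"
      if s': "s' \<in> insert s S" for s'
    proof (cases "s' = s")
      case True
      have "s' = smul (c * j) u' + s1 + smul (of_nat p) (smul r s)"
        by (simp add: True s1_def scale_left_diff_distrib)
      then show ?thesis by (rule pivot_decompositionI[OF O(3) in0(1) MD(3)[OF O(4) sM]])
    next
      case False
      then have "pivot_decomposition p u S0 S s'" using rep s' by blast
      then obtain a t l where al: "a \<in> ring_of_integers" "t \<in> ispan S0" "l \<in> ispan S" "s' = smul a u + t + smul (of_nat p) l"
        by (rule pivot_decompositionE)
      have tl: "t \<in> ispan ?S0" "l \<in> ?M" using al sub SM by blast+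
      have "u = t1 + smul j u' + smul (of_nat p) (smul r u)"
        by (simp add: t1_def scale_left_diff_distrib)
      then have "smul a u = smul a (t1 + smul j u' + smul (of_nat p) (smul r u))" by (rule arg_cong)
      then have "s' = smul (a * j) u' + (smul a t1 + t) + smul (of_nat p) (smul (a * r) u + l)"
        by (simp add: al(4) scale_right_distrib algebra_simps)
      then show ?thesis
        by (intro pivot_decompositionI[of "a * j" "smul a t1 + t" _ "smul (a * r) u + l"]
            ring_of_integers_closed MD ID al O in0 uM tl)
    qed
    moreover have "finite ?S0" "?S0 \<subseteq> ?M" "\<forall>t\<in>?S0. coord i t = 0"
      using u SM s1M t1M \<open>coord i s1 = 0\<close> \<open>coord i t1 = 0\<close> by auto
    ultimately show ?thesis using u'M by (intro exI[of _ u'] exI[of _ ?S0]) simp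
  qed
qed

text \<open>Elimination of all coordinates in \<open>A\<close>, with one generator for each.\<close>

lemma local_generators_aux:
  assumes p: "0 < (p::nat)" and A: "finite A"
  shows "finite S \<Longrightarrow> (\<forall>s\<in>S. \<forall>i\<in>- A. coord i s = 0) \<Longrightarrow>
    \<exists>x. (\<forall>i. x i \<in> ispan S) \<and> ispan S \<subseteq>
      {v. \<exists>r l. (\<forall>i. r i \<in> ring_of_integers) \<and> l \<in> ispan S \<and> v = (\<Sum>i\<in>A. smul (r i) (x i)) + smul (of_nat p) l}"
  using A
proof (induction A arbitrary: S)
  case empty
  then have "S \<subseteq> {0}" by (auto intro!: coord_eqI simp: coord_simps)
  moreover have "integer_submodule smul {0}" by (simp add: integer_submodule_def)
  ultimately have "ispan S \<subseteq> {0}" by (intro integer_span_least)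
  moreover have "0 \<in> ispan S" by (rule integer_submoduleD(1)[OF integer_submodule_integer_span])
  ultimately show ?case
    by (intro exI[of _ "\<lambda>_. 0"]) (auto intro!: exI[of _ 0] exI[of _ "\<lambda>_. 0"] simp: ring_of_integers_closed)
next
  case (insert a A)
  have M: "integer_submodule smul (ispan S)" by (rule integer_submodule_integer_span)
  obtain u S0 where u: "u \<in> ispan S" "finite S0" "S0 \<subseteq> ispan S" "\<forall>t\<in>S0. coord a t = 0"
    and rep: "\<forall>s\<in>S. pivot_decomposition p u S0 S s"
    using pivot_generator[OF p insert.prems(1), of a] by blast
  have sub: "ispan S0 \<subseteq> ispan S" by (rule integer_span_least[OF M u(3)])
  have "S \<subseteq> {v. \<forall>i\<in>- insert a A. coord i v = 0}" using insert.prems(2) by auto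
  then have "ispan S \<subseteq> {v. \<forall>i\<in>- insert a A. coord i v = 0}"
    by (rule integer_span_least[OF integer_submodule_coord_zero])
  then have "coord i s = 0" if "s \<in> S0" "i \<in> - A" for s i
    using that u(3,4) by (cases "i = a") auto
  then obtain x where x: "\<And>i. x i \<in> ispan S0" and gen: "ispan S0 \<subseteq>
      {v. \<exists>r l. (\<forall>i. r i \<in> ring_of_integers) \<and> l \<in> ispan S0 \<and> v = (\<Sum>i\<in>A. smul (r i) (x i)) + smul (of_nat p) l}"
    using insert.IH[OF u(2)] by blast
  define x' where "x' = x(a := u)"
  have x': "x' i \<in> ispan S" for i using x u(1) sub by (auto simp: x'_def)
  have "S \<subseteq> {v. \<exists>r l. (\<forall>i. r i \<in> ring_of_integers) \<and> l \<in> ispan S \<and>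
      v = (\<Sum>i\<in>insert a A. smul (r i) (x' i)) + smul (of_nat p) l}"
  proof (intro subsetI CollectI)
    fix s assume "s \<in> S"
    then have "pivot_decomposition p u S0 S s" using rep by blast
    then obtain b t l where b: "b \<in> ring_of_integers" "t \<in> ispan S0" "l \<in> ispan S" "s = smul b u + t + smul (of_nat p) l"
      by (rule pivot_decompositionE)
    then obtain r m where r: "\<And>i. r i \<in> ring_of_integers" "m \<in> ispan S0" "t = (\<Sum>i\<in>A. smul (r i) (x i)) + smul (of_nat p) m"
      using gen by blast
    define r' where "r' = r(a := b)"
    have "(\<Sum>i\<in>insert a A. smul (r' i) (x' i)) = smul b u + (\<Sum>i\<in>A. smul (r i) (x i))"
    proof -
      have "(\<Sum>i\<in>A. smul (r' i) (x' i)) = (\<Sum>i\<in>A. smul (r i) (x i))"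
        using insert.hyps by (intro sum.cong refl) (auto simp: r'_def x'_def)
      then show ?thesis using insert.hyps by (simp add: r'_def x'_def)
    qed
    then have "s = (\<Sum>i\<in>insert a A. smul (r' i) (x' i)) + smul (of_nat p) (m + l)"
      by (simp add: b(4) r(3) scale_right_distrib)
    moreover have "m + l \<in> ispan S" using r(2) sub b(3) by (intro integer_submoduleD(2)[OF M]) auto
    moreover have "\<forall>i. r' i \<in> ring_of_integers" using r(1) b(1) by (simp add: r'_def)
    ultimately show "\<exists>r l. (\<forall>i. r i \<in> ring_of_integers) \<and> l \<in> ispan S \<and>
        s = (\<Sum>i\<in>insert a A. smul (r i) (x' i)) + smul (of_nat p) l"
      by blast
  qed
  then have "ispan S \<subseteq> {v. \<exists>r l. (\<forall>i. r i \<in> ring_of_integers) \<and> l \<in> ispan S \<and>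
      v = (\<Sum>i\<in>insert a A. smul (r i) (x' i)) + smul (of_nat p) l}"
    by (rule integer_span_least[OF integer_submodule_combinations[OF M]])
  then show ?case using x' by blast
qed

lemma local_generators:
  assumes p: "0 < (p::nat)" and S: "finite S" and L: "L = ispan S"
  obtains x :: "'n \<Rightarrow> 'v" where "\<And>i. x i \<in> L"
    "\<And>v. v \<in> L \<Longrightarrow> \<exists>r l. (\<forall>i. r i \<in> ring_of_integers) \<and> l \<in> L \<and> v = (\<Sum>i\<in>UNIV. smul (r i) (x i)) + smul (of_nat p) l"
proof -
  obtain x :: "'n \<Rightarrow> 'v" where x: "\<forall>i. x i \<in> ispan S" "ispan S \<subseteq>
      {v. \<exists>r l. (\<forall>i. r i \<in> ring_of_integers) \<and> l \<in> ispan S \<and> v = (\<Sum>i\<in>UNIV. smul (r i) (x i)) + smul (of_nat p) l}"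
    using local_generators_aux[OF p finite[of UNIV] S] by auto
  show ?thesis
  proof (rule that[of x])
    show "x i \<in> L" for i using x(1) L by blast
    show "\<exists>r l. (\<forall>i. r i \<in> ring_of_integers) \<and> l \<in> L \<and> v = (\<Sum>i\<in>UNIV. smul (r i) (x i)) + smul (of_nat p) l"
      if "v \<in> L" for v
      using x(2) that unfolding L by blast
  qed
qed

end

section \<open>Norms of ideals\<close>

context real_embedding_family
begin

lemma additive_subgroup_minkowski_image:
  assumes "integer_submodule (*) (I :: 'k set)"
  shows "additive_subgroup (minkowski ` I)"
  unfolding additive_subgroup_def
proof (intro conjI ballI)
  show "0 \<in> minkowski ` I"
    using integer_submoduleD(1)[OF assms] minkowski_simps(1) by (metis imageI)
next
  fix x y assume "x \<in> minkowski ` I" "y \<in> minkowski ` I"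
  then obtain a c where ac: "x = minkowski a" "y = minkowski c" "a \<in> I" "c \<in> I" by blast
  have "- 1 * c \<in> I"
    by (intro integer_submoduleD(3)[OF assms] ac ring_of_integers_closed)
  then have "a - c \<in> I" using integer_submoduleD(2)[OF assms ac(3)] by fastforce
  then show "x - y \<in> minkowski ` I" using ac minkowski_simps(3)[of a c] by (metis imageI)
qed

lemma integer_submodule_principal: "integer_submodule (*) ((*) (g :: 'k) ` ring_of_integers)"
  unfolding integer_submodule_def
proof (intro conjI ballI)
  show "0 \<in> (*) g ` ring_of_integers" by (rule image_eqI[of _ _ 0]) (simp_all add: ring_of_integers_closed)
next
  fix x y assume "x \<in> (*) g ` ring_of_integers" "y \<in> (*) g ` ring_of_integers"
  then obtain a b where "x = g * a" "y = g * b" "a \<in> ring_of_integers" "b \<in> ring_of_integers" by blast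
  then show "x + y \<in> (*) g ` ring_of_integers"
    by (intro image_eqI[of _ _ "a + b"]) (simp_all add: algebra_simps ring_of_integers_closed)
next
  fix a x assume a: "a \<in> (ring_of_integers :: 'k set)" and "x \<in> (*) g ` ring_of_integers"
  then obtain b where "x = g * b" "b \<in> ring_of_integers" by blast
  with a show "a * x \<in> (*) g ` ring_of_integers"
    by (intro image_eqI[of _ _ "a * b"]) (simp_all add: algebra_simps ring_of_integers_closed)
qed

text \<open>Multiplication by \<open>g\<close> acts on Minkowski vectors through the diagonal matrix of the numbers \<open>\<sigma> j g\<close>.\<close>

lemma principal_ideal_lattice:
  assumes b: "integral_basis (b :: 'd \<Rightarrow> 'k)" and g: "(g :: 'k) \<noteq> 0"
  shows "lattice_basis (minkowski ` (*) g ` ring_of_integers) (\<lambda>i. minkowski (g * b i))"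
    "covol (\<lambda>i. minkowski (g * b i)) = abs_norm g * covol (\<lambda>i. minkowski (b i))"
proof -
  define D :: "real^'d^'d" where "D = (\<chi> i j. if i = j then \<sigma> j g else 0)"
  have "det D = (\<Prod>i\<in>UNIV. D $ i $ i)" by (rule det_diagonal) (simp add: D_def)
  then have D: "det D = (\<Prod>j\<in>UNIV. \<sigma> j g)" by (simp add: D_def)
  have "vec_lambda (\<lambda>i. minkowski (g * b i)) = vec_lambda (\<lambda>i. minkowski (b i)) ** D"
    by (intro vec_eq_iff[THEN iffD2] allI)
       (simp add: D_def minkowski_def matrix_matrix_mult_def emb_simps if_distrib[where f = "(*) _"] mult.commute cong: if_cong)
  then have det: "det (vec_lambda (\<lambda>i. minkowski (g * b i))) = det (vec_lambda (\<lambda>i. minkowski (b i))) * (\<Prod>j\<in>UNIV. \<sigma> j g)"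
    by (simp add: Determinants.det_mul D)
  show "covol (\<lambda>i. minkowski (g * b i)) = abs_norm g * covol (\<lambda>i. minkowski (b i))"
    by (simp add: det abs_mult abs_norm_def)
  have lb: "lattice_basis O_image (\<lambda>i. minkowski (b i))" using b integral_basis_iff by blast
  have rng: "range (\<lambda>c :: 'd \<Rightarrow> int. \<Sum>i\<in>UNIV. of_int (c i) * b i) = ring_of_integers"
    using b by (simp add: integral_basis_def bij_betw_def)
  have mc: "minkowski (g * (\<Sum>i\<in>UNIV. of_int (c i) * b i)) = (\<Sum>i\<in>UNIV. of_int (c i) *\<^sub>R minkowski (g * b i))" for c
    by (simp add: sum_distrib_left mult.left_commute[of g] minkowski_sum minkowski_simps)
  have "minkowski ` (*) g ` ring_of_integers = int_span (\<lambda>i. minkowski (g * b i))"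
    unfolding rng[symmetric] int_span_def image_image mc ..
  moreover have "(\<Prod>j\<in>UNIV. \<sigma> j g) \<noteq> 0" using g by (simp add: emb_simps)
  then have "det (vec_lambda (\<lambda>i. minkowski (g * b i))) \<noteq> 0"
    using lb det by (simp add: lattice_basis_def)
  ultimately show "lattice_basis (minkowski ` (*) g ` ring_of_integers) (\<lambda>i. minkowski (g * b i))"
    by (simp add: lattice_basis_def)
qed

text \<open>The index of \<open>gO\<close> in \<open>O\<close> is the absolute norm of \<open>g\<close>, and \<open>I\<close> lies in between. If \<open>k I\<close> is contained in
\<open>gO\<close>, the index \<open>t\<close> of \<open>gO\<close> in \<open>I\<close> divides a power of \<open>k\<close>.\<close>

lemma ideal_norm_principal_multiple:
  assumes I: "integer_submodule (*) (I :: 'k set)" "I \<subseteq> ring_of_integers"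
    and g: "g \<in> I" "g \<noteq> 0" and k: "\<And>x. x \<in> I \<Longrightarrow> of_nat k * x \<in> (*) g ` ring_of_integers"
  shows "\<exists>t. t dvd k ^ CARD('d) \<and> abs_norm g = real t * real (ideal_norm I)" "0 < ideal_norm I"
proof -
  obtain b :: "'d \<Rightarrow> 'k" where b: "integral_basis b" using integral_basis_exists by blast
  have lb: "lattice_basis O_image (\<lambda>i. minkowski (b i))" using b integral_basis_iff by blast
  note pg = principal_ideal_lattice[OF b g(2)]
  have gI: "(*) g ` ring_of_integers \<subseteq> I"
    using integer_submoduleD(3)[OF I(1) _ g(1)] by (auto simp: mult.commute)
  have sub: "minkowski ` (*) g ` ring_of_integers \<subseteq> minkowski ` I" "minkowski ` I \<subseteq> O_image"
    using gI I(2) by blast+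
  note subI = additive_subgroup_minkowski_image[OF I(1)]
  obtain y where y: "lattice_basis (minkowski ` I) y"
    using lattice_basis_between[OF subI pg(1) sub(1) lb sub(2)] by blast
  obtain N where N: "0 < N" "has_index O_image (minkowski ` I) N"
    "covol y = real N * covol (\<lambda>i. minkowski (b i))"
    using lattice_index[OF y lb sub(2)] by blast
  have "card (quotient_group O_image (minkowski ` I)) = N"
    by (rule has_index_quotient_group(2)[OF subgroup_O_image subI N(2)])
  then have IN: "ideal_norm I = N"
    by (simp add: ideal_norm_def quotient_group_image(1)[OF inj_minkowski minkowski_simps(3)])
  then show "0 < ideal_norm I" using N(1) by simp
  obtain t where t: "covol (\<lambda>i. minkowski (g * b i)) = real t * covol y"
    using lattice_index[OF pg(1) y sub(1)] by blast
  have "t dvd k ^ CARD('d)"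
  proof (rule lattice_index_dvd_power[OF pg(1) y t])
    fix v assume "v \<in> minkowski ` I"
    then obtain a where a: "a \<in> I" "v = minkowski a" by blast
    then have "real k *\<^sub>R v = minkowski (of_nat k * a)" by (simp add: minkowski_simps)
    then show "real k *\<^sub>R v \<in> minkowski ` (*) g ` ring_of_integers" using k[OF a(1)] by blast
  qed
  moreover have "abs_norm g * covol (\<lambda>i. minkowski (b i))
      = (real t * real N) * covol (\<lambda>i. minkowski (b i))"
    using t N(3) pg(2) by simp
  then have "abs_norm g = real t * real N" using lb by (simp add: lattice_basis_def)
  ultimately show "\<exists>t. t dvd k ^ CARD('d) \<and> abs_norm g = real t * real (ideal_norm I)"
    using IN by blast
qed

lemma field_disc_nat:
  obtains m :: nat where "0 < m" "field_disc TYPE('d) TYPE('k) = of_nat m"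
    "\<And>b :: 'd \<Rightarrow> 'k. integral_basis b \<Longrightarrow> real m = (det (vec_lambda (\<lambda>i. minkowski (b i))))\<^sup>2"
proof -
  obtain b :: "'d \<Rightarrow> 'k" where b: "integral_basis b" using integral_basis_exists by blast
  have lb: "lattice_basis O_image (\<lambda>i. minkowski (b i))" using b integral_basis_iff by blast
  obtain m :: nat where m: "(det (vec_lambda (\<lambda>i. minkowski (b i))))\<^sup>2 = real m"
    using minkowski_det_square_nat[of "\<lambda>i. minkowski (b i)"] lattice_basis_mem[OF lb] by blast
  have "of_rat (field_disc TYPE('d) TYPE('k)) = (of_rat (of_nat m) :: real)"
    using field_disc_eq[OF b] m by simp
  then have disc: "field_disc TYPE('d) TYPE('k) = of_nat m" by (simp only: of_rat_eq_iff)
  moreover have "0 < m" using m lb by (cases m) (auto simp: lattice_basis_def)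
  moreover have "real m = (det (vec_lambda (\<lambda>i. minkowski (b' i))))\<^sup>2" if "integral_basis b'" for b' :: "'d \<Rightarrow> 'k"
    using field_disc_eq[OF that] disc by simp
  ultimately show ?thesis using that by blast
qed

end

section \<open>Lattices in the vector space as lattices in Euclidean space\<close>

text \<open>The rows of a vector of vectors, written one after the other, so that determinants of tuples make
sense.\<close>

definition flatten :: "real^'n^'d \<Rightarrow> real^('d \<times> 'n)" where
  "flatten x = (\<chi> r. x $ fst r $ snd r)"

lemma flatten_diff: "flatten (x - y) = flatten x - flatten y"
  by (simp add: flatten_def vec_eq_iff)

lemma inj_flatten: "inj flatten"
proof (rule injI)
  fix x y :: "real^'n^'d" assume "flatten x = flatten y"
  then have "flatten x $ (j, a) = flatten y $ (j, a)" for j a by simp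
  then show "x = y" by (simp add: flatten_def vec_eq_iff)
qed

lemma sum_pairs: "(\<Sum>r\<in>UNIV. h r) = (\<Sum>i\<in>UNIV. \<Sum>a\<in>UNIV. h (i, a))"
  by (simp add: sum.cartesian_product flip: UNIV_Times_UNIV)

context real_embedding_space
begin

definition embed :: "'v \<Rightarrow> real^('d \<times> 'n)" where
  "embed v = (\<chi> r. \<sigma> (fst r) (coord (snd r) v))"

lemma cor_map_nth: "cor_map smul e \<sigma> v $ j $ a = \<sigma> j (coord a v)"
  by (simp add: cor_map_def base_change_vec_def coord_def)

lemma embed_eq: "embed v = flatten (cor_map smul e \<sigma> v)"
  by (simp add: embed_def flatten_def cor_map_nth)

lemma embed_simps:
  "embed (v + w) = embed v + embed w" "embed (v - w) = embed v - embed w" "embed 0 = 0"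
  "embed (smul (of_int z) v) = of_int z *\<^sub>R embed v" "embed (smul (of_nat n) v) = of_nat n *\<^sub>R embed v"
  by (simp_all add: embed_def vec_eq_iff coord_simps emb_simps)

lemma embed_sum: "embed (\<Sum>i\<in>A. f i) = (\<Sum>i\<in>A. embed (f i))"
  by (induction A rule: infinite_finite_induct) (simp_all add: embed_simps)

lemma inj_embed: "inj embed"
proof (rule injI)
  fix v w assume "embed v = embed w"
  then have "embed (v - w) $ (undefined, a) = 0" for a by (simp add: embed_simps)
  then have "coord a (v - w) = 0" for a
    using field_embeddingD(7)[OF emb] by (simp add: embed_def)
  then show "v = w" by (intro coord_eqI) (simp add: coord_simps)
qed

lemma additive_subgroup_embed:
  assumes "integer_submodule smul L"
  shows "additive_subgroup (embed ` L)"
  unfolding additive_subgroup_def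
proof (intro conjI ballI)
  show "0 \<in> embed ` L"
    using integer_submoduleD(1)[OF assms] embed_simps(3) by (metis imageI)
next
  fix x y assume "x \<in> embed ` L" "y \<in> embed ` L"
  then obtain v w where "x = embed v" "y = embed w" "v \<in> L" "w \<in> L" by blast
  then show "x - y \<in> embed ` L"
    using integer_submodule_diff[OF assms, of v w] embed_simps(2)[of v w] by (metis imageI)
qed

definition free_module :: "('n \<Rightarrow> 'v) \<Rightarrow> 'v set" where
  "free_module x = {\<Sum>a\<in>UNIV. smul (r a) (x a) | r. \<forall>a. r a \<in> ring_of_integers}"

lemma free_moduleI: "(\<And>a. r a \<in> ring_of_integers) \<Longrightarrow> (\<Sum>a\<in>UNIV. smul (r a) (x a)) \<in> free_module x"
  by (auto simp: free_module_def)

definition coord_matrix :: "('n \<Rightarrow> 'v) \<Rightarrow> 'k^'n^'n" where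
  "coord_matrix x = (\<chi> a l. coord l (x a))"

text \<open>The images of the \<open>\<int>\<close>-basis of \<open>free_module x\<close> that consists of the products of an integral basis
\<open>b\<close> of \<open>K\<close> with the \<open>x a\<close>.\<close>

definition free_basis :: "('d \<Rightarrow> 'k) \<Rightarrow> ('n \<Rightarrow> 'v) \<Rightarrow> 'd \<times> 'n \<Rightarrow> real^('d \<times> 'n)" where
  "free_basis b x r = embed (smul (b (fst r)) (x (snd r)))"

lemma embed_free_module:
  assumes b: "integral_basis b"
  shows "embed ` free_module x = int_span (free_basis b x)"
proof -
  have rng: "range (\<lambda>c :: 'd \<Rightarrow> int. \<Sum>i\<in>UNIV. of_int (c i) * b i) = ring_of_integers"
    using b by (simp add: integral_basis_def bij_betw_def)
  have key: "(\<Sum>r\<in>UNIV. of_int (z r) *\<^sub>R free_basis b x r)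
      = embed (\<Sum>a\<in>UNIV. smul (\<Sum>i\<in>UNIV. of_int (z (i, a)) * b i) (x a))" for z :: "'d \<times> 'n \<Rightarrow> int"
  proof -
    have "embed (\<Sum>a\<in>UNIV. smul (\<Sum>i\<in>UNIV. of_int (z (i, a)) * b i) (x a))
        = (\<Sum>a\<in>UNIV. \<Sum>i\<in>UNIV. of_int (z (i, a)) *\<^sub>R embed (smul (b i) (x a)))"
      by (simp add: embed_sum scale_sum_left embed_simps flip: scale_scale)
    also have "\<dots> = (\<Sum>r\<in>UNIV. of_int (z r) *\<^sub>R free_basis b x r)"
      unfolding sum_pairs by (subst sum.swap) (simp add: free_basis_def)
    finally show ?thesis by simp
  qed
  show ?thesis
  proof (intro equalityI subsetI)
    fix v assume "v \<in> embed ` free_module x"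
    then obtain r where r: "\<And>a. r a \<in> ring_of_integers" "v = embed (\<Sum>a\<in>UNIV. smul (r a) (x a))"
      by (auto simp: free_module_def)
    have "\<forall>a. \<exists>c :: 'd \<Rightarrow> int. r a = (\<Sum>i\<in>UNIV. of_int (c i) * b i)"
    proof
      fix a
      have "r a \<in> range (\<lambda>c :: 'd \<Rightarrow> int. \<Sum>i\<in>UNIV. of_int (c i) * b i)" unfolding rng by (rule r(1))
      then show "\<exists>c :: 'd \<Rightarrow> int. r a = (\<Sum>i\<in>UNIV. of_int (c i) * b i)" by (elim rangeE) (rule exI)
    qed
    then obtain c where c: "\<And>a. r a = (\<Sum>i\<in>UNIV. of_int (c a i) * b i)" by metis
    have "v = (\<Sum>r\<in>UNIV. of_int (c (snd r) (fst r)) *\<^sub>R free_basis b x r)"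
      by (simp add: key r(2) c)
    then show "v \<in> int_span (free_basis b x)" by (simp add: int_spanI)
  next
    fix v assume "v \<in> int_span (free_basis b x)"
    then obtain z where "v = (\<Sum>r\<in>UNIV. of_int (z r) *\<^sub>R free_basis b x r)"
      by (auto simp: int_span_def)
    then have "v = embed (\<Sum>a\<in>UNIV. smul (\<Sum>i\<in>UNIV. of_int (z (i, a)) * b i) (x a))"
      by (simp only: key)
    moreover have "(\<Sum>i\<in>UNIV. of_int (z (i, a)) * b i) \<in> ring_of_integers" for a
      unfolding rng[symmetric] by (rule range_eqI[of _ _ "\<lambda>i. z (i, a)"]) (rule refl)
    ultimately show "v \<in> embed ` free_module x"
      using free_moduleI[of "\<lambda>a. \<Sum>i\<in>UNIV. of_int (z (i, a)) * b i" x] by blast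
  qed
qed

text \<open>The matrix of the tuple is a product of two block diagonal matrices: one has a copy of the matrix of
Minkowski vectors of \<open>b\<close> for every \<open>a\<close>, the other has the \<open>\<sigma> j\<close>-image of the coordinate matrix for
every \<open>j\<close>. The two matrices have their blocks along different factors of the index type.\<close>

lemma det_free_basis:
  "det (vec_lambda (free_basis b x)) =
    det (vec_lambda (\<lambda>i. minkowski (b i))) ^ CARD('n) * (\<Prod>j\<in>UNIV. \<sigma> j (det (coord_matrix x)))"
proof -
  let ?S = "vec_lambda (\<lambda>i. minkowski (b i)) :: real^'d^'d"
  let ?A = "\<lambda>j. (\<chi> a l. \<sigma> j (coord_matrix x $ a $ l)) :: real^'n^'n"
  define T :: "real^('d \<times> 'n)^('d \<times> 'n)" where
    "T = (\<chi> r c. if snd r = snd c then ?S $ fst r $ fst c else 0)"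
  define B :: "real^('d \<times> 'n)^('d \<times> 'n)" where
    "B = (\<chi> r c. if fst r = fst c then ?A (fst r) $ snd r $ snd c else 0)"
  have "det T = (\<Prod>a\<in>(UNIV :: 'n set). det ?S)"
    unfolding T_def
    by (rule det_block_diagonal[of snd fst "\<lambda>_. ?S"]) (auto simp: bij_def inj_def surj_def)
  then have T: "det T = det ?S ^ CARD('n)" by simp
  have "det B = (\<Prod>j\<in>UNIV. det (?A j))"
    unfolding B_def
    by (rule det_block_diagonal[of fst snd ?A]) (auto simp: bij_def inj_def surj_def)
  then have B: "det B = (\<Prod>j\<in>UNIV. \<sigma> j (det (coord_matrix x)))"
    by (simp add: field_embedding_det[OF emb])
  have "vec_lambda (free_basis b x) = T ** B"
  proof (intro vec_eq_iff[THEN iffD2] allI)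
    fix r c :: "'d \<times> 'n"
    have "(T ** B) $ r $ c = (\<Sum>k\<in>UNIV. if k = (fst c, snd r) then ?S $ fst r $ fst c * ?A (fst c) $ snd r $ snd c else 0)"
      unfolding matrix_matrix_mult_def T_def B_def
      by (simp only: vec_lambda_beta, intro sum.cong refl) auto
    also have "\<dots> = vec_lambda (free_basis b x) $ r $ c"
      by (simp add: free_basis_def embed_def coord_simps coord_matrix_def emb_simps minkowski_def)
    finally show "vec_lambda (free_basis b x) $ r $ c = (T ** B) $ r $ c" by simp
  qed
  then show ?thesis by (simp add: Determinants.det_mul T B)
qed

lemma free_module_lattice:
  assumes b: "integral_basis b" and x: "det (coord_matrix x) \<noteq> 0"
  shows "lattice_basis (embed ` free_module x) (free_basis b x)"
proof -
  have "(\<Prod>j\<in>UNIV. \<sigma> j (det (coord_matrix x))) \<noteq> 0" using x by (simp add: emb_simps)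
  moreover have "det (vec_lambda (\<lambda>i. minkowski (b i))) \<noteq> 0"
    using b integral_basis_iff by (auto simp: lattice_basis_def)
  ultimately show ?thesis
    by (simp add: lattice_basis_def embed_free_module[OF b] det_free_basis)
qed

lemma det_coord_matrix_scaled_basis:
  "det (coord_matrix (\<lambda>a. smul (c a) (e a))) = (\<Prod>a\<in>UNIV. c a)"
proof -
  have "det (coord_matrix (\<lambda>a. smul (c a) (e a))) = (\<Prod>a\<in>UNIV. coord_matrix (\<lambda>a. smul (c a) (e a)) $ a $ a)"
    by (rule det_diagonal) (simp add: coord_matrix_def coord_simps coord_e)
  then show ?thesis by (simp add: coord_matrix_def coord_simps coord_e)
qed

lemma free_module_subset:
  assumes L: "integer_submodule smul L" and x: "\<And>a. x a \<in> L"
  shows "free_module x \<subseteq> L"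
proof
  fix v assume "v \<in> free_module x"
  then obtain r where "\<And>a. r a \<in> ring_of_integers" "v = (\<Sum>a\<in>UNIV. smul (r a) (x a))"
    by (auto simp: free_module_def)
  then show "v \<in> L" by (simp add: integer_submodule_sum[OF L] integer_submoduleD(3)[OF L] x)
qed

lemma integer_lattice_multiple:
  assumes L: "integer_submodule smul L" and v: "v \<in> span L"
  shows "\<exists>N>0. smul (of_nat N) v \<in> L"
  using v
proof (induction rule: span_induct_alt)
  case base
  show ?case using integer_submoduleD(1)[OF L] by (intro exI[of _ 1]) simp
next
  case (step k w v)
  obtain N where N: "0 < N" "smul (of_nat N) v \<in> L" using step by blast
  obtain D :: nat where D: "0 < D" "of_nat D * k \<in> ring_of_integers" using integral_denominator by blast
  have "smul (of_nat (D * N)) (smul k w + v) = smul (of_nat N * (of_nat D * k)) w + smul (of_nat D) (smul (of_nat N) v)"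
    by (simp add: scale_right_distrib mult_ac)
  also have "\<dots> \<in> L"
    by (intro integer_submoduleD(2,3)[OF L] ring_of_integers_closed D N step)
  finally show ?case using N D by (intro exI[of _ "D * N"]) simp
qed

text \<open>A lattice lies between two free modules spanned by rational multiples of \<open>e\<close>, obtained by clearing
the denominators of the vectors \<open>e a\<close> with respect to \<open>L\<close> and of the generators of \<open>L\<close> with respect to \<open>e\<close>.\<close>

lemma integer_lattice_basis:
  assumes S: "finite S" and L: "L = ispan S" and span: "span L = UNIV"
  shows "\<exists>y. lattice_basis (embed ` L) y"
proof -
  obtain b :: "'d \<Rightarrow> 'k" where b: "integral_basis b" using integral_basis_exists by blast
  have sub: "integer_submodule smul L" unfolding L by (rule integer_submodule_integer_span)
  have "\<forall>a. \<exists>N::nat. 0 < N \<and> smul (of_nat N) (e a) \<in> L"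
    using integer_lattice_multiple[OF sub] span by blast
  then obtain N where N: "\<And>a. 0 < N a" "\<And>a. smul (of_nat (N a)) (e a) \<in> L" by metis
  have "(\<Prod>a\<in>UNIV. (of_nat (N a) :: 'k)) \<noteq> 0" using N(1) by simp
  then have lower: "lattice_basis (embed ` free_module (\<lambda>a. smul (of_nat (N a)) (e a))) (free_basis b (\<lambda>a. smul (of_nat (N a)) (e a)))"
    by (intro free_module_lattice[OF b]) (simp add: det_coord_matrix_scaled_basis)
  have lsub: "embed ` free_module (\<lambda>a. smul (of_nat (N a)) (e a)) \<subseteq> embed ` L"
    by (intro image_mono free_module_subset[OF sub] N)
  have "\<exists>D>0. \<forall>k\<in>T. of_nat D * k \<in> ring_of_integers" if "finite T" for T :: "'k set"
    using that
  proof (induction T)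
    case empty
    show ?case by (intro exI[of _ 1]) simp
  next
    case (insert k T)
    then obtain D where D: "0 < D" "\<forall>k\<in>T. of_nat D * k \<in> ring_of_integers" by blast
    obtain C :: nat where C: "0 < C" "of_nat C * k \<in> ring_of_integers" using integral_denominator by blast
    have "of_nat (C * D) * l \<in> ring_of_integers" if "l \<in> insert k T" for l
    proof (cases "l = k")
      case True
      have "of_nat (C * D) * l = of_nat D * (of_nat C * k)" by (simp add: True)
      then show ?thesis using C(2) ring_of_integers_closed(2,8) by metis
    next
      case False
      have "of_nat (C * D) * l = of_nat C * (of_nat D * l)" by (simp add: mult.assoc)
      then show ?thesis using False that D(2) ring_of_integers_closed(2,8) by (metis insertE)
    qed
    then show ?case using C D by (intro exI[of _ "C * D"]) auto
  qed
  from this[of "(\<lambda>(a, s). coord a s) ` (UNIV \<times> S)"]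
  obtain D where D: "0 < D" "\<And>a s. s \<in> S \<Longrightarrow> of_nat D * coord a s \<in> ring_of_integers"
    using S by fastforce
  have "(\<Prod>a\<in>(UNIV :: 'n set). (1 / of_nat D :: 'k)) \<noteq> 0" using D(1) by simp
  then have upper: "lattice_basis (embed ` free_module (\<lambda>a. smul (1 / of_nat D) (e a))) (free_basis b (\<lambda>a. smul (1 / of_nat D) (e a)))"
    by (intro free_module_lattice[OF b]) (simp add: det_coord_matrix_scaled_basis)
  have "integer_submodule smul {v. \<forall>a. of_nat D * coord a v \<in> ring_of_integers}"
    by (simp add: integer_submodule_def coord_simps distrib_left mult.left_commute ring_of_integers_closed)
  then have up: "L \<subseteq> {v. \<forall>a. of_nat D * coord a v \<in> ring_of_integers}"
    unfolding L using D(2) by (intro integer_span_least) auto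
  have "L \<subseteq> free_module (\<lambda>a. smul (1 / of_nat D) (e a))"
  proof
    fix v assume "v \<in> L"
    then have "\<forall>a. of_nat D * coord a v \<in> ring_of_integers" using up by blast
    moreover have "v = (\<Sum>a\<in>UNIV. smul (of_nat D * coord a v) (smul (1 / of_nat D) (e a)))"
      using D(1) coord_expansion[of v] by simp
    ultimately show "v \<in> free_module (\<lambda>a. smul (1 / of_nat D) (e a))"
      using free_moduleI[of "\<lambda>a. of_nat D * coord a v" "\<lambda>a. smul (1 / of_nat D) (e a)"] by simp
  qed
  then show ?thesis
    using lattice_basis_between[OF additive_subgroup_embed[OF sub] lower lsub upper] by blast
qed

text \<open>The \<open>n\<close> generators of \<open>L\<close> modulo \<open>p L\<close> span a free module of index prime to \<open>p\<close>, by Nakayama's lemma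
for the lattices in Euclidean space.\<close>

lemma local_free_sublattice:
  assumes S: "finite S" and L: "L = ispan S" and y: "lattice_basis (embed ` L) y"
    and p: "prime (p::nat)" and b: "integral_basis b"
  shows "\<exists>x k. (\<forall>a. x a \<in> L) \<and> \<not> p dvd k \<and> (\<forall>v\<in>L. smul (of_nat k) v \<in> free_module x) \<and>
    covol (free_basis b x) = real k * covol y"
proof -
  have sub: "integer_submodule smul L" unfolding L by (rule integer_submodule_integer_span)
  have p0: "0 < p" using p prime_gt_0_nat by blast
  obtain x :: "'n \<Rightarrow> 'v" where x: "\<And>a. x a \<in> L"
    and gen: "\<And>v. v \<in> L \<Longrightarrow> \<exists>r l. (\<forall>i. r i \<in> ring_of_integers) \<and> l \<in> L \<and> v = (\<Sum>i\<in>UNIV. smul (r i) (x i)) + smul (of_nat p) l"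
    using local_generators[OF p0 S L] by metis
  let ?M = "embed ` free_module x"
  have M: "additive_subgroup ?M"
    by (simp add: embed_free_module[OF b] additive_subgroup_int_span)
  have MsubL: "?M \<subseteq> embed ` L" by (intro image_mono free_module_subset[OF sub] x)
  have cover: "\<exists>a\<in>?M. \<exists>c\<in>embed ` L. w = a + real p *\<^sub>R c" if w: "w \<in> embed ` L" for w
  proof -
    obtain v where v: "v \<in> L" "w = embed v" using w by blast
    obtain r l where rl: "\<forall>i. r i \<in> ring_of_integers" "l \<in> L" "v = (\<Sum>i\<in>UNIV. smul (r i) (x i)) + smul (of_nat p) l"
      using gen[OF v(1)] by blast
    have "w = embed (\<Sum>i\<in>UNIV. smul (r i) (x i)) + real p *\<^sub>R embed l"
      by (simp add: v(2) rl(3) embed_simps)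
    moreover have "(\<Sum>i\<in>UNIV. smul (r i) (x i)) \<in> free_module x"
      using rl(1) by (simp add: free_moduleI)
    ultimately show ?thesis using rl(2) by blast
  qed
  obtain z k where z: "lattice_basis ?M z" "covol z = real k * covol y"
    "\<not> p dvd k" "\<And>w. w \<in> embed ` L \<Longrightarrow> real k *\<^sub>R w \<in> ?M"
    using sublattice_index_prime_to[OF y M MsubL p cover] by metis
  have "\<And>r. z r \<in> int_span (free_basis b x)"
    using lattice_basis_mem[OF z(1)] by (simp add: embed_free_module[OF b])
  then obtain m :: int where "det (vec_lambda z) = of_int m * det (vec_lambda (free_basis b x))"
    using det_int_multiple[of z "free_basis b x"] by blast
  then have fb: "lattice_basis ?M (free_basis b x)"
    using z(1) by (auto simp: lattice_basis_def embed_free_module[OF b])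
  have mult: "smul (of_nat k) v \<in> free_module x" if "v \<in> L" for v
  proof -
    have "embed (smul (of_nat k) v) \<in> ?M" using z(4)[of "embed v"] that by (simp add: embed_simps)
    then show ?thesis using inj_embed by (auto simp: inj_def)
  qed
  have "covol (free_basis b x) = real k * covol y"
    using lattice_basis_abs_det_unique[OF fb z(1)] z(2) by simp
  then show ?thesis
    using x z(3) mult by (intro exI[of _ x] exI[of _ k]) simp
qed

end

section \<open>The order of the discriminant group\<close>

locale real_embedding_form = real_embedding_space \<sigma> smul e
  for \<sigma> :: "'d::finite \<Rightarrow> 'k::field_char_0 \<Rightarrow> real" and smul :: "'k \<Rightarrow> 'v::ab_group_add \<Rightarrow> 'v"
    and e :: "'n::finite \<Rightarrow> 'v" +
  fixes Q :: "'v \<Rightarrow> 'v \<Rightarrow> 'k"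
  assumes form: "nondegenerate_symmetric_form smul Q"
begin

definition gram :: "('n \<Rightarrow> 'v) \<Rightarrow> 'k^'n^'n" where
  "gram x = (\<chi> a b. Q (x a) (x b))"

lemma form_simps:
  "Q (smul k v) w = k * Q v w" "Q v (smul k w) = k * Q v w"
  "Q (\<Sum>a\<in>A. g a) w = (\<Sum>a\<in>A. Q (g a) w)" "Q v (\<Sum>a\<in>A. g a) = (\<Sum>a\<in>A. Q v (g a))"
proof -
  have lin: "Vector_Spaces.linear smul (*) (\<lambda>w. Q u w)"
            "Vector_Spaces.linear smul (*) (\<lambda>w. Q w u)" for u
    using form by (auto simp: nondegenerate_symmetric_form_def)
  interpret L: Vector_Spaces.linear smul "(*)" "\<lambda>w. Q u w" for u by (rule lin)
  interpret R: Vector_Spaces.linear smul "(*)" "\<lambda>w. Q w u" for u by (rule lin)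
  show "Q (smul k v) w = k * Q v w" "Q v (smul k w) = k * Q v w"
    "Q (\<Sum>a\<in>A. g a) w = (\<Sum>a\<in>A. Q (g a) w)" "Q v (\<Sum>a\<in>A. g a) = (\<Sum>a\<in>A. Q v (g a))"
    by (rule R.scale L.scale R.sum L.sum)+
qed

lemma det_gram_combination:
  assumes y: "\<And>a. y a = (\<Sum>b\<in>UNIV. smul (R $ a $ b) (x b))"
  shows "det (gram y) = (det R)\<^sup>2 * det (gram x)"
proof -
  have "gram y = R ** gram x ** transpose R"
    by (intro vec_eq_iff[THEN iffD2] allI)
       (simp add: gram_def y form_simps matrix_matrix_mult_def transpose_def sum_distrib_left sum_distrib_right mult_ac)
  then show ?thesis by (simp add: Determinants.det_mul power2_eq_square mult_ac)
qed

lemma det_gram_coord: "det (gram x) = (det (coord_matrix x))\<^sup>2 * det (gram e)"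
  by (rule det_gram_combination) (simp add: coord_matrix_def coord_expansion[symmetric])

text \<open>A vector in the kernel of the Gram matrix is orthogonal to the basis \<open>e\<close>, hence to \<open>V\<close>.\<close>

lemma det_gram_basis_nonzero: "det (gram e) \<noteq> 0"
proof
  assume zero: "det (gram e) = 0"
  have "\<not> (\<exists>B::'k^'n^'n. B ** gram e = mat 1)"
  proof
    assume "\<exists>B::'k^'n^'n. B ** gram e = mat 1"
    then obtain B :: "'k^'n^'n" where "B ** gram e = mat 1" by blast
    then have "det B * det (gram e) = 1" by (simp flip: Determinants.det_mul)
    then show False using zero by simp
  qed
  then obtain c :: "'k^'n" where c: "c \<noteq> 0" "gram e *v c = 0"
    unfolding matrix_left_invertible_ker by blast
  define v where "v = (\<Sum>b\<in>UNIV. smul (c $ b) (e b))"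
  have "Q (e a) v = (gram e *v c) $ a" for a
    by (simp add: v_def form_simps gram_def matrix_vector_mult_def mult.commute)
  then have ev: "Q (e a) v = 0" for a using c(2) by simp
  have "Q w v = 0" for w
    by (subst coord_expansion[of w]) (simp add: form_simps ev)
  then have "\<forall>w. Q v w = 0" using form by (metis nondegenerate_symmetric_form_def)
  then have "v = 0" using form by (auto simp: nondegenerate_symmetric_form_def)
  moreover have "coord a v = c $ a" for a
    by (simp add: v_def coord_sum coord_simps coord_e if_distrib[where f = "(*) _"] cong: if_cong)
  ultimately have "c = 0" by (simp add: vec_eq_iff coord_simps)
  then show False using c(1) by simp
qed

lemma cor_form_cor_map:
  "cor_form e \<sigma> Q (cor_map smul e \<sigma> v) (cor_map smul e \<sigma> w) = of_rat (field_trace (Q v w))"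
proof -
  have "base_change_form e (\<sigma> j) Q (base_change_vec smul e (\<sigma> j) v) (base_change_vec smul e (\<sigma> j) w) = \<sigma> j (Q v w)" for j
    using base_change_form_tensor[OF vector_space_axioms basis emb[of j] form, of 1 v 1 w] by simp
  then show ?thesis by (simp add: cor_form_def cor_map_def field_trace_eq)
qed

definition form_matrix :: "real^('d \<times> 'n)^('d \<times> 'n)" where
  "form_matrix = (\<chi> r c. if fst r = fst c then \<sigma> (fst r) (gram e $ snd r $ snd c) else 0)"

lemma cor_form_flatten: "cor_form e \<sigma> Q x y = flatten x \<bullet> (form_matrix *v flatten y)"
proof -
  have row: "(form_matrix *v flatten y) $ (j, a) = (\<Sum>b\<in>UNIV. \<sigma> j (gram e $ a $ b) * y $ j $ b)" for j a
  proof -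
    have "(form_matrix *v flatten y) $ (j, a)
        = (\<Sum>k\<in>UNIV. \<Sum>b\<in>UNIV. if j = k then \<sigma> j (gram e $ a $ b) * y $ k $ b else 0)"
      by (simp add: matrix_vector_mult_def sum_pairs form_matrix_def flatten_def if_distrib[where f = "\<lambda>c. c * _"] cong: if_cong)
    also have "\<dots> = (\<Sum>b\<in>UNIV. \<sigma> j (gram e $ a $ b) * y $ j $ b)"
      by (subst sum.swap) simp
    finally show ?thesis .
  qed
  show ?thesis
    unfolding inner_vec_def sum_pairs row
    by (simp add: cor_form_def base_change_form_def flatten_def gram_def sum_distrib_left mult_ac)
qed

lemma det_form_matrix: "\<bar>det form_matrix\<bar> = abs_norm (det (gram e))"
proof -
  have "det form_matrix = (\<Prod>j\<in>UNIV. det (\<chi> a l. \<sigma> j (gram e $ a $ l)))"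
    using det_block_diagonal[of fst snd "\<lambda>j. (\<chi> a l. \<sigma> j (gram e $ a $ l)) :: real^'n^'n"]
    by (simp add: form_matrix_def bij_def inj_def surj_def cong: if_cong)
  then show ?thesis by (simp add: abs_norm_def field_embedding_det[OF emb])
qed

text \<open>The dual lattice is defined inside the rational space \<open>f(V)\<close>, while \<open>dual_lattice_basis\<close> concerns
the dual in Euclidean space. They coincide: the real dual contains \<open>f(L)\<close> with finite index \<open>k\<close>, so
\<open>k\<close> times any of its elements lies in \<open>f(L)\<close>.\<close>

lemma discriminant_group_order:
  assumes L: "integer_submodule smul L" and y: "lattice_basis (embed ` L) y"
    and int: "\<And>v w. v \<in> L \<Longrightarrow> w \<in> L \<Longrightarrow> Q v w \<in> ring_of_integers"
  shows "finite (discriminant_group smul e \<sigma> Q L)" "0 < card (discriminant_group smul e \<sigma> Q L)"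
    "real (card (discriminant_group smul e \<sigma> Q L)) = abs_norm (det (gram e)) * (det (vec_lambda y))\<^sup>2"
proof -
  let ?f = "cor_map smul e \<sigma>"
  define D where "D = {v. \<forall>w\<in>embed ` L. v \<bullet> (form_matrix *v w) \<in> \<int>}"
  have H: "det form_matrix \<noteq> 0"
    using det_form_matrix det_gram_basis_nonzero by (auto simp: abs_norm_def emb_simps)
  obtain z where z: "lattice_basis D z" "covol z * \<bar>det form_matrix\<bar> * covol y = 1"
    unfolding D_def by (rule dual_lattice_basis[OF y H])
  have "embed v \<bullet> (form_matrix *v embed w) \<in> \<int>" if vw: "v \<in> L" "w \<in> L" for v w
  proof -
    have "embed v \<bullet> (form_matrix *v embed w) = of_rat (field_trace (Q v w))"
      using cor_form_cor_map[of v w] by (simp add: cor_form_flatten embed_eq)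
    moreover obtain m where "field_trace (Q v w) = of_int m"
      using trace_integral[OF int[OF vw]] by (auto elim: Ints_cases)
    ultimately show ?thesis by simp
  qed
  then have LD: "embed ` L \<subseteq> D" by (auto simp: D_def)
  obtain k where k: "0 < k" "has_index D (embed ` L) k" "covol y = real k * covol z"
    "\<And>v. v \<in> D \<Longrightarrow> real k *\<^sub>R v \<in> embed ` L"
    using lattice_index[OF y z(1) LD] by blast
  let ?dual = "dual_lattice (cor_form e \<sigma> Q) (cor_space smul e \<sigma>) (?f ` L)"
  have "flatten ` ?dual = D"
  proof (intro equalityI subsetI)
    fix v assume "v \<in> flatten ` ?dual"
    then show "v \<in> D"
      by (auto simp: dual_lattice_def D_def cor_form_flatten embed_eq)
  next
    fix v assume v: "v \<in> D"
    obtain l where l: "l \<in> L" "real k *\<^sub>R v = embed l" using k(4)[OF v] by blast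
    have kl: "smul (of_nat k) (smul (1 / of_nat k) l) = l" using k(1) by simp
    have "real k *\<^sub>R embed (smul (1 / of_nat k) l) = embed (smul (of_nat k) (smul (1 / of_nat k) l))"
      by (simp only: embed_simps(5))
    then have "real k *\<^sub>R embed (smul (1 / of_nat k) l) = real k *\<^sub>R v"
      by (simp only: kl l(2))
    moreover have "real k \<noteq> 0" using k(1) by simp
    ultimately have "embed (smul (1 / of_nat k) l) = v" by (rule scaleR_left_imp_eq[rotated])
    then have v': "v = flatten (?f (smul (1 / of_nat k) l))" unfolding embed_eq by (rule sym)
    moreover have "?f (smul (1 / of_nat k) l) \<in> ?dual"
      using v by (auto simp: dual_lattice_def D_def cor_space_def cor_form_flatten embed_eq v')
    ultimately show "v \<in> flatten ` ?dual" by blast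
  qed
  moreover have "flatten ` ?f ` L = embed ` L" by (simp add: image_image embed_eq)
  ultimately have q: "card (discriminant_group smul e \<sigma> Q L) = card (quotient_group D (embed ` L))"
    "finite (discriminant_group smul e \<sigma> Q L) \<longleftrightarrow> finite (quotient_group D (embed ` L))"
    unfolding discriminant_group_def
    using quotient_group_image[OF inj_flatten flatten_diff, of ?dual "?f ` L"] by simp_all
  have DL: "additive_subgroup D" "additive_subgroup (embed ` L)"
    using lattice_basis_subgroup z(1) y by blast+
  show "finite (discriminant_group smul e \<sigma> Q L)"
    using q(2) has_index_quotient_group(1)[OF DL k(2)] by simp
  have card: "card (discriminant_group smul e \<sigma> Q L) = k"
    using q(1) has_index_quotient_group(2)[OF DL k(2)] by simp
  then show "0 < card (discriminant_group smul e \<sigma> Q L)" using k(1) by simp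
  have "covol y * covol y * \<bar>det form_matrix\<bar>
      = real k * (covol z * \<bar>det form_matrix\<bar> * covol y)"
    unfolding k(3) by (simp add: mult_ac)
  then have "real k = covol y * covol y * \<bar>det form_matrix\<bar>" using z(2) by simp
  then show "real (card (discriminant_group smul e \<sigma> Q L)) = abs_norm (det (gram e)) * (det (vec_lambda y))\<^sup>2"
    by (simp add: card det_form_matrix power2_eq_square mult.commute)
qed

lemma abs_norm_mult: "abs_norm (x * y) = abs_norm x * abs_norm y"
  by (simp add: abs_norm_def emb_simps prod.distrib abs_mult)

lemma disc_ideal_submodule: "integer_submodule (*) (disc_ideal TYPE('n) Q L)"
proof -
  interpret K: rational_vector_space "(*) :: 'k \<Rightarrow> 'k \<Rightarrow> 'k"
    by unfold_locales (simp_all add: algebra_simps)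
  show ?thesis unfolding disc_ideal_def by (rule K.integer_submodule_integer_span)
qed

lemma disc_ideal_generator: "(\<And>a. x a \<in> L) \<Longrightarrow> det (gram x) \<in> disc_ideal TYPE('n) Q L"
proof -
  interpret K: rational_vector_space "(*) :: 'k \<Rightarrow> 'k \<Rightarrow> 'k"
    by unfold_locales (simp_all add: algebra_simps)
  assume "\<And>a. x a \<in> L"
  then show ?thesis unfolding disc_ideal_def gram_def
    by (intro K.integer_span_superset) blast
qed

lemma disc_ideal_least:
  assumes "integer_submodule (*) I" "\<And>x. (\<And>a. x a \<in> L) \<Longrightarrow> det (gram x) \<in> I"
  shows "disc_ideal TYPE('n) Q L \<subseteq> I"
proof -
  interpret K: rational_vector_space "(*) :: 'k \<Rightarrow> 'k \<Rightarrow> 'k"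
    by unfold_locales (simp_all add: algebra_simps)
  have "{det (\<chi> i j. Q (x i) (x j)) | x :: 'n \<Rightarrow> 'v. range x \<subseteq> L} \<subseteq> I"
    using assms(2) by (auto simp: gram_def)
  then show ?thesis unfolding disc_ideal_def by (rule K.integer_span_least[OF assms(1)])
qed

text \<open>Let \<open>x\<close> span a free submodule of index \<open>k\<close> prime to \<open>p\<close>, and let \<open>g\<close> be its Gram determinant. For a
tuple \<open>w\<close> in \<open>L\<close> the vectors \<open>k w\<^sub>a\<close> are integral combinations of \<open>x\<close>, so \<open>k\<^bsup>2n\<^esup>\<close> times its
Gram determinant is a multiple of \<open>g\<close>. So \<open>gO\<close> has index \<open>t\<close> prime to \<open>p\<close> in the discriminant ideal. The
covolume of the submodule is \<open>k\<close> times that of \<open>L\<close>, which produces the factor \<open>k\<^sup>2\<close> in the order of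
the discriminant group.\<close>

lemma discriminant_order_away_from_prime:
  assumes S: "finite S" and L: "L = ispan S" and y: "lattice_basis (embed ` L) y"
    and int: "\<And>v w. v \<in> L \<Longrightarrow> w \<in> L \<Longrightarrow> Q v w \<in> ring_of_integers"
    and m: "\<And>b :: 'd \<Rightarrow> 'k. integral_basis b \<Longrightarrow> real m = (det (vec_lambda (\<lambda>i. minkowski (b i))))\<^sup>2"
    and p: "prime (p::nat)"
  shows "\<exists>k t. \<not> p dvd k \<and> \<not> p dvd t \<and>
    card (discriminant_group smul e \<sigma> Q L) * k\<^sup>2 = m ^ CARD('n) * (t * ideal_norm (disc_ideal TYPE('n) Q L))"
    "0 < ideal_norm (disc_ideal TYPE('n) Q L)"
proof -
  let ?I = "disc_ideal TYPE('n) Q L"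
  have sub: "integer_submodule smul L" unfolding L by (rule integer_submodule_integer_span)
  obtain b :: "'d \<Rightarrow> 'k" where b: "integral_basis b" using integral_basis_exists by blast
  obtain x k where x: "\<forall>a. x a \<in> L" "\<not> p dvd k" "\<forall>v\<in>L. smul (of_nat k) v \<in> free_module x"
    "covol (free_basis b x) = real k * covol y"
    using local_free_sublattice[OF S L y p b] by blast
  have xL: "x a \<in> L" for a using x(1) by blast
  have k0: "k \<noteq> 0" using x(2) by (intro notI) simp
  have "det (vec_lambda (free_basis b x)) \<noteq> 0"
    using x(4) k0 y by (auto simp: lattice_basis_def)
  then have cx: "det (coord_matrix x) \<noteq> 0"
    by (auto simp: det_free_basis emb_simps)
  define g where "g = det (gram x)"
  have g0: "g \<noteq> 0"
    unfolding g_def det_gram_coord[of x] using cx det_gram_basis_nonzero by simp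
  have gI: "g \<in> ?I" unfolding g_def by (rule disc_ideal_generator[OF xL])
  have IO: "?I \<subseteq> ring_of_integers"
  proof (rule disc_ideal_least)
    show "integer_submodule (*) (ring_of_integers :: 'k set)"
      by (simp add: integer_submodule_def ring_of_integers_closed)
    fix w :: "'n \<Rightarrow> 'v" assume w: "\<And>a. w a \<in> L"
    show "det (gram w) \<in> ring_of_integers"
      by (rule ring_of_integers_det) (simp add: gram_def int w)
  qed
  define K where "K = k ^ (2 * CARD('n))"
  have KI: "of_nat K * z \<in> (*) g ` ring_of_integers" if z: "z \<in> ?I" for z
  proof -
    have "integer_submodule (*) {z. of_nat K * z \<in> (*) g ` ring_of_integers}"
      using integer_submodule_principal[of g]
      by (auto simp: integer_submodule_def distrib_left mult.left_commute)
    moreover have "det (gram w) \<in> {z. of_nat K * z \<in> (*) g ` ring_of_integers}" if w: "\<And>a. w a \<in> L" for w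
    proof -
      have "\<forall>a. \<exists>r. (\<forall>c. r c \<in> ring_of_integers) \<and> smul (of_nat k) (w a) = (\<Sum>c\<in>UNIV. smul (r c) (x c))"
        using x(3) w by (simp add: free_module_def) metis
      then obtain r where r: "\<And>a c. r a c \<in> ring_of_integers"
        "\<And>a. smul (of_nat k) (w a) = (\<Sum>c\<in>UNIV. smul (r a c) (x c))" by metis
      have "det (gram (\<lambda>a. smul (of_nat k) (w a))) = (det (\<chi> a c. r a c))\<^sup>2 * g"
        unfolding g_def by (rule det_gram_combination) (simp add: r(2))
      moreover have "det (gram (\<lambda>a. smul (of_nat k) (w a))) = (det (mat (of_nat k) :: 'k^'n^'n))\<^sup>2 * det (gram w)"
        by (rule det_gram_combination)
           (simp add: Finite_Cartesian_Product.mat_def if_distrib[where f = "\<lambda>c. smul c _"] cong: if_cong)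
      moreover have "det (mat (of_nat k) :: 'k^'n^'n) = of_nat k ^ CARD('n)"
        by (subst det_diagonal) (simp_all add: Finite_Cartesian_Product.mat_def)
      ultimately have "of_nat K * det (gram w) = g * (det (\<chi> a c. r a c))\<^sup>2"
        by (simp add: K_def power_mult[symmetric] mult.commute)
      moreover have "(det (\<chi> a c. r a c))\<^sup>2 \<in> ring_of_integers"
        by (intro ring_of_integers_closed ring_of_integers_det) (simp add: r(1))
      ultimately show ?thesis by blast
    qed
    ultimately have "?I \<subseteq> {z. of_nat K * z \<in> (*) g ` ring_of_integers}" by (rule disc_ideal_least)
    then show ?thesis using z by blast
  qed
  obtain t where t: "t dvd K ^ CARD('d)" "abs_norm g = real t * real (ideal_norm ?I)"
    using ideal_norm_principal_multiple(1)[OF disc_ideal_submodule IO gI g0 KI] by blast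
  show "0 < ideal_norm ?I"
    by (rule ideal_norm_principal_multiple(2)[OF disc_ideal_submodule IO gI g0 KI])
  have "\<not> p dvd K ^ CARD('d)"
    by (metis K_def p prime_dvd_power_nat x(2))
  then have pt: "\<not> p dvd t" using t(1) dvd_trans by blast
  note order = discriminant_group_order[OF sub y int]
  let ?s = "det (vec_lambda (\<lambda>i. minkowski (b i)))"
  let ?P = "\<Prod>j\<in>UNIV. \<sigma> j (det (coord_matrix x))"
  have normsq: "abs_norm (det (coord_matrix x)) ^ 2 = ?P\<^sup>2" by (simp add: abs_norm_def)
  have "real (card (discriminant_group smul e \<sigma> Q L)) * (real k)\<^sup>2
      = abs_norm (det (gram e)) * (real k * covol y)\<^sup>2"
    by (simp add: order(3) power_mult_distrib)
  also have "(real k * covol y)\<^sup>2 = (?s ^ CARD('n) * ?P)\<^sup>2"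
    unfolding x(4)[symmetric] power2_abs det_free_basis ..
  also have "\<dots> = (?s\<^sup>2) ^ CARD('n) * ?P\<^sup>2"
    by (simp add: power_mult_distrib power_mult[symmetric] mult.commute)
  also have "abs_norm (det (gram e)) * ((?s\<^sup>2) ^ CARD('n) * ?P\<^sup>2) = real m ^ CARD('n) * abs_norm g"
    by (simp add: m[OF b] g_def det_gram_coord[of x] abs_norm_mult power2_eq_square normsq[unfolded power2_eq_square, symmetric] mult_ac)
  also have "\<dots> = real (m ^ CARD('n) * (t * ideal_norm ?I))"
    using t(2) by simp
  finally have "real (card (discriminant_group smul e \<sigma> Q L) * k\<^sup>2) = real (m ^ CARD('n) * (t * ideal_norm ?I))"
    by simp
  then have "card (discriminant_group smul e \<sigma> Q L) * k\<^sup>2 = m ^ CARD('n) * (t * ideal_norm ?I)"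
    by (simp only: of_nat_eq_iff)
  then show "\<exists>k t. \<not> p dvd k \<and> \<not> p dvd t \<and>
      card (discriminant_group smul e \<sigma> Q L) * k\<^sup>2 = m ^ CARD('n) * (t * ideal_norm ?I)"
    using x(2) pt by blast
qed

lemma nat_eq_if_eq_away_from_primes:
  fixes a c :: nat
  assumes "0 < a" "0 < c" "\<And>p. prime p \<Longrightarrow> \<exists>s t. \<not> p dvd s \<and> \<not> p dvd t \<and> a * s = c * t"
  shows "a = c"
proof (rule multiplicity_eq_nat)
  fix p :: nat assume p: "prime p"
  obtain s t where st: "\<not> p dvd s" "\<not> p dvd t" "a * s = c * t" using assms(3)[OF p] by blast
  have "s \<noteq> 0" "t \<noteq> 0" using st(1,2) by (intro notI; simp)+
  then have "multiplicity p (a * s) = multiplicity p a" "multiplicity p (c * t) = multiplicity p c"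
    using p assms(1,2) st(1,2) by (simp_all add: prime_elem_multiplicity_mult_distrib not_dvd_imp_multiplicity_0)
  then show "multiplicity p a = multiplicity p c" using st(3) by simp
qed (use assms in auto)

lemma discriminant_group_card:
  assumes lat: "integer_lattice smul L"
    and int: "\<And>v w. v \<in> L \<Longrightarrow> w \<in> L \<Longrightarrow> Q v w \<in> ring_of_integers"
  shows "finite (discriminant_group smul e \<sigma> Q L)"
    "of_nat (card (discriminant_group smul e \<sigma> Q L)) =
      field_disc TYPE('d) TYPE('k) ^ CARD('n) * of_nat (ideal_norm (disc_ideal TYPE('n) Q L))"
proof -
  obtain S where S: "finite S" "L = ispan S" and span: "span L = UNIV"
    using lat by (auto simp: integer_lattice_def)
  have sub: "integer_submodule smul L" unfolding S(2) by (rule integer_submodule_integer_span)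
  obtain y where y: "lattice_basis (embed ` L) y"
    using integer_lattice_basis[OF S span] by blast
  note order = discriminant_group_order[OF sub y int]
  show "finite (discriminant_group smul e \<sigma> Q L)" by (rule order(1))
  obtain m :: nat where m: "0 < m" "field_disc TYPE('d) TYPE('k) = of_nat m"
    "\<And>b :: 'd \<Rightarrow> 'k. integral_basis b \<Longrightarrow> real m = (det (vec_lambda (\<lambda>i. minkowski (b i))))\<^sup>2"
    using field_disc_nat by metis
  note away = discriminant_order_away_from_prime[OF S y int m(3)]
  have "card (discriminant_group smul e \<sigma> Q L) = m ^ CARD('n) * ideal_norm (disc_ideal TYPE('n) Q L)"
  proof (rule nat_eq_if_eq_away_from_primes)
    show "0 < card (discriminant_group smul e \<sigma> Q L)" by (rule order(2))
    have "0 < ideal_norm (disc_ideal TYPE('n) Q L)"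
      by (rule discriminant_order_away_from_prime(2)[OF S y int m(3) two_is_prime_nat])
    then show "0 < m ^ CARD('n) * ideal_norm (disc_ideal TYPE('n) Q L)"
      using m(1) by simp
    fix p :: nat assume "prime p"
    then obtain k t where kt: "\<not> p dvd k" "\<not> p dvd t"
      "card (discriminant_group smul e \<sigma> Q L) * k\<^sup>2 = m ^ CARD('n) * (t * ideal_norm (disc_ideal TYPE('n) Q L))"
      using away(1) by blast
    have "\<not> p dvd k\<^sup>2" using kt(1) \<open>prime p\<close> prime_dvd_power by blast
    moreover have "card (discriminant_group smul e \<sigma> Q L) * k\<^sup>2
        = m ^ CARD('n) * ideal_norm (disc_ideal TYPE('n) Q L) * t"
      using kt(3) by (simp add: mult_ac)
    ultimately show "\<exists>s t. \<not> p dvd s \<and> \<not> p dvd t \<and>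
        card (discriminant_group smul e \<sigma> Q L) * s = m ^ CARD('n) * ideal_norm (disc_ideal TYPE('n) Q L) * t"
      using kt(2) by blast
  qed
  then show "of_nat (card (discriminant_group smul e \<sigma> Q L)) =
      field_disc TYPE('d) TYPE('k) ^ CARD('n) * of_nat (ideal_norm (disc_ideal TYPE('n) Q L))"
    by (simp add: m(2))
qed

abbreviation "corv \<equiv> cor_map smul e \<sigma>"

section \<open>The action of the field on the corestriction\<close>

lemma cor_map_simps:
  "corv (v + w) = corv v + corv w" "corv (smul (of_rat q) v) = of_rat q *\<^sub>R corv v"
  by (simp_all add: vec_eq_iff cor_map_nth coord_simps emb_simps)

lemma linear_cor_map: "Vector_Spaces.linear (\<lambda>q::rat. smul (of_rat q)) (\<lambda>q::rat. (*\<^sub>R) (of_rat q)) corv"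
proof -
  have "vector_space (\<lambda>q::rat. smul (of_rat q))"
    by unfold_locales (simp_all add: of_rat_add of_rat_mult scale_left_distrib scale_right_distrib)
  moreover have "vector_space (\<lambda>q::rat. (*\<^sub>R) (of_rat q) :: real^'n^'d \<Rightarrow> _)"
    by unfold_locales (simp_all add: of_rat_add of_rat_mult scaleR_left_distrib scaleR_right_distrib)
  ultimately show ?thesis
    by (simp add: Vector_Spaces.linear_def module_hom_def module_hom_axioms_def module_iff_vector_space cor_map_simps)
qed

lemma inj_cor_map: "inj corv"
  using inj_embed by (auto simp: inj_def embed_eq)

lemma cor_mult_cor_map: "cor_mult smul e \<sigma> k (corv v) = corv (smul k v)"
proof -
  have "corv v \<in> cor_space smul e \<sigma>" by (simp add: cor_space_def)
  then have "cor_mult smul e \<sigma> k (corv v) = (\<chi> j. \<sigma> j k *\<^sub>R (corv v $ j))"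
    by (simp add: cor_mult_def)
  also have "\<dots> = corv (smul k v)"
    by (simp add: vec_eq_iff cor_map_nth coord_simps emb_simps)
  finally show ?thesis .
qed

lemma cor_mult_embedding: "rat_End_embedding (cor_space smul e \<sigma>) (cor_mult smul e \<sigma>)"
  unfolding rat_End_embedding_def
proof (intro conjI allI)
  let ?C = "cor_space smul e \<sigma>" and ?phi = "cor_mult smul e \<sigma>"
  have outside: "?phi k x = undefined" if "x \<notin> ?C" for k x using that by (simp add: cor_mult_def)
  have C: "x \<in> ?C \<longleftrightarrow> (\<exists>v. x = corv v)" for x by (auto simp: cor_space_def)
  show "range ?phi \<subseteq> rat_End ?C"
  proof (intro image_subsetI)
    fix k
    have "?phi k \<in> ?C \<rightarrow>\<^sub>E ?C"
    proof (rule PiE_I)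
      fix x assume "x \<in> ?C"
      then obtain v where "x = corv v" using C by blast
      then show "?phi k x \<in> ?C" by (simp add: cor_mult_cor_map) (simp add: cor_space_def)
    qed (rule outside)
    moreover have "?phi k (x + y) = ?phi k x + ?phi k y" if "x \<in> ?C" "y \<in> ?C" for x y
      using that by (auto simp: C cor_mult_cor_map scale_right_distrib simp flip: cor_map_simps(1))
    moreover have "?phi k (of_rat q *\<^sub>R x) = of_rat q *\<^sub>R ?phi k x" if "x \<in> ?C" for x and q :: rat
      using that by (auto simp: C cor_mult_cor_map mult.commute simp flip: cor_map_simps(2))
    ultimately show "?phi k \<in> rat_End ?C" by (simp add: rat_End_def)
  qed
  show "inj ?phi"
  proof (rule injI)
    fix k l assume "?phi k = ?phi l"
    then have "corv (smul k (e undefined)) = corv (smul l (e undefined))"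
      by (metis cor_mult_cor_map)
    then have "smul k (e undefined) = smul l (e undefined)" by (rule injD[OF inj_cor_map])
    then have "coord undefined (smul k (e undefined)) = coord undefined (smul l (e undefined))" by (rule arg_cong)
    then show "k = l" by (simp add: coord_simps coord_e)
  qed
  show "?phi 1 = (\<lambda>x\<in>?C. x)"
    by (rule ext) (auto simp: outside C cor_mult_cor_map restrict_def)
  show "?phi (k + l) = (\<lambda>x\<in>?C. ?phi k x + ?phi l x)" for k l
    by (rule ext) (auto simp: outside C cor_mult_cor_map restrict_def scale_left_distrib cor_map_simps)
  show "?phi (k * l) = compose ?C (?phi k) (?phi l)" for k l
    by (rule ext) (auto simp: outside C cor_mult_cor_map compose_def restrict_def)
qed

lemma cor_mult_integral:
  assumes L: "integer_submodule smul L" and k: "k \<in> ring_of_integers"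
  shows "cor_mult smul e \<sigma> k \<in> int_End (cor_space smul e \<sigma>) (corv ` L)"
  using cor_mult_embedding integer_submoduleD(3)[OF L k]
  by (auto simp: int_End_def rat_End_embedding_def cor_mult_cor_map)

end

theorem lemma4p2:
  fixes smul :: "'k::field_char_0 \<Rightarrow> 'v::ab_group_add \<Rightarrow> 'v"
    and Q :: "'v \<Rightarrow> 'v \<Rightarrow> 'k"
    and \<sigma> :: "'d::finite \<Rightarrow> 'k \<Rightarrow> real"
    and e :: "'n::finite \<Rightarrow> 'v"
  assumes "totally_real_field TYPE('k)"
    and "field_degree TYPE('k) = CARD('d)"
    and "bij_betw \<sigma> UNIV real_embeddings"
    and "vector_space smul"
    and "basis_family smul e"
    and "nondegenerate_symmetric_form smul Q"
  shows
    "let C = cor_space smul e \<sigma>; f = cor_map smul e \<sigma>;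
         \<phi> = cor_mult smul e \<sigma>; Q0 = cor_form e \<sigma> Q in
     \<comment> \<open>\<open>f\<close> is an isomorphism of \<open>\<rat>\<close>-vector spaces onto \<open>C\<close>\<close>
     (Vector_Spaces.linear (\<lambda>q::rat. smul (of_rat q)) (\<lambda>q::rat. (*\<^sub>R) (of_rat q)) f \<and>
      bij_betw f UNIV C) \<and>
     \<comment> \<open>(1)\<close>
     rat_End_embedding C \<phi> \<and> (\<forall>k v. \<phi> k (f v) = f (smul k v)) \<and>
     (\<forall>L. integer_lattice smul L \<longrightarrow> (\<forall>k\<in>ring_of_integers. \<phi> k \<in> int_End C (f ` L))) \<and>
     \<comment> \<open>(2)\<close>
     (\<forall>x\<in>C. \<forall>y\<in>C. Q0 x y \<in> \<rat>) \<and>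
     (\<forall>k v w. Q0 (\<phi> k (f v)) (f w) = of_rat (field_trace (k * Q v w))) \<and>
     \<comment> \<open>order of the discriminant group\<close>
     (\<forall>L. integer_lattice smul L \<and> (\<forall>v\<in>L. \<forall>w\<in>L. Q v w \<in> ring_of_integers) \<longrightarrow>
        finite (discriminant_group smul e \<sigma> Q L) \<and>
        of_nat (card (discriminant_group smul e \<sigma> Q L)) =
          field_disc TYPE('d) TYPE('k) ^ CARD('n) * of_nat (ideal_norm (disc_ideal TYPE('n) Q L)))"
proof -
  interpret vector_space smul by fact
  interpret real_embedding_form \<sigma> smul e Q
    using assms by unfold_locales auto
  have "bij_betw (cor_map smul e \<sigma>) UNIV (cor_space smul e \<sigma>)"
    using inj_cor_map by (simp add: bij_betw_def cor_space_def)
  moreover have "cor_mult smul e \<sigma> k \<in> int_End (cor_space smul e \<sigma>) (cor_map smul e \<sigma> ` L)"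
    if "integer_lattice smul L" "k \<in> ring_of_integers" for L k
    using that cor_mult_integral[OF integer_submodule_integer_span] by (auto simp: integer_lattice_def)
  moreover have "cor_form e \<sigma> Q x y \<in> \<rat>" if "x \<in> cor_space smul e \<sigma>" "y \<in> cor_space smul e \<sigma>" for x y
    using that by (auto simp: cor_space_def cor_form_cor_map)
  moreover have "cor_form e \<sigma> Q (cor_mult smul e \<sigma> k (cor_map smul e \<sigma> v)) (cor_map smul e \<sigma> w)
      = of_rat (field_trace (k * Q v w))" for k v w
    by (simp add: cor_mult_cor_map cor_form_cor_map form_simps)
  ultimately show ?thesis
    unfolding Let_def
    using linear_cor_map cor_mult_embedding cor_mult_cor_map discriminant_group_card by blast
qed

end
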